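(* Let $F,\tilde F\in L^\infty(\Omega)$ and $q,\tilde q\in\mathcal A_q$, and suppose in addition that $q\in W^{2,2}(\Omega)\cap W^{1,\infty}(\Omega)$. Suppose that $\|q\|_{W^{1,2}(\Omega)}\le C$ and $\|\tilde q\|_{W^{1,2}(\Omega)}\le C$ for a constant $C$. Let $w$ be the weak solution of $-\nabla\cdot(q\nabla w)=F$ in $\Omega$, $w=0$ on $\partial\Omega$, and let $\tilde w$ be the weak solution of $-\nabla\cdot(\tilde q\nabla\tilde w)=\tilde F$ in $\Omega$, $\tilde w=0$ on $\partial\Omega$. Then there is a constant $c>0$, independent of $\tilde q$ and $\tilde F$ (it may depend on $\Omega$, $\underline c_q$, $\bar c_q$, $C$, $q$ and $F$), such that $$\int_\Omega \frac{(q-\tilde q)^2}{q^2}\left(q|\nabla w|^2+Fw\right)\,dx\le c\left(\|w-\tilde w\|_{W^{1,2}(\Omega)}+\|F-\tilde F\|_{L^2(\Omega)}\right).$$ Moreover, if there are constants $\beta\ge 0$ and $c_0>0$ such that $$(q|\nabla w|^2+Fw)(x)\ge c_0\,\mathrm{dist}(x,\partial\Omega)^\beta\quad\text{for a.e. }x\in\Omega,$$ then, with a constant $c>0$ that may additionally depend on $\beta$ and $c_0$, $$\|q-\tilde q\|_{L^2(\Omega)}\le c\left(\|w-\tilde w\|_{W^{1,2}(\Omega)}+\|F-\tilde F\|_{L^2(\Omega)}\right)^{\frac1{2(1+\beta)}}.$$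
   Context: $\Omega\subset\mathbb R^d$ ($d=1,2,3$) is a convex polyhedral domain with boundary $\partial\Omega$. For fixed constants $0<\underline c_q\le\bar c_q$, the admissible set is $\mathcal A_q=\{q\in W^{1,2}(\Omega):\underline c_q\le q\le\bar c_q\text{ a.e. in }\Omega\}$. *)

theory Defs
  imports "HOL-Analysis.Analysis"
begin

text \<open>Elements of \<open>L\<^sup>p(\<Omega>)\<close> and of Sobolev spaces on \<open>\<Omega>\<close> are represented by functions on the whole
  space, whose values outside \<open>\<Omega>\<close> and on null sets are irrelevant.\<close>

definition convex_polyhedral_domain :: "'a::euclidean_space set \<Rightarrow> bool" where
  "convex_polyhedral_domain \<Omega> \<longleftrightarrow> \<Omega> \<noteq> {} \<and> open \<Omega> \<and> convex \<Omega> \<and> polytope (closure \<Omega>)"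

primrec C_k :: "nat \<Rightarrow> ('a::euclidean_space \<Rightarrow> real) \<Rightarrow> bool" where
  "C_k 0 f \<longleftrightarrow> continuous_on UNIV f"
| "C_k (Suc k) f \<longleftrightarrow> f differentiable_on UNIV \<and>
     (\<forall>i\<in>Basis. C_k k (\<lambda>x. frechet_derivative f (at x) i))"

text \<open>\<open>C\<^sub>c\<^sup>\<infinity>(\<Omega>)\<close>, each function being extended by zero to the whole space.\<close>

definition test_functions :: "'a::euclidean_space set \<Rightarrow> ('a \<Rightarrow> real) set" where
  "test_functions \<Omega> =
     {\<phi>. (\<forall>k. C_k k \<phi>) \<and> compact (closure {x. \<phi> x \<noteq> 0}) \<and> closure {x. \<phi> x \<noteq> 0} \<subseteq> \<Omega>}"

definition locally_integrable_on :: "('a::euclidean_space \<Rightarrow> real) \<Rightarrow> 'a set \<Rightarrow> bool" where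
  "locally_integrable_on u \<Omega> \<longleftrightarrow> (\<forall>K. compact K \<and> K \<subseteq> \<Omega> \<longrightarrow> integrable (lebesgue_on K) u)"

definition has_weak_pderiv ::
    "'a::euclidean_space set \<Rightarrow> 'a \<Rightarrow> ('a \<Rightarrow> real) \<Rightarrow> ('a \<Rightarrow> real) \<Rightarrow> bool" where
  "has_weak_pderiv \<Omega> i u g \<longleftrightarrow> locally_integrable_on u \<Omega> \<and> locally_integrable_on g \<Omega> \<and>
     (\<forall>\<phi>\<in>test_functions \<Omega>.
        (LINT x|lebesgue_on \<Omega>. u x * frechet_derivative \<phi> (at x) i) =
        - (LINT x|lebesgue_on \<Omega>. g x * \<phi> x))"

text \<open>Weak partial derivatives are unique only up to null sets, so a representative is chosen.
  The result is meaningful only if all weak partial derivatives exist.\<close>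

definition weak_grad :: "'a::euclidean_space set \<Rightarrow> ('a \<Rightarrow> real) \<Rightarrow> 'a \<Rightarrow> 'a" where
  "weak_grad \<Omega> u x = (\<Sum>i\<in>Basis. (SOME g. has_weak_pderiv \<Omega> i u g) x *\<^sub>R i)"

definition L2 :: "'a::euclidean_space set \<Rightarrow> ('a \<Rightarrow> real) set" where
  "L2 \<Omega> = {u \<in> borel_measurable (lebesgue_on \<Omega>). integrable (lebesgue_on \<Omega>) (\<lambda>x. (u x)\<^sup>2)}"

definition Linf :: "'a::euclidean_space set \<Rightarrow> ('a \<Rightarrow> real) set" where
  "Linf \<Omega> = {u \<in> borel_measurable (lebesgue_on \<Omega>). \<exists>M. AE x in lebesgue_on \<Omega>. \<bar>u x\<bar> \<le> M}"

text \<open>\<open>sobolev L k \<Omega>\<close> is \<open>W\<^sup>k\<^sup>,\<^sup>p(\<Omega>)\<close> when \<open>L\<close> is \<open>L\<^sup>p\<close>.\<close>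

primrec sobolev ::
    "('a::euclidean_space set \<Rightarrow> ('a \<Rightarrow> real) set) \<Rightarrow> nat \<Rightarrow> 'a set \<Rightarrow> ('a \<Rightarrow> real) set" where
  "sobolev L 0 \<Omega> = L \<Omega>"
| "sobolev L (Suc k) \<Omega> =
     {u \<in> L \<Omega>. \<forall>i\<in>Basis. \<exists>g\<in>sobolev L k \<Omega>. has_weak_pderiv \<Omega> i u g}"

definition L2_norm :: "'a::euclidean_space set \<Rightarrow> ('a \<Rightarrow> real) \<Rightarrow> real" where
  "L2_norm \<Omega> u = sqrt (LINT x|lebesgue_on \<Omega>. (u x)\<^sup>2)"

definition W12_norm :: "'a::euclidean_space set \<Rightarrow> ('a \<Rightarrow> real) \<Rightarrow> real" where
  "W12_norm \<Omega> u = sqrt ((LINT x|lebesgue_on \<Omega>. (u x)\<^sup>2) +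
                        (LINT x|lebesgue_on \<Omega>. (norm (weak_grad \<Omega> u x))\<^sup>2))"

definition W12_0 :: "'a::euclidean_space set \<Rightarrow> ('a \<Rightarrow> real) set" where
  "W12_0 \<Omega> = {u \<in> sobolev L2 1 \<Omega>. \<exists>\<phi>. (\<forall>n::nat. \<phi> n \<in> test_functions \<Omega>) \<and>
                (\<lambda>n. W12_norm \<Omega> (\<lambda>x. u x - \<phi> n x)) \<longlonglongrightarrow> 0}"

definition admissible :: "'a::euclidean_space set \<Rightarrow> real \<Rightarrow> real \<Rightarrow> ('a \<Rightarrow> real) set" where
  "admissible \<Omega> cl cu = {q \<in> sobolev L2 1 \<Omega>. AE x in lebesgue_on \<Omega>. cl \<le> q x \<and> q x \<le> cu}"

text \<open>The weak solution of \<open>-\<nabla>\<cdot>(q\<nabla>w) = F\<close> in \<open>\<Omega>\<close>, \<open>w = 0\<close> on \<open>\<partial>\<Omega>\<close>.\<close>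

definition weak_solution ::
    "'a::euclidean_space set \<Rightarrow> ('a \<Rightarrow> real) \<Rightarrow> ('a \<Rightarrow> real) \<Rightarrow> ('a \<Rightarrow> real) \<Rightarrow> bool" where
  "weak_solution \<Omega> q F w \<longleftrightarrow> w \<in> W12_0 \<Omega> \<and>
     (\<forall>v\<in>W12_0 \<Omega>. (LINT x|lebesgue_on \<Omega>. q x * (weak_grad \<Omega> w x \<bullet> weak_grad \<Omega> v x)) =
                   (LINT x|lebesgue_on \<Omega>. F x * v x))"

end

theory Submission
  imports Defs
begin

text \<open>
  Let \<open>r = (q - qt) / q = 1 - qt / q\<close>. Testing the equation of \<open>w\<close> with
  \<open>r\<^sup>2 w\<close> expresses \<open>\<integral> F r\<^sup>2 w\<close> through gradients, and the weighted integral becomes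
  \<open>\<integral> r\<^sup>2 (q \<bar>\<nabla>w\<bar>\<^sup>2 + F w) = 2 \<integral> (q - qt) \<nabla>w \<bullet> \<nabla>(r w)\<close>. Testing the equations of \<open>w\<close> and \<open>wt\<close> with
  \<open>r w\<close> and subtracting them gives
  \<open>\<integral> (q - qt) \<nabla>w \<bullet> \<nabla>(r w) = \<integral> (F - Ft) r w - \<integral> qt \<nabla>(w - wt) \<bullet> \<nabla>(r w)\<close>, which the Cauchy-Schwarz
  inequality bounds by the data, once \<open>r w\<close> is bounded in \<open>W\<^sup>1\<^sup>,\<^sup>2\<close>
  (\<open>weighted_identity\<close>, \<open>weighted_estimate\<close>). As \<open>\<nabla>(r w) = r \<nabla>w + w \<nabla>r\<close>, where \<open>r\<close> is bounded and
  \<open>\<nabla>r\<close> is only square integrable, this needs a bound for \<open>w\<close> in \<open>L\<^sup>\<infinity>\<close> that depends on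
  \<open>q\<close>, \<open>F\<close> and \<open>\<Omega>\<close> only.

  The bound for \<open>w\<close> comes from the maximum principle. Since \<open>q\<close> is bounded below and has a bounded
  weak gradient, an explicit function of one coordinate is a supersolution (\<open>barrier\<close>), and a
  smooth function of \<open>w - \<psi>\<close> supported where \<open>w > \<psi>\<close> is used as a test function (\<open>comparison\<close>).

  The products \<open>r w\<close> and \<open>r\<^sup>2 w\<close> are handled by approximation. Mollification turns \<open>q\<close> and \<open>qt\<close> into
  smooth functions with the same bounds (\<open>smooth_approx_sobolev\<close>), the classical product and
  quotient rules survive the limit (\<open>smooth_approx_mult\<close>, \<open>smooth_approx_inverse\<close>), and \<open>w\<close> is
  a limit of smoothly truncated test functions (\<open>div_eq_mult\<close>). The underlying facts are the
  convergence of mollifications in \<open>L\<^sup>2\<close> (\<open>mollify_tendsto_L2\<close>) and the uniqueness of weak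
  derivatives (\<open>weakly_zero_imp_AE_zero\<close>).

  For the second estimate, \<open>\<Omega>\<close> is split at distance \<open>\<rho>\<close> from its boundary. Further inside, the
  weight is at least \<open>c0 \<rho>\<^bsup>\<beta>\<^esup>\<close> and the first estimate applies; the remaining strip has volume at
  most a multiple of \<open>\<rho>\<close>, because \<open>\<Omega>\<close> is convex and bounded (\<open>convex_boundary_strip\<close>). Optimising
  \<open>\<rho>\<close> gives the exponent \<open>1 / (2 (1 + \<beta>))\<close>.
\<close>

section \<open>Calculus of smooth functions\<close>

definition grad :: "('a::euclidean_space \<Rightarrow> real) \<Rightarrow> 'a \<Rightarrow> 'a" where
  "grad f x = (\<Sum>i\<in>Basis. frechet_derivative f (at x) i *\<^sub>R i)"

definition smooth :: "('a::euclidean_space \<Rightarrow> real) \<Rightarrow> bool" where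
  "smooth f \<longleftrightarrow> (\<forall>k. C_k k f)"

lemma C_k_SucI:
  assumes "\<And>x. (f has_derivative D x) (at x)" and "\<And>i. i \<in> Basis \<Longrightarrow> C_k k (\<lambda>x. D x i)"
  shows "C_k (Suc k) f"
proof -
  have "frechet_derivative f (at x) = D x" for x
    using assms(1)[of x] by (metis frechet_derivative_at)
  moreover have "f differentiable_on UNIV"
    using assms(1) by (auto simp: differentiable_on_def differentiable_def)
  ultimately show ?thesis using assms(2) by simp
qed

lemma C_k_SucD:
  assumes "C_k (Suc k) f"
  shows "(f has_derivative frechet_derivative f (at x)) (at x)"
    and "i \<in> Basis \<Longrightarrow> C_k k (\<lambda>x. frechet_derivative f (at x) i)"
  using assms by (auto simp: differentiable_on_def frechet_derivative_works)

lemma C_k_Suc_imp: "C_k (Suc k) f \<Longrightarrow> C_k k f"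
proof (induction k arbitrary: f)
  case 0
  then show ?case by (simp add: differentiable_imp_continuous_on)
next
  case (Suc k)
  show ?case
    using C_k_SucD[OF Suc.prems] Suc.IH by (intro C_k_SucI) blast+
qed

lemma C_k_const: "C_k k (\<lambda>x. c)"
proof (induction k arbitrary: c)
  case (Suc k)
  show ?case by (rule C_k_SucI[where D="\<lambda>x h. 0"]) (auto intro: Suc)
qed simp

lemma C_k_add: "C_k k f \<Longrightarrow> C_k k g \<Longrightarrow> C_k k (\<lambda>x. f x + g x)"
proof (induction k arbitrary: f g)
  case (Suc k)
  note f = C_k_SucD[OF Suc.prems(1)] and g = C_k_SucD[OF Suc.prems(2)]
  show ?case
    by (rule C_k_SucI[OF has_derivative_add[OF f(1) g(1)]]) (rule Suc.IH[OF f(2) g(2)])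
qed (simp add: continuous_on_add)

lemma C_k_mult: "C_k k f \<Longrightarrow> C_k k g \<Longrightarrow> C_k k (\<lambda>x. f x * g x)"
proof (induction k arbitrary: f g)
  case (Suc k)
  note f = C_k_SucD[OF Suc.prems(1)] and g = C_k_SucD[OF Suc.prems(2)]
  show ?case
    by (rule C_k_SucI[OF has_derivative_mult[OF f(1) g(1)]])
       (rule C_k_add[OF Suc.IH[OF C_k_Suc_imp[OF Suc.prems(1)] g(2)]
                        Suc.IH[OF f(2) C_k_Suc_imp[OF Suc.prems(2)]]])
qed (simp add: continuous_on_mult)

lemma C_k_affine: "C_k k f \<Longrightarrow> C_k k (\<lambda>x. f (a + s *\<^sub>R x))"
proof (induction k arbitrary: f)
  case 0
  have "continuous_on UNIV (\<lambda>x. a + s *\<^sub>R x)" by (intro continuous_intros)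
  from continuous_on_compose2[OF _ this, of UNIV f] 0 show ?case by simp
next
  case (Suc k)
  note f = C_k_SucD[OF Suc.prems(1)]
  have "((\<lambda>x. f (a + s *\<^sub>R x)) has_derivative
         (\<lambda>h. s * frechet_derivative f (at (a + s *\<^sub>R x)) h)) (at x)" for x
  proof -
    have "((\<lambda>x. f (a + s *\<^sub>R x)) has_derivative
         (\<lambda>h. frechet_derivative f (at (a + s *\<^sub>R x)) (s *\<^sub>R h))) (at x)"
      by (rule has_derivative_compose[where g=f, OF _ f(1)]) (auto intro!: derivative_eq_intros)
    then show ?thesis
      using linear_scale[OF has_derivative_linear[OF f(1)]] by simp
  qed
  moreover have "C_k k (\<lambda>x. s * frechet_derivative f (at (a + s *\<^sub>R x)) i)" if "i \<in> Basis" for i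
    using C_k_mult[OF C_k_const Suc.IH[OF f(2)[OF that]]] .
  ultimately show ?case
    by (rule C_k_SucI[where D="\<lambda>x h. s * frechet_derivative f (at (a + s *\<^sub>R x)) h"])
qed

lemma C_k_inner_Basis: "C_k k (\<lambda>x::'a::euclidean_space. x \<bullet> i)"
proof (cases k)
  case (Suc m)
  show ?thesis unfolding Suc
    by (rule C_k_SucI[where D="\<lambda>x h. h \<bullet> i"])
       (rule bounded_linear_imp_has_derivative[OF bounded_linear_inner_left], rule C_k_const)
qed (simp add: continuous_on_inner)

lemma C_k_realI:
  fixes g :: "real \<Rightarrow> real"
  assumes "\<And>t. (g has_field_derivative g' t) (at t)" and "C_k k g'"
  shows "C_k (Suc k) g"
  using assms
  by (intro C_k_SucI[where D="\<lambda>t h. g' t * h"]) (auto simp: has_field_derivative_def)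

lemma C_k_compose:
  fixes g :: "real \<Rightarrow> real"
  shows "C_k k g \<Longrightarrow> C_k k f \<Longrightarrow> C_k k (\<lambda>x. g (f x))"
proof (induction k arbitrary: f g)
  case 0
  then show ?case using continuous_on_compose2[of UNIV g UNIV f] by simp
next
  case (Suc k)
  note g = C_k_SucD[OF Suc.prems(1)] and f = C_k_SucD[OF Suc.prems(2)]
  let ?g' = "\<lambda>t. frechet_derivative g (at t) 1"
  have "((\<lambda>x. g (f x)) has_derivative
         (\<lambda>h. ?g' (f x) * frechet_derivative f (at x) h)) (at x)" for x
  proof -
    have lin: "frechet_derivative g (at t) s = ?g' t * s" for t s
      using linear_scale[OF has_derivative_linear[OF g(1)], of t s 1] by (simp add: mult.commute)
    show ?thesis
      using has_derivative_compose[OF f(1)[of x] g(1)] by (subst (asm) lin)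
  qed
  moreover have "C_k k (\<lambda>x. ?g' (f x) * frechet_derivative f (at x) i)" if "i \<in> Basis" for i
    using C_k_mult[OF Suc.IH[OF g(2) C_k_Suc_imp[OF Suc.prems(2)]] f(2)[OF that]] by simp
  ultimately show ?case
    by (rule C_k_SucI[where D="\<lambda>x h. ?g' (f x) * frechet_derivative f (at x) h"])
qed

lemma smooth_const: "smooth (\<lambda>x. c)"
  and smooth_add: "smooth f \<Longrightarrow> smooth g \<Longrightarrow> smooth (\<lambda>x. f x + g x)"
  and smooth_mult: "smooth f \<Longrightarrow> smooth g \<Longrightarrow> smooth (\<lambda>x. f x * g x)"
  and smooth_affine: "smooth f \<Longrightarrow> smooth (\<lambda>x. f (a + s *\<^sub>R x))"
  and smooth_inner: "smooth (\<lambda>x. x \<bullet> i)"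
  and smooth_compose: "smooth u \<Longrightarrow> smooth f \<Longrightarrow> smooth (\<lambda>x. u (f x :: real))"
  by (auto simp: smooth_def C_k_const C_k_add C_k_mult C_k_affine C_k_inner_Basis C_k_compose)

lemma smooth_minus: "smooth f \<Longrightarrow> smooth (\<lambda>x. - f x)"
  using smooth_mult[OF smooth_const[of "-1"], of f] by simp

lemma smooth_diff: "smooth f \<Longrightarrow> smooth g \<Longrightarrow> smooth (\<lambda>x. f x - g x)"
  using smooth_add[OF _ smooth_minus, of f g] by simp

lemma smooth_sum: "(\<And>j. j \<in> J \<Longrightarrow> smooth (f j)) \<Longrightarrow> smooth (\<lambda>x. \<Sum>j\<in>J. f j x)"
  by (induction J rule: infinite_finite_induct) (auto intro: smooth_add simp: smooth_const)

text \<open>A family of functions such as \<open>{exp}\<close> or \<open>{sin, cos}\<close>, in which every derivative is a linear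
  combination of members, consists of smooth functions: the order of differentiability of all
  members rises together.\<close>

lemma smooth_realI:
  fixes g :: "nat \<Rightarrow> real \<Rightarrow> real"
  assumes der: "\<And>j t. (g j has_field_derivative
                   (\<Sum>l\<in>J j. c j l * g l t)) (at t)"
  shows "smooth (g j)"
proof -
  have "\<forall>j. C_k k (g j)" for k
  proof (induction k)
    case 0
    have "continuous_on UNIV (g j)" for j
      using der DERIV_isCont by (blast intro: continuous_at_imp_continuous_on)
    then show ?case by simp
  next
    case (Suc k)
    have "C_k k (\<lambda>t. \<Sum>l\<in>A. c j l * g l t)" for j A
      by (induction A rule: infinite_finite_induct)
         (auto intro!: C_k_add C_k_mult C_k_const Suc[rule_format])
    then show ?case using C_k_realI[OF der] by blast
  qed
  then show ?thesis by (simp add: smooth_def)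
qed

lemma smooth_exp: "smooth (exp :: real \<Rightarrow> real)"
  using smooth_realI[where g="\<lambda>_. exp" and J="\<lambda>_. {0}" and c="\<lambda>_ _. 1"] DERIV_exp by simp

lemma smooth_sin: "smooth (sin :: real \<Rightarrow> real)"
proof -
  have "smooth ((\<lambda>j. if j = 0 then sin else cos :: real \<Rightarrow> real) (0::nat))"
    by (rule smooth_realI[where J="\<lambda>j. {1 - j}" and c="\<lambda>j l. if j = 0 then 1 else -1"])
       (auto intro!: derivative_eq_intros)
  then show ?thesis by simp
qed

lemma smooth_inverse:
  assumes "smooth f" and "\<And>x. f x \<noteq> 0"
  shows "smooth (\<lambda>x. inverse (f x))"
proof -
  have "C_k k (\<lambda>x. inverse (f x))" for k
  proof (induction k)
    case 0
    have "continuous_on UNIV f" using assms(1) by (metis C_k.simps(1) smooth_def)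
    then show ?case using assms(2) by (simp add: continuous_on_inverse)
  next
    case (Suc k)
    have f: "C_k (Suc k) f" using assms(1) by (simp add: smooth_def del: C_k.simps)
    note D = C_k_SucD[OF f]
    have m: "C_k k (\<lambda>x. - h x)" if "C_k k h" for h :: "'a \<Rightarrow> real"
      using C_k_mult[OF C_k_const that, of "-1"] by simp
    have "C_k k (\<lambda>x. - (inverse (f x) * frechet_derivative f (at x) i * inverse (f x)))"
      if "i \<in> Basis" for i
      by (intro m C_k_mult Suc D(2) that)
    moreover have "((\<lambda>x. inverse (f x)) has_derivative
        (\<lambda>h. - (inverse (f x) * frechet_derivative f (at x) h * inverse (f x)))) (at x)" for x
      using Deriv.has_derivative_inverse[OF assms(2) D(1)] .
    ultimately show ?case
      by (rule C_k_SucI[where D="\<lambda>x h. - (inverse (f x) * frechet_derivative f (at x) h * inverse (f x))",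
            rotated])
  qed
  then show ?thesis by (simp add: smooth_def)
qed

lemma smooth_has_derivative:
  assumes "smooth f"
  shows "(f has_derivative (\<lambda>h. grad f x \<bullet> h)) (at x)"
proof -
  have D: "(f has_derivative frechet_derivative f (at x)) (at x)"
    using assms C_k_SucD(1)[of 0 f x] by (simp add: smooth_def del: C_k.simps)
  interpret bounded_linear "frechet_derivative f (at x)"
    using D by (rule has_derivative_bounded_linear)
  have "frechet_derivative f (at x) h = grad f x \<bullet> h" for h
  proof -
    have "frechet_derivative f (at x) h = frechet_derivative f (at x) (\<Sum>i\<in>Basis. (h \<bullet> i) *\<^sub>R i)"
      by (simp add: euclidean_representation)
    also have "\<dots> = (\<Sum>i\<in>Basis. (h \<bullet> i) * frechet_derivative f (at x) i)"
      by (simp add: sum scaleR)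
    also have "\<dots> = grad f x \<bullet> h"
      by (simp add: grad_def inner_sum_right inner_commute[of _ h] mult.commute)
    finally show ?thesis .
  qed
  then have "frechet_derivative f (at x) = (\<lambda>h. grad f x \<bullet> h)" by blast
  then show ?thesis using D by simp
qed

lemma frechet_derivative_smooth: "smooth f \<Longrightarrow> frechet_derivative f (at x) h = grad f x \<bullet> h"
  using smooth_has_derivative frechet_derivative_at by metis

lemma grad_eqI:
  assumes "(f has_derivative (\<lambda>h. G \<bullet> h)) (at x)"
  shows "grad f x = G"
proof -
  have "frechet_derivative f (at x) = (\<lambda>h. G \<bullet> h)" using assms frechet_derivative_at by metis
  then show ?thesis by (simp add: grad_def euclidean_representation)
qed

lemma grad_const [simp]: "grad (\<lambda>x. c) x = 0"
  by (rule grad_eqI) simp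

lemma grad_add: "smooth f \<Longrightarrow> smooth g \<Longrightarrow> grad (\<lambda>x. f x + g x) x = grad f x + grad g x"
  by (rule grad_eqI) (auto intro!: derivative_eq_intros smooth_has_derivative simp: inner_add_left)

lemma grad_diff: "smooth f \<Longrightarrow> smooth g \<Longrightarrow> grad (\<lambda>x. f x - g x) x = grad f x - grad g x"
  by (rule grad_eqI) (auto intro!: derivative_eq_intros smooth_has_derivative simp: inner_diff_left)

lemma grad_mult:
  "smooth f \<Longrightarrow> smooth g \<Longrightarrow> grad (\<lambda>x. f x * g x) x = f x *\<^sub>R grad g x + g x *\<^sub>R grad f x"
  by (rule grad_eqI)
     (auto intro!: derivative_eq_intros smooth_has_derivative simp: inner_add_left)

lemma grad_inverse:
  "smooth f \<Longrightarrow> f x \<noteq> 0 \<Longrightarrow> grad (\<lambda>x. inverse (f x)) x = - (inverse (f x))\<^sup>2 *\<^sub>R grad f x"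
  by (rule grad_eqI)
     (auto intro!: derivative_eq_intros smooth_has_derivative simp: power2_eq_square)

lemma grad_compose:
  assumes "smooth f" and "(u has_field_derivative u') (at (f x))"
  shows "grad (\<lambda>x. u (f x)) x = u' *\<^sub>R grad f x"
proof (rule grad_eqI)
  show "((\<lambda>x. u (f x)) has_derivative (\<lambda>h. (u' *\<^sub>R grad f x) \<bullet> h)) (at x)"
    using has_derivative_compose[OF smooth_has_derivative[OF assms(1)]
        assms(2)[unfolded has_field_derivative_def]] by simp
qed

lemma smooth_grad_component:
  assumes "smooth f" and "i \<in> Basis"
  shows "smooth (\<lambda>x. grad f x \<bullet> i)"
  unfolding smooth_def
proof
  fix k
  have "C_k k (\<lambda>x. frechet_derivative f (at x) i)"
    using assms by (intro C_k_SucD(2)) (simp_all add: smooth_def del: C_k.simps)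
  then show "C_k k (\<lambda>x. grad f x \<bullet> i)" using assms by (simp add: frechet_derivative_smooth)
qed

lemma smooth_continuous: "smooth f \<Longrightarrow> continuous_on S f"
  by (metis C_k.simps(1) continuous_on_subset smooth_def subset_UNIV)

lemma continuous_grad: "smooth f \<Longrightarrow> continuous_on S (grad f)"
  by (subst continuous_on_componentwise) (auto intro: smooth_continuous smooth_grad_component)

lemma smooth_inner_self: "smooth (\<lambda>x::'a::euclidean_space. x \<bullet> x)"
  by (subst euclidean_inner) (intro smooth_sum smooth_mult smooth_inner)

subsection \<open>The flat function \<open>exp (-1/t)\<close>\<close>

text \<open>The factor \<open>t\<^sup>-\<^sup>j\<close> makes the family closed under differentiation, so that smoothness of all of
  its members follows from one differentiation rule.\<close>

definition flat :: "nat \<Rightarrow> real \<Rightarrow> real" where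
  "flat j t = (if t > 0 then inverse t ^ j * exp (- inverse t) else 0)"

lemma flat_tendsto_0: "((\<lambda>t. inverse t ^ j * exp (- inverse t)) \<longlongrightarrow> 0) (at_right (0::real))"
proof -
  have "((\<lambda>s::real. s ^ j / exp s) \<longlongrightarrow> 0) at_top" by (rule tendsto_power_div_exp_0)
  then have "((\<lambda>t. inverse t ^ j / exp (inverse t)) \<longlongrightarrow> 0) (at_right (0::real))"
    by (rule filterlim_compose[OF _ filterlim_inverse_at_top_right])
  then show ?thesis by (simp add: exp_minus divide_inverse)
qed

lemma DERIV_flat: "(flat j has_field_derivative flat (j + 2) t - j * flat (j + 1) t) (at t)"
proof -
  consider "t > 0" | "t < 0" | "t = 0" by linarith
  then show ?thesis
  proof cases
    case 1
    have "((\<lambda>t. inverse t ^ j * exp (- inverse t)) has_field_derivative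
          flat (j + 2) t - j * flat (j + 1) t) (at t)"
    proof -
      have "((\<lambda>t. inverse t ^ j * exp (- inverse t)) has_field_derivative
          real j * inverse t ^ (j - 1) * (- (inverse t)\<^sup>2) * exp (- inverse t)
          + inverse t ^ j * (exp (- inverse t) * (inverse t)\<^sup>2)) (at t)"
        using 1 by (auto intro!: derivative_eq_intros simp: power2_eq_square)
      moreover have "real j * inverse t ^ (j - 1) * (- (inverse t)\<^sup>2) * exp (- inverse t)
          + inverse t ^ j * (exp (- inverse t) * (inverse t)\<^sup>2)
        = flat (j + 2) t - j * flat (j + 1) t"
        using 1 by (cases j) (simp_all add: flat_def power2_eq_square algebra_simps)
      ultimately show ?thesis by (simp only:)
    qed
    moreover have "eventually (\<lambda>t. inverse t ^ j * exp (- inverse t) = flat j t) (nhds t)"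
      using eventually_nhds_in_open[of "{0<..}" t] 1
      by (auto simp: flat_def elim!: eventually_mono)
    ultimately show ?thesis by (rule iffD1[OF DERIV_cong_ev[OF refl _ refl], rotated])
  next
    case 2
    have "eventually (\<lambda>t. 0 = flat j t) (nhds t)"
      using eventually_nhds_in_open[of "{..<0}" t] 2
      by (auto simp: flat_def elim!: eventually_mono)
    moreover have "((\<lambda>t. 0) has_field_derivative flat (j + 2) t - j * flat (j + 1) t) (at t)"
      using 2 by (simp add: flat_def)
    ultimately show ?thesis by (rule iffD1[OF DERIV_cong_ev[OF refl _ refl]])
  next
    case 3
    have "((\<lambda>h. flat j h / h) \<longlongrightarrow> 0) (at_right 0)"
      by (rule Lim_transform_eventually[OF flat_tendsto_0[of "Suc j"]])
         (auto simp: flat_def eventually_at_right_field divide_inverse intro!: exI[of _ 1])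
    moreover have "((\<lambda>h. flat j h / h) \<longlongrightarrow> 0) (at_left 0)"
      by (rule Lim_transform_eventually[OF tendsto_const[of 0]])
         (auto simp: flat_def eventually_at_left_field intro!: exI[of _ "-1"])
    ultimately have "((\<lambda>h. flat j h / h) \<longlongrightarrow> 0) (at 0)"
      by (rule filterlim_split_at[rotated])
    then show ?thesis by (simp add: 3 DERIV_def flat_def)
  qed
qed

lemma smooth_flat: "smooth (flat j)"
  by (rule smooth_realI[where J="\<lambda>j. {j + 1, j + 2}" and c="\<lambda>j l. if l = j + 2 then 1 else - real j"])
     (use DERIV_flat in \<open>simp add: algebra_simps\<close>)

lemma flat_nonneg: "flat j t \<ge> 0"
  and flat_pos: "t > 0 \<Longrightarrow> flat j t > 0"
  and flat_eq_0: "t \<le> 0 \<Longrightarrow> flat j t = 0"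
  by (auto simp: flat_def)

lemma flat_bounded:
  obtains B where "\<And>t. flat j t \<le> B"
proof
  fix t
  have "s ^ j * exp (- s) \<le> fact j" if "s \<ge> 0" for s :: real
  proof -
    have "s ^ j / fact j \<le> exp s"
      using sum_le_suminf[OF summable_exp[of s], of "{j}"] that
      by (simp add: exp_def divide_inverse mult.commute)
    then show ?thesis by (simp add: exp_minus field_simps)
  qed
  then show "flat j t \<le> fact j" by (auto simp: flat_def)
qed

section \<open>Mollification\<close>

definition conv :: "('a::euclidean_space \<Rightarrow> real) \<Rightarrow> ('a \<Rightarrow> real) \<Rightarrow> 'a \<Rightarrow> real" where
  "conv f \<eta> x = (LINT y|lebesgue. f y * \<eta> (x - y))"

lemma continuous_imp_lebesgue_measurable:
  "continuous_on UNIV (f :: 'a::euclidean_space \<Rightarrow> 'b::real_normed_vector) \<Longrightarrow> f \<in> borel_measurable lebesgue"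
  by (simp add: borel_measurable_continuous_onI measurable_completion)

lemma bounded_if_vanishing_outside_ball:
  fixes \<zeta> :: "'a::euclidean_space \<Rightarrow> 'b::real_normed_vector"
  assumes "continuous_on UNIV \<zeta>" and "\<And>z. norm z > \<epsilon> \<Longrightarrow> \<zeta> z = 0"
  obtains B where "B > 0" and "\<And>z. norm (\<zeta> z) \<le> B"
proof -
  have "compact (\<zeta> ` cball 0 \<epsilon>)"
    using assms(1) by (intro compact_continuous_image) (auto intro: continuous_on_subset)
  then obtain B where B: "B > 0" "\<And>z. z \<in> cball 0 \<epsilon> \<Longrightarrow> norm (\<zeta> z) \<le> B"
    using compact_imp_bounded bounded_pos by (metis imageI)
  have "norm (\<zeta> z) \<le> B" for z
    using B assms(2)[of z] by (cases "norm z > \<epsilon>") auto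
  then show thesis using B(1) that by blast
qed

lemma integrable_if_vanishing_outside_ball:
  fixes \<zeta> :: "'a::euclidean_space \<Rightarrow> 'b::euclidean_space"
  assumes "continuous_on UNIV \<zeta>" and "\<And>z. norm z > \<epsilon> \<Longrightarrow> \<zeta> z = 0"
  shows "integrable lebesgue \<zeta>"
proof -
  obtain B where B: "B > 0" "\<And>z. norm (\<zeta> z) \<le> B"
    using bounded_if_vanishing_outside_ball assms by blast
  show ?thesis
  proof (rule Bochner_Integration.integrable_bound)
    show "integrable lebesgue (\<lambda>z. B * indicator (cball (0::'a) \<epsilon>) z)"
      by (intro integrable_mult_right integrable_real_indicator)
         (use emeasure_bounded_finite[OF bounded_cball, of "0::'a" \<epsilon>] in \<open>simp_all add: less_top\<close>)
    show "AE z in lebesgue. norm (\<zeta> z) \<le> norm (B * indicator (cball (0::'a) \<epsilon>) z)"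
      using B assms(2) by (intro AE_I2) (auto simp: indicator_def)
  qed (rule continuous_imp_lebesgue_measurable[OF assms(1)])
qed

lemma uniformly_continuous_if_vanishing_outside_ball:
  fixes \<zeta> :: "'a::euclidean_space \<Rightarrow> 'b::real_normed_vector"
  assumes "continuous_on UNIV \<zeta>" and "\<And>z. norm z > \<epsilon> \<Longrightarrow> \<zeta> z = 0" and "e > 0"
  obtains d where "d > 0" and "\<And>x y. norm (x - y) < d \<Longrightarrow> norm (\<zeta> x - \<zeta> y) < e"
proof -
  have "uniformly_continuous_on (cball 0 (\<epsilon> + 1)) \<zeta>"
    using assms(1) by (intro compact_uniformly_continuous) (auto intro: continuous_on_subset)
  then obtain d where d: "d > 0"
    "\<And>x y. x \<in> cball 0 (\<epsilon> + 1) \<Longrightarrow> y \<in> cball 0 (\<epsilon> + 1) \<Longrightarrow> dist y x < d \<Longrightarrow> dist (\<zeta> y) (\<zeta> x) < e"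
    unfolding uniformly_continuous_on_def using assms(3) by metis
  have "norm (\<zeta> x - \<zeta> y) < e" if xy: "norm (x - y) < min d 1" for x y
  proof (cases "x \<in> cball 0 (\<epsilon> + 1) \<and> y \<in> cball 0 (\<epsilon> + 1)")
    case True
    then show ?thesis using d(2)[of y x] xy by (simp add: dist_norm)
  next
    case False
    have "norm x \<le> norm y + 1" "norm y \<le> norm x + 1"
      using xy norm_triangle_sub[of x y] norm_triangle_sub[of y x] by (auto simp: norm_minus_commute)
    then have "norm x > \<epsilon>" "norm y > \<epsilon>" using False by auto
    then show ?thesis using assms(2,3) by simp
  qed
  then show thesis using that[of "min d 1"] d(1) by simp
qed

lemma integrable_conv:
  fixes f :: "'a::euclidean_space \<Rightarrow> real" and \<zeta> :: "'a \<Rightarrow> 'b::euclidean_space"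
  assumes "integrable lebesgue f" and "continuous_on UNIV \<zeta>" and "\<And>z. norm z > \<epsilon> \<Longrightarrow> \<zeta> z = 0"
  shows "integrable lebesgue (\<lambda>y. f y *\<^sub>R \<zeta> (x - y))"
proof -
  obtain B where B: "B > 0" "\<And>z. norm (\<zeta> z) \<le> B"
    using bounded_if_vanishing_outside_ball assms(2,3) by blast
  have "continuous_on UNIV (\<lambda>y. \<zeta> (x - y))"
    by (rule continuous_on_compose2[OF assms(2)]) (auto intro!: continuous_intros)
  then have "(\<lambda>y. \<zeta> (x - y)) \<in> borel_measurable lebesgue"
    by (rule continuous_imp_lebesgue_measurable)
  then have m: "(\<lambda>y. f y *\<^sub>R \<zeta> (x - y)) \<in> borel_measurable lebesgue"
    using assms(1) by simp
  show ?thesis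
  proof (rule Bochner_Integration.integrable_bound[OF _ m])
    show "integrable lebesgue (\<lambda>y. B * f y)" using assms(1) by simp
    show "AE y in lebesgue. norm (f y *\<^sub>R \<zeta> (x - y)) \<le> norm (B * f y)"
      using mult_right_mono[OF B(2) abs_ge_zero] B(1) by (intro AE_I2) (simp add: abs_mult mult.commute)
  qed
qed

lemma grad_eq_0_outside_ball:
  assumes "smooth \<eta>" and "\<And>z. norm z > \<epsilon> \<Longrightarrow> \<eta> z = 0" and "norm z > \<epsilon>"
  shows "grad \<eta> z = 0"
proof (rule grad_eqI)
  have o: "open {z::'a. norm z > \<epsilon>}" by (intro open_Collect_less continuous_intros)
  have "((\<lambda>z. 0) has_derivative (\<lambda>h. 0)) (at z)" by simp
  then have "(\<eta> has_derivative (\<lambda>h. 0)) (at z)"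
    by (rule has_derivative_transform_within_open[OF _ o]) (use assms in auto)
  then show "(\<eta> has_derivative (\<lambda>h. 0 \<bullet> h)) (at z)" by simp
qed

text \<open>Differentiation under the integral sign: the first order Taylor remainder of \<open>\<eta>\<close> is uniformly
  small because its gradient is uniformly continuous.\<close>

lemma conv_has_derivative:
  fixes f :: "'a::euclidean_space \<Rightarrow> real"
  assumes f: "integrable lebesgue f" and \<eta>: "smooth \<eta>" and supp: "\<And>z. norm z > \<epsilon> \<Longrightarrow> \<eta> z = 0"
  shows "(conv f \<eta> has_derivative
           (\<lambda>h. (\<Sum>i\<in>Basis. conv f (\<lambda>z. grad \<eta> z \<bullet> i) x *\<^sub>R i) \<bullet> h)) (at x)"
proof -
  have supp': "norm z > \<epsilon> \<Longrightarrow> grad \<eta> z = 0" for z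
    using grad_eq_0_outside_ball[OF \<eta>] supp by blast
  let ?G = "\<Sum>i\<in>Basis. conv f (\<lambda>z. grad \<eta> z \<bullet> i) x *\<^sub>R i"
  have int_i: "integrable lebesgue (\<lambda>y. f y * (grad \<eta> (x - y) \<bullet> v))" for v
    using integrable_inner_left[OF integrable_conv[OF f continuous_grad[OF \<eta>] supp']]
    by (simp add: )
  have int_\<eta>: "integrable lebesgue (\<lambda>y. f y * \<eta> (z - y))" for z
    using integrable_conv[OF f smooth_continuous[OF \<eta>] supp] by simp
  have G: "?G \<bullet> h = (LINT y|lebesgue. f y * (grad \<eta> (x - y) \<bullet> h))" for h
  proof -
    have "?G \<bullet> h = (\<Sum>i\<in>Basis. (LINT y|lebesgue. f y * (grad \<eta> (x - y) \<bullet> i)) * (i \<bullet> h))"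
      by (simp add: inner_sum_left conv_def)
    also have "\<dots> = (LINT y|lebesgue. (\<Sum>i\<in>Basis. f y * (grad \<eta> (x - y) \<bullet> i) * (i \<bullet> h)))"
      using int_i by (subst Bochner_Integration.integral_sum) auto
    also have "\<dots> = (LINT y|lebesgue. f y * (grad \<eta> (x - y) \<bullet> h))"
      by (intro Bochner_Integration.integral_cong)
         (auto simp: euclidean_inner[of "grad \<eta> _" h] sum_distrib_left inner_commute[of h] mult.assoc)
    finally show ?thesis .
  qed
  show ?thesis unfolding has_derivative_at_alt
  proof (intro conjI allI impI)
    show "bounded_linear (\<lambda>h. ?G \<bullet> h)" by (rule bounded_linear_inner_right)
    fix e :: real assume "e > 0"
    define I where "I = (LINT y|lebesgue. \<bar>f y\<bar>)"
    have I: "I \<ge> 0" by (simp add: I_def)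
    define e' where "e' = e / (1 + I)"
    have e': "e' > 0" "e' * I \<le> e"
      using \<open>e > 0\<close> I by (auto simp: e'_def field_simps)
    obtain d where d: "d > 0" "\<And>u v. norm (u - v) < d \<Longrightarrow> norm (grad \<eta> u - grad \<eta> v) < e'"
      using uniformly_continuous_if_vanishing_outside_ball[OF continuous_grad[OF \<eta>] supp' e'(1)]
      by blast
    have taylor: "\<bar>\<eta> (z + h) - \<eta> z - grad \<eta> z \<bullet> h\<bar> \<le> norm h * e'" if "norm h < d" for z h
    proof -
      have "norm (\<eta> (z + h) - \<eta> z - grad \<eta> z \<bullet> ((z + h) - z)) \<le> norm ((z + h) - z) * e'"
      proof (rule differentiable_bound_linearization[where S="ball z d" and f'="\<lambda>z h. grad \<eta> z \<bullet> h"])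
        fix t :: real assume "t \<in> {0..1}"
        then have "\<bar>t\<bar> * norm h \<le> norm h" by (simp add: mult_left_le_one_le)
        then show "z + t *\<^sub>R (z + h - z) \<in> ball z d" using that by (simp add: dist_norm)
      next
        fix u show "(\<eta> has_derivative (\<lambda>h. grad \<eta> u \<bullet> h)) (at u within ball z d)"
          using smooth_has_derivative[OF \<eta>] has_derivative_at_withinI by blast
      next
        fix u assume "u \<in> ball z d"
        then have "norm (grad \<eta> u - grad \<eta> z) \<le> e'"
          using d(2)[of u z] by (simp add: dist_norm norm_minus_commute)
        then have "norm ((grad \<eta> u - grad \<eta> z) \<bullet> v) \<le> e' * norm v" for v
          using order_trans[OF Cauchy_Schwarz_ineq2 mult_right_mono[OF _ norm_ge_zero]] by simp
        then show "onorm ((\<lambda>h. grad \<eta> u \<bullet> h) - (\<lambda>h. grad \<eta> z \<bullet> h)) \<le> e'"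
          using e'(1) by (intro onorm_bound) (auto simp: fun_diff_def inner_diff_left)
      qed (use d in auto)
      then show ?thesis by simp
    qed
    show "\<exists>d>0. \<forall>y. norm (y - x) < d \<longrightarrow>
            norm (conv f \<eta> y - conv f \<eta> x - ?G \<bullet> (y - x)) \<le> e * norm (y - x)"
    proof (intro exI[of _ d] conjI allI impI d(1))
      fix x' assume x': "norm (x' - x) < d"
      define h where "h = x' - x"
      let ?r = "\<lambda>y. f y * \<eta> (x' - y) - f y * \<eta> (x - y) - f y * (grad \<eta> (x - y) \<bullet> h)"
      have "conv f \<eta> x' - conv f \<eta> x - ?G \<bullet> h = (LINT y|lebesgue. ?r y)"
        using int_\<eta>[of x'] int_\<eta>[of x] int_i[of h] G[of h] by (simp add: conv_def)
      also have "norm \<dots> \<le> (LINT y|lebesgue. \<bar>f y\<bar> * (norm h * e'))"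
      proof (rule Bochner_Integration.integral_norm_bound_integral)
        show "integrable lebesgue ?r"
          using int_\<eta>[of x'] int_\<eta>[of x] int_i[of h] by simp
        fix y
        have "?r y = f y * (\<eta> (x - y + h) - \<eta> (x - y) - grad \<eta> (x - y) \<bullet> h)"
          by (simp add: h_def right_diff_distrib)
        then show "norm (?r y) \<le> \<bar>f y\<bar> * (norm h * e')"
          using taylor[of h "x - y"] x' by (simp add: abs_mult mult_left_mono h_def)
      qed (use f in simp)
      also have "\<dots> = norm h * (e' * I)" by (simp add: mult_ac I_def)
      also have "\<dots> \<le> norm h * e" using e'(2) by (rule mult_left_mono) simp
      finally show "norm (conv f \<eta> x' - conv f \<eta> x - ?G \<bullet> (x' - x)) \<le> e * norm (x' - x)"
        by (simp add: mult.commute h_def)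
    qed
  qed
qed

lemma grad_conv:
  assumes "integrable lebesgue f" and "smooth \<eta>" and "\<And>z. norm z > \<epsilon> \<Longrightarrow> \<eta> z = 0" and "i \<in> Basis"
  shows "grad (conv f \<eta>) x \<bullet> i = conv f (\<lambda>z. grad \<eta> z \<bullet> i) x"
  using grad_eqI[OF conv_has_derivative[OF assms(1-3)]] assms(4) by simp

lemma smooth_conv:
  assumes f: "integrable lebesgue f" and "smooth \<eta>" and "\<And>z. norm z > \<epsilon> \<Longrightarrow> \<eta> z = 0"
  shows "smooth (conv f \<eta>)"
proof -
  have "C_k k (conv f \<eta>)" if "smooth \<eta>" "\<And>z. norm z > \<epsilon> \<Longrightarrow> \<eta> z = 0" for k \<eta>
    using that
  proof (induction k arbitrary: \<eta>)
    case 0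
    have "\<And>x. isCont (conv f \<eta>) x"
      using has_derivative_continuous[OF conv_has_derivative[OF f]] 0 by blast
    then show ?case by (simp add: continuous_at_imp_continuous_on)
  next
    case (Suc k)
    have "C_k k (conv f (\<lambda>z. grad \<eta> z \<bullet> i))" if "i \<in> Basis" for i
      using Suc.IH[OF smooth_grad_component[OF Suc.prems(1) that]]
            grad_eq_0_outside_ball[OF Suc.prems] by simp
    then show ?case
      by (intro C_k_SucI[OF conv_has_derivative[OF f Suc.prems]]) (simp_all)
  qed
  then show ?thesis using assms by (simp add: smooth_def)
qed

subsection \<open>Mollifiers\<close>

text \<open>The radius enters through \<open>\<epsilon>\<^sup>2 - \<bar>x\<bar>\<^sup>2\<close> and not by scaling a fixed bump, so that no change of
  variables is needed.\<close>

definition mollifier :: "real \<Rightarrow> 'a::euclidean_space \<Rightarrow> real" where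
  "mollifier \<epsilon> x = flat 0 (\<epsilon>\<^sup>2 - x \<bullet> x) / (LINT x|(lebesgue :: 'a measure). flat 0 (\<epsilon>\<^sup>2 - x \<bullet> x))"

context
  fixes \<epsilon> :: real
  assumes \<epsilon>: "\<epsilon> > 0"
begin

lemma smooth_bump: "smooth (\<lambda>x::'a::euclidean_space. flat 0 (\<epsilon>\<^sup>2 - x \<bullet> x))"
  by (rule smooth_compose[OF smooth_flat smooth_diff[OF smooth_const smooth_inner_self]])

lemma bump_eq_0: "norm x \<ge> \<epsilon> \<Longrightarrow> flat 0 (\<epsilon>\<^sup>2 - x \<bullet> x) = 0"
  using \<epsilon> by (intro flat_eq_0) (simp add: power2_norm_eq_inner[symmetric] power_mono)

lemma integrable_bump: "integrable lebesgue (\<lambda>x::'a::euclidean_space. flat 0 (\<epsilon>\<^sup>2 - x \<bullet> x))"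
  by (rule integrable_if_vanishing_outside_ball[OF smooth_continuous[OF smooth_bump]])
     (use bump_eq_0 less_imp_le in blast)

lemma bump_integral_pos: "(LINT x|(lebesgue :: 'a::euclidean_space measure). flat 0 (\<epsilon>\<^sup>2 - x \<bullet> x)) > 0"
proof (rule ccontr)
  assume "\<not> ?thesis"
  moreover have "(LINT x|(lebesgue :: 'a measure). flat 0 (\<epsilon>\<^sup>2 - x \<bullet> x)) \<ge> 0"
    by (intro integral_nonneg_AE) (simp add: flat_nonneg)
  ultimately have "AE x in (lebesgue :: 'a measure). flat 0 (\<epsilon>\<^sup>2 - x \<bullet> x) = 0"
    using integral_nonneg_eq_0_iff_AE[OF integrable_bump[where 'a='a]] by (simp add: flat_nonneg)
  moreover have "flat 0 (\<epsilon>\<^sup>2 - x \<bullet> x) \<noteq> 0" if "x \<in> ball 0 \<epsilon>" for x :: 'a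
    using that flat_pos[of "\<epsilon>\<^sup>2 - x \<bullet> x" 0] \<epsilon> by (simp add: power2_norm_eq_inner[symmetric] power_strict_mono)
  ultimately have "AE x in lebesgue. x \<notin> ball (0::'a) \<epsilon>" by (auto elim!: eventually_mono)
  then have "negligible (ball (0::'a) \<epsilon>)"
    by (simp add: AE_iff_null_sets negligible_iff_null_sets)
  then show False using \<epsilon> by (simp add: negligible_iff_measure0)
qed

lemma smooth_mollifier: "smooth (mollifier \<epsilon>)"
  unfolding mollifier_def[abs_def] divide_inverse by (rule smooth_mult[OF smooth_bump smooth_const])

lemma mollifier_nonneg: "mollifier \<epsilon> x \<ge> 0"
  unfolding mollifier_def using bump_integral_pos flat_nonneg by (intro divide_nonneg_pos)

lemma mollifier_eq_0: "norm x \<ge> \<epsilon> \<Longrightarrow> mollifier \<epsilon> x = 0"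
  by (simp add: mollifier_def bump_eq_0)

lemma mollifier_minus: "mollifier \<epsilon> (- x) = mollifier \<epsilon> x"
  by (simp add: mollifier_def)

lemma mollifier_integral: "(LINT x|(lebesgue :: 'a::euclidean_space measure). mollifier \<epsilon> x) = 1"
  unfolding mollifier_def using bump_integral_pos[where 'a='a] by simp

lemma borel_measurable_mollifier: "mollifier \<epsilon> \<in> borel_measurable borel"
  by (intro borel_measurable_continuous_onI smooth_continuous smooth_mollifier)

lemma nn_integral_mollifier_reflect: "(\<integral>\<^sup>+y. ennreal (mollifier \<epsilon> (x - y)) \<partial>lborel) = 1"
proof -
  note [measurable] = borel_measurable_mollifier
  have "integrable lborel (mollifier \<epsilon> :: 'a \<Rightarrow> real)"
    using integrable_bump[where 'a='a] borel_measurable_mollifier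
    by (subst integrable_completion[symmetric]) (simp_all add: mollifier_def[abs_def])
  then have "(\<integral>\<^sup>+y. ennreal (mollifier \<epsilon> y) \<partial>(lborel :: 'a measure)) 
      = ennreal (LINT y|(lborel :: 'a measure). mollifier \<epsilon> y)"
    by (intro nn_integral_eq_integral AE_I2) (simp_all add: mollifier_nonneg)
  also have "\<dots> = 1"
    using mollifier_integral[where 'a='a] integral_completion[of "mollifier \<epsilon> :: 'a \<Rightarrow> real" lborel] borel_measurable_mollifier
    by simp
  finally have "(\<integral>\<^sup>+y. ennreal (mollifier \<epsilon> y) \<partial>(lborel :: 'a measure)) = 1" .
  then show ?thesis
    by (subst (asm) lborel_affine[of "-1" x]) (simp_all add: nn_integral_density nn_integral_distr)
qed

lemma integral_mollifier_reflect: "(LINT y|lebesgue. mollifier \<epsilon> (x - y)) = 1"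
  and integrable_mollifier_reflect: "integrable lebesgue (\<lambda>y. mollifier \<epsilon> (x - y))"
proof -
  note [measurable] = borel_measurable_mollifier
  have m: "(\<lambda>y. mollifier \<epsilon> (x - y)) \<in> borel_measurable lborel" by simp
  have "has_bochner_integral lborel (\<lambda>y. mollifier \<epsilon> (x - y)) 1"
    by (rule has_bochner_integral_nn_integral)
       (use nn_integral_mollifier_reflect in \<open>auto simp: mollifier_nonneg\<close>)
  then show "(LINT y|lebesgue. mollifier \<epsilon> (x - y)) = 1" "integrable lebesgue (\<lambda>y. mollifier \<epsilon> (x - y))"
    using integral_completion[OF m] integrable_completion[OF m] has_bochner_integral_iff by auto
qed

lemma integrable_mult_mollifier:
  assumes "integrable lebesgue f"
  shows "integrable lebesgue (\<lambda>y. f y * mollifier \<epsilon> (x - y))"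
proof -
  have "integrable lebesgue (\<lambda>y. f y *\<^sub>R mollifier \<epsilon> (x - y))"
    by (rule integrable_conv[OF assms smooth_continuous[OF smooth_mollifier], of \<epsilon>])
       (simp add: mollifier_eq_0)
  then show ?thesis by simp
qed

lemma conv_mollifier_bounds:
  assumes f: "integrable lebesgue f" and b: "AE x in lebesgue. a \<le> f x \<and> f x \<le> b"
  shows "a \<le> conv f (mollifier \<epsilon>) x" and "conv f (mollifier \<epsilon>) x \<le> b"
proof -
  note i = integrable_mollifier_reflect[of x]
  have c: "integrable lebesgue (\<lambda>y. f y * mollifier \<epsilon> (x - y))"
    by (rule integrable_mult_mollifier[OF f])
  have "(LINT y|lebesgue. a * mollifier \<epsilon> (x - y)) \<le> conv f (mollifier \<epsilon>) x"
    unfolding conv_def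
    by (rule integral_mono_AE[OF integrable_mult_right[OF i] c])
       (rule AE_mp[OF b], auto intro!: mult_right_mono mollifier_nonneg)
  moreover have "conv f (mollifier \<epsilon>) x \<le> (LINT y|lebesgue. b * mollifier \<epsilon> (x - y))"
    unfolding conv_def
    by (rule integral_mono_AE[OF c integrable_mult_right[OF i]])
       (rule AE_mp[OF b], auto intro!: mult_right_mono mollifier_nonneg)
  ultimately show "a \<le> conv f (mollifier \<epsilon>) x" "conv f (mollifier \<epsilon>) x \<le> b"
    by (simp_all add: integral_mollifier_reflect)
qed

lemma conv_mollifier_close:
  assumes h: "continuous_on UNIV h" "\<And>z. norm z > R \<Longrightarrow> h z = 0" and "integrable lebesgue h"
    and close: "\<And>x y. norm (x - y) < \<epsilon> \<Longrightarrow> \<bar>h x - h y\<bar> \<le> e"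
  shows "\<bar>conv h (mollifier \<epsilon>) x - h x\<bar> \<le> e"
proof -
  note i = integrable_mollifier_reflect[of x]
  have c: "integrable lebesgue (\<lambda>y. h y * mollifier \<epsilon> (x - y))"
    by (rule integrable_mult_mollifier[OF assms(3)])
  have "conv h (mollifier \<epsilon>) x - h x = (LINT y|lebesgue. (h y - h x) * mollifier \<epsilon> (x - y))"
    using c i by (simp add: conv_def left_diff_distrib integral_mollifier_reflect)
  also have "norm \<dots> \<le> (LINT y|lebesgue. e * mollifier \<epsilon> (x - y))"
  proof (rule Bochner_Integration.integral_norm_bound_integral)
    fix y
    show "norm ((h y - h x) * mollifier \<epsilon> (x - y)) \<le> e * mollifier \<epsilon> (x - y)"
      using close[of y x] mollifier_eq_0[of "x - y"] mollifier_nonneg[of "x - y"]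
      by (cases "norm (x - y) < \<epsilon>") (auto simp: abs_mult norm_minus_commute intro!: mult_right_mono)
  qed (use c i in \<open>simp_all add: left_diff_distrib\<close>)
  finally show ?thesis by (simp add: integral_mollifier_reflect)
qed

lemma conv_eq_0_far:
  assumes "\<And>y. norm y > R \<Longrightarrow> f y = 0" and "norm x > R + \<epsilon>"
  shows "conv f (mollifier \<epsilon>) x = 0"
proof -
  have "f y * mollifier \<epsilon> (x - y) = 0" for y
    using assms norm_triangle_sub[of x y] mollifier_eq_0[of "x - y"] by (cases "norm y > R") auto
  then have "(\<lambda>y. f y * mollifier \<epsilon> (x - y)) = (\<lambda>y. 0)" by blast
  then show ?thesis by (simp add: conv_def)
qed

text \<open>Young's inequality in \<open>L\<^sup>2\<close>: pointwise, \<open>(f * \<eta>)\<^sup>2 \<le> f\<^sup>2 * \<eta>\<close> because \<open>\<eta>\<close> is a probability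
  density, and integrating out the variable of \<open>\<eta>\<close> first leaves \<open>\<integral> f\<^sup>2\<close>.\<close>

lemma conv_mollifier_L2_bound:
  fixes f :: "'a::euclidean_space \<Rightarrow> real"
  assumes f: "integrable lebesgue f" and f2: "integrable lebesgue (\<lambda>x. (f x)\<^sup>2)"
  shows "(\<integral>\<^sup>+x. ennreal ((conv f (mollifier \<epsilon>) x)\<^sup>2) \<partial>lebesgue) \<le> (\<integral>\<^sup>+x. ennreal ((f x)\<^sup>2) \<partial>lebesgue)"
proof -
  note [measurable] = borel_measurable_mollifier
  let ?\<eta> = "mollifier \<epsilon> :: 'a \<Rightarrow> real"
  obtain g where g [measurable]: "g \<in> borel_measurable lborel" and ae: "AE x in lborel. f x = g x"
    using completion_ex_borel_measurable_real[of f lborel] f by auto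
  have ae': "AE x in lebesgue. f x = g x" using ae by (rule AE_completion)
  have gm: "g \<in> borel_measurable lebesgue" using g by (simp add: measurable_completion)
  have gi: "integrable lebesgue g" "integrable lebesgue (\<lambda>x. (g x)\<^sup>2)"
    by (rule integrable_cong_AE_imp[OF f gm], use ae' in \<open>auto elim!: eventually_mono\<close>)
       (rule integrable_cong_AE_imp[OF f2], use ae' gm in \<open>auto elim!: eventually_mono\<close>)
  have conv: "conv f ?\<eta> x = conv g ?\<eta> x" for x
    unfolding conv_def
    by (rule integral_cong_AE)
       (use ae' integrable_mult_mollifier[OF f] integrable_mult_mollifier[OF gi(1)] in auto)
  have jensen: "ennreal ((conv g ?\<eta> x)\<^sup>2) \<le> (\<integral>\<^sup>+y. ennreal ((g y)\<^sup>2) * ennreal (?\<eta> (x - y)) \<partial>lborel)" for x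
  proof -
    let ?m = "conv g ?\<eta> x"
    note i0 = integrable_mollifier_reflect[of x]
    have i1: "integrable lebesgue (\<lambda>y. g y * ?\<eta> (x - y))"
      by (rule integrable_mult_mollifier[OF gi(1)])
    have i2: "integrable lebesgue (\<lambda>y. (g y)\<^sup>2 * ?\<eta> (x - y))"
      by (rule integrable_mult_mollifier[OF gi(2)])
    have "0 \<le> (LINT y|lebesgue. (g y - ?m)\<^sup>2 * ?\<eta> (x - y))"
      by (simp add: mollifier_nonneg)
    also have "\<dots> = (LINT y|lebesgue. (g y)\<^sup>2 * ?\<eta> (x - y) - 2 * ?m * (g y * ?\<eta> (x - y)) + ?m\<^sup>2 * ?\<eta> (x - y))"
      by (simp add: power2_diff algebra_simps)
    also have "\<dots> = (LINT y|lebesgue. (g y)\<^sup>2 * ?\<eta> (x - y)) - 2 * ?m * ?m + ?m\<^sup>2"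
      using i0 i1 i2 by (simp add: integral_mollifier_reflect conv_def)
    finally have "?m\<^sup>2 \<le> (LINT y|lebesgue. (g y)\<^sup>2 * ?\<eta> (x - y))"
      by (simp add: power2_eq_square)
    also have "ennreal \<dots> = (\<integral>\<^sup>+y. ennreal ((g y)\<^sup>2 * ?\<eta> (x - y)) \<partial>lebesgue)"
      using i2 by (intro nn_integral_eq_integral[symmetric]) (auto simp: mollifier_nonneg)
    finally show ?thesis
      by (simp add: nn_integral_completion ennreal_mult mollifier_nonneg ennreal_leI)
  qed
  have "(\<integral>\<^sup>+x. ennreal ((conv f ?\<eta> x)\<^sup>2) \<partial>lebesgue)
      \<le> (\<integral>\<^sup>+x. (\<integral>\<^sup>+y. ennreal ((g y)\<^sup>2) * ennreal (?\<eta> (x - y)) \<partial>lborel) \<partial>lborel)"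
    unfolding nn_integral_completion conv by (intro nn_integral_mono jensen)
  also have "\<dots> = (\<integral>\<^sup>+y. (\<integral>\<^sup>+x. ennreal ((g y)\<^sup>2) * ennreal (?\<eta> (x - y)) \<partial>lborel) \<partial>lborel)"
    by (rule lborel_pair.Fubini') simp
  also have "\<dots> = (\<integral>\<^sup>+y. ennreal ((g y)\<^sup>2) * (\<integral>\<^sup>+x. ennreal (?\<eta> (y - x)) \<partial>lborel) \<partial>lborel)"
  proof -
    have "?\<eta> (x - y) = ?\<eta> (y - x)" for x y using mollifier_minus[of "x - y"] by simp
    then show ?thesis by (simp add: nn_integral_cmult)
  qed
  also have "\<dots> = (\<integral>\<^sup>+y. ennreal ((g y)\<^sup>2) \<partial>lborel)"
    by (simp add: nn_integral_mollifier_reflect)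
  also have "\<dots> = (\<integral>\<^sup>+y. ennreal ((f y)\<^sup>2) \<partial>lebesgue)"
    unfolding nn_integral_completion using ae by (intro nn_integral_cong_AE) (auto elim: eventually_mono)
  finally show ?thesis .
qed

end

subsection \<open>Convergence of mollifications in \<open>L\<^sup>2\<close>\<close>

lemma sum3_squares_le: "(a + b + c)\<^sup>2 \<le> 3 * (a\<^sup>2 + b\<^sup>2 + c\<^sup>2)" for a b c :: real
proof -
  have "0 \<le> (a - b)\<^sup>2 + (b - c)\<^sup>2 + (a - c)\<^sup>2" by simp
  then show ?thesis by (simp add: power2_eq_square algebra_simps)
qed

lemma sum2_squares_le: "(a + b)\<^sup>2 \<le> 2 * (a\<^sup>2 + b\<^sup>2)" for a b :: real
  using sum_squares_bound[of a b] by (simp add: power2_sum)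

lemma integrable_square_add:
  fixes f g :: "'a \<Rightarrow> real"
  assumes "f \<in> borel_measurable M" "g \<in> borel_measurable M"
    and "integrable M (\<lambda>x. (f x)\<^sup>2)" "integrable M (\<lambda>x. (g x)\<^sup>2)"
  shows "integrable M (\<lambda>x. (f x + g x)\<^sup>2)"
  by (rule Bochner_Integration.integrable_bound[of _ "\<lambda>x. 2 * ((f x)\<^sup>2 + (g x)\<^sup>2)"])
     (use assms sum2_squares_le in \<open>auto intro!: AE_I2\<close>)

lemma integrable_square_diff:
  fixes f g :: "'a \<Rightarrow> real"
  assumes "f \<in> borel_measurable M" "g \<in> borel_measurable M"
    and "integrable M (\<lambda>x. (f x)\<^sup>2)" "integrable M (\<lambda>x. (g x)\<^sup>2)"
  shows "integrable M (\<lambda>x. (f x - g x)\<^sup>2)"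
  using integrable_square_add[of f M "\<lambda>x. - g x"] assms by simp

lemma integrable_indicator_cball: "integrable lebesgue (indicator (cball (a::'a::euclidean_space) R) :: 'a \<Rightarrow> real)"
  using emeasure_bounded_finite[OF bounded_cball, of a R]
  by (intro integrable_real_indicator) (auto simp: less_top)

definition clip :: "real \<Rightarrow> real \<Rightarrow> real" where
  "clip B t = max (- B) (min B t)"

lemma continuous_clip: "continuous_on S f \<Longrightarrow> continuous_on S (\<lambda>x. clip B (f x))"
  unfolding clip_def by (intro continuous_intros)

lemma abs_clip_le: "B \<ge> 0 \<Longrightarrow> \<bar>clip B t\<bar> \<le> B"
  by (auto simp: clip_def)

lemma clip_eq: "\<bar>t\<bar> \<le> B \<Longrightarrow> clip B t = t"
  by (auto simp: clip_def)

lemma abs_diff_clip_mult_le: "B \<ge> 0 \<Longrightarrow> 0 \<le> c \<Longrightarrow> c \<le> 1 \<Longrightarrow> \<bar>t - clip B t * c\<bar> \<le> \<bar>t\<bar>"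
proof -
  assume a: "B \<ge> 0" "0 \<le> c" "c \<le> 1"
  have m: "0 \<le> s * c \<and> s * c \<le> s" if "s \<ge> 0" for s
    using a that by (simp add: mult_left_le)
  show ?thesis
  proof (cases "t \<ge> 0")
    case True
    then have "clip B t \<ge> 0" "clip B t \<le> t" using a by (auto simp: clip_def)
    then show ?thesis using m[of "clip B t"] True by auto
  next
    case False
    then have "- clip B t \<ge> 0" "- clip B t \<le> - t" using a by (auto simp: clip_def)
    then show ?thesis using m[of "- clip B t"] False by auto
  qed
qed

text \<open>A Lebesgue measurable function is an almost everywhere limit of continuous functions. Truncating
  the values and the support first makes this convergence dominated.\<close>

lemma L2_approx_continuous:
  fixes f :: "'a::euclidean_space \<Rightarrow> real"
  assumes f: "f \<in> borel_measurable lebesgue" and f2: "integrable lebesgue (\<lambda>x. (f x)\<^sup>2)" and "e > 0"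
  obtains h R where "continuous_on UNIV h" and "\<And>z. norm z > R \<Longrightarrow> h z = 0"
    and "integrable lebesgue (\<lambda>x. (f x - h x)\<^sup>2)" and "(LINT x|lebesgue. (f x - h x)\<^sup>2) < e"
proof -
  define cut :: "nat \<Rightarrow> 'a \<Rightarrow> real" where "cut n x = max 0 (min 1 (real n - norm x))" for n x
  have cut: "0 \<le> cut n x" "cut n x \<le> 1" "norm x > real n \<Longrightarrow> cut n x = 0" for n x
    by (auto simp: cut_def)
  have cut_cont: "continuous_on UNIV (cut n)" for n
    unfolding cut_def by (intro continuous_intros)
  have [measurable]: "cut n \<in> borel_measurable lebesgue" for n
    by (rule continuous_imp_lebesgue_measurable[OF cut_cont])
  note [measurable] = f
  have clip_m [measurable]: "(\<lambda>x. clip B (u x)) \<in> borel_measurable lebesgue"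
    if "u \<in> borel_measurable lebesgue" for B and u :: "'a \<Rightarrow> real"
    using that unfolding clip_def by measurable
  define s where "s n x = clip (real n) (f x) * cut n x" for n x
  have [measurable]: "s n \<in> borel_measurable lebesgue" for n unfolding s_def by measurable
  have bound: "norm ((f x - s n x)\<^sup>2) \<le> (f x)\<^sup>2" for n x
    using abs_diff_clip_mult_le[of "real n" "cut n x" "f x"] cut[where n=n and x=x]
    by (simp add: s_def abs_le_square_iff)
  have "(\<lambda>n. LINT x|lebesgue. (f x - s n x)\<^sup>2) \<longlonglongrightarrow> (LINT x|(lebesgue::'a measure). 0)"
  proof (rule integral_dominated_convergence[where w="\<lambda>x. (f x)\<^sup>2"])
    have "(\<lambda>n. (f x - s n x)\<^sup>2) \<longlonglongrightarrow> 0" for x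
    proof (rule tendsto_eventually)
      obtain n0 :: nat where "max \<bar>f x\<bar> (norm x + 1) \<le> real n0" using real_arch_simple by blast
      then have "\<forall>n\<ge>n0. (f x - s n x)\<^sup>2 = 0"
        by (auto simp: s_def clip_eq cut_def)
      then show "eventually (\<lambda>n. (f x - s n x)\<^sup>2 = 0) sequentially"
        by (auto simp: eventually_sequentially)
    qed
    then show "AE x in lebesgue. (\<lambda>n. (f x - s n x)\<^sup>2) \<longlonglongrightarrow> 0" by simp
  qed (use bound f2 in auto)
  then have "eventually (\<lambda>n. (LINT x|lebesgue. (f x - s n x)\<^sup>2) < e / 4) sequentially"
    using \<open>e > 0\<close> by (intro order_tendstoD) auto
  then obtain n where n: "(LINT x|lebesgue. (f x - s n x)\<^sup>2) < e / 4"
    by (auto simp: eventually_sequentially)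
  have "f measurable_on UNIV"
    using f by (intro lebesgue_measurable_imp_measurable_on) auto
  then obtain N g where N: "negligible N" and g: "\<And>m. continuous_on UNIV (g m)"
    and lim: "\<And>x. x \<notin> N \<Longrightarrow> (\<lambda>m. g m x) \<longlonglongrightarrow> f x"
    unfolding measurable_on_def by auto
  define h where "h m x = clip (real n) (g m x) * cut n x" for m :: nat and x
  have h: "continuous_on UNIV (h m)" "norm z > real n \<Longrightarrow> h m z = 0" for m z
    unfolding h_def using cut g by (auto intro!: continuous_on_mult continuous_clip cut_cont)
  have [measurable]: "h m \<in> borel_measurable lebesgue" for m
    by (rule continuous_imp_lebesgue_measurable[OF h(1)])
  have bound': "(s n x - h m x)\<^sup>2 \<le> (2 * real n)\<^sup>2 * indicator (cball 0 (real n)) x" for m x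
  proof (cases "norm x > real n")
    case True
    then show ?thesis by (simp add: s_def h_def cut)
  next
    case False
    have "\<bar>s n x\<bar> \<le> real n" "\<bar>h m x\<bar> \<le> real n"
      unfolding s_def h_def abs_mult using cut[where n=n and x=x] abs_clip_le[of "real n"]
      by (auto intro: mult_mono[of _ "real n" _ 1, simplified])
    then have "\<bar>s n x - h m x\<bar> \<le> \<bar>2 * real n\<bar>" by linarith
    then show ?thesis using False by (simp only: abs_le_square_iff) (simp add: indicator_def)
  qed
  have N': "AE x in lebesgue. x \<notin> N"
    using N by (intro AE_not_in) (simp add: negligible_iff_null_sets)
  have "(\<lambda>m. LINT x|lebesgue. (s n x - h m x)\<^sup>2) \<longlonglongrightarrow> (LINT x|(lebesgue::'a measure). 0)"
  proof (rule integral_dominated_convergence[where w="\<lambda>x. (2 * real n)\<^sup>2 * indicator (cball 0 (real n)) x"])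
    have "(\<lambda>m. (s n x - h m x)\<^sup>2) \<longlonglongrightarrow> 0" if "x \<notin> N" for x
    proof -
      have "(\<lambda>m. (s n x - h m x)\<^sup>2) \<longlonglongrightarrow> (s n x - s n x)\<^sup>2"
        unfolding s_def h_def clip_def by (intro tendsto_intros tendsto_max tendsto_min lim that)
      then show ?thesis by simp
    qed
    with N' show "AE x in lebesgue. (\<lambda>m. (s n x - h m x)\<^sup>2) \<longlonglongrightarrow> 0" by (auto elim!: eventually_mono)
  qed (use bound' in \<open>auto intro!: integrable_mult_right integrable_indicator_cball\<close>)
  then have "eventually (\<lambda>m. (LINT x|lebesgue. (s n x - h m x)\<^sup>2) < e / 4) sequentially"
    using \<open>e > 0\<close> by (intro order_tendstoD) auto
  then obtain m where m: "(LINT x|lebesgue. (s n x - h m x)\<^sup>2) < e / 4"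
    by (auto simp: eventually_sequentially)
  have i1: "integrable lebesgue (\<lambda>x. (f x - s n x)\<^sup>2)"
    by (rule Bochner_Integration.integrable_bound[OF f2]) (use bound in auto)
  have i2: "integrable lebesgue (\<lambda>x. (s n x - h m x)\<^sup>2)"
    by (rule Bochner_Integration.integrable_bound[of _ "\<lambda>x. (2 * real n)\<^sup>2 * indicator (cball 0 (real n)) x"])
       (use bound' in \<open>auto intro!: integrable_mult_right integrable_indicator_cball\<close>)
  have i3: "integrable lebesgue (\<lambda>x. (f x - h m x)\<^sup>2)"
    using integrable_square_add[OF _ _ i1 i2] by simp
  have "(f x - h m x)\<^sup>2 \<le> 2 * ((f x - s n x)\<^sup>2 + (s n x - h m x)\<^sup>2)" for x
    using sum2_squares_le[of "f x - s n x" "s n x - h m x"] by simp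
  then have "(LINT x|lebesgue. (f x - h m x)\<^sup>2)
      \<le> (LINT x|lebesgue. 2 * ((f x - s n x)\<^sup>2 + (s n x - h m x)\<^sup>2))"
    using i1 i2 i3 by (intro integral_mono) auto
  also have "\<dots> < e" using n m i1 i2 by simp
  finally show thesis using that h i3 by blast
qed

lemma conv_mollifier_L2:
  fixes f :: "'a::euclidean_space \<Rightarrow> real"
  assumes "\<epsilon> > 0" and f: "integrable lebesgue f" and f2: "integrable lebesgue (\<lambda>x. (f x)\<^sup>2)"
  shows "integrable lebesgue (\<lambda>x. (conv f (mollifier \<epsilon>) x)\<^sup>2)"
    and "(LINT x|lebesgue. (conv f (mollifier \<epsilon>) x)\<^sup>2) \<le> (LINT x|lebesgue. (f x)\<^sup>2)"
proof -
  have s: "smooth (conv f (mollifier \<epsilon>))"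
    by (rule smooth_conv[OF f smooth_mollifier[OF assms(1)], of \<epsilon>]) (simp add: mollifier_eq_0 assms(1))
  have m: "(\<lambda>x. (conv f (mollifier \<epsilon>) x)\<^sup>2) \<in> borel_measurable lebesgue"
    using continuous_imp_lebesgue_measurable[OF smooth_continuous[OF s]] by simp
  have "(\<integral>\<^sup>+x. ennreal ((conv f (mollifier \<epsilon>) x)\<^sup>2) \<partial>lebesgue) \<le> (\<integral>\<^sup>+x. ennreal ((f x)\<^sup>2) \<partial>lebesgue)"
    using conv_mollifier_L2_bound[OF assms] .
  also have "\<dots> = ennreal (LINT x|lebesgue. (f x)\<^sup>2)"
    using f2 by (intro nn_integral_eq_integral) auto
  finally have le: "(\<integral>\<^sup>+x. ennreal ((conv f (mollifier \<epsilon>) x)\<^sup>2) \<partial>lebesgue) \<le> ennreal (LINT x|lebesgue. (f x)\<^sup>2)" .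
  then show i: "integrable lebesgue (\<lambda>x. (conv f (mollifier \<epsilon>) x)\<^sup>2)"
    using m by (intro integrableI_bounded) (auto simp: less_top[symmetric] top_unique)
  show "(LINT x|lebesgue. (conv f (mollifier \<epsilon>) x)\<^sup>2) \<le> (LINT x|lebesgue. (f x)\<^sup>2)"
    using le i by (subst (asm) nn_integral_eq_integral) auto
qed

text \<open>By Young's inequality the maps \<open>f \<mapsto> f * \<eta>\<^sub>\<epsilon>\<close> are uniformly bounded on \<open>L\<^sup>2\<close>, so it suffices to
  have convergence on the dense set of continuous functions of compact support, where it is uniform.\<close>

lemma mollify_tendsto_L2:
  fixes f :: "'a::euclidean_space \<Rightarrow> real"
  assumes f: "integrable lebesgue f" and f2: "integrable lebesgue (\<lambda>x. (f x)\<^sup>2)"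
    and \<epsilon>: "\<And>n. \<epsilon> n > 0" "\<epsilon> \<longlonglongrightarrow> 0"
  shows "(\<lambda>n. LINT x|lebesgue. (conv f (mollifier (\<epsilon> n)) x - f x)\<^sup>2) \<longlonglongrightarrow> 0"
proof (rule LIMSEQ_I)
  fix e :: real assume "e > 0"
  note [measurable] = borel_measurable_integrable[OF f]
  obtain h R where h: "continuous_on UNIV h" "\<And>z. norm z > R \<Longrightarrow> h z = 0"
    and fh: "integrable lebesgue (\<lambda>x. (f x - h x)\<^sup>2)" "(LINT x|lebesgue. (f x - h x)\<^sup>2) < e / 12"
    using L2_approx_continuous[OF borel_measurable_integrable[OF f] f2, of "e / 12"] \<open>e > 0\<close> by auto
  note [measurable] = continuous_imp_lebesgue_measurable[OF h(1)]
  have hi: "integrable lebesgue h" by (rule integrable_if_vanishing_outside_ball[OF h])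
  define V where "V = (LINT x|lebesgue. (indicator (cball (0::'a) (R + 1)) x :: real))"
  have V: "V \<ge> 0" unfolding V_def by (intro integral_nonneg_AE) auto
  define e' where "e' = sqrt (e / (12 * (V + 1)))"
  have e': "e' > 0" using \<open>e > 0\<close> V by (simp add: e'_def)
  have e'V: "e'\<^sup>2 * V \<le> e / 12"
  proof -
    have "e'\<^sup>2 * V = e / 12 * (V / (V + 1))" using \<open>e > 0\<close> V by (simp add: e'_def)
    also have "\<dots> \<le> e / 12 * 1" using \<open>e > 0\<close> V by (intro mult_left_mono) auto
    finally show ?thesis by simp
  qed
  obtain d where d: "d > 0" "\<And>x y. norm (x - y) < d \<Longrightarrow> norm (h x - h y) < e'"
    using uniformly_continuous_if_vanishing_outside_ball[OF h e'] by blast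
  have "(LINT x|lebesgue. (conv f (mollifier \<delta>) x - f x)\<^sup>2) < e" if \<delta>: "0 < \<delta>" "\<delta> < min d 1" for \<delta>
  proof -
    let ?c = "\<lambda>u :: 'a \<Rightarrow> real. conv u (mollifier \<delta>)"
    have cm: "?c u \<in> borel_measurable lebesgue" if "integrable lebesgue u" for u
      by (intro continuous_imp_lebesgue_measurable smooth_continuous
            smooth_conv[OF that smooth_mollifier[OF \<delta>(1)], of \<delta>]) (simp add: mollifier_eq_0 \<delta>)
    note [measurable] = cm[OF f] cm[OF hi]
    have fhi: "integrable lebesgue (\<lambda>x. f x - h x)" using f hi by simp
    have diff: "?c f x - ?c h x = ?c (\<lambda>x. f x - h x) x" for x
      using integrable_mult_mollifier[OF \<delta>(1) f] integrable_mult_mollifier[OF \<delta>(1) hi]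
      by (simp add: conv_def left_diff_distrib)
    note c1 = conv_mollifier_L2[OF \<delta>(1) fhi fh(1), folded diff]
    have close: "(?c h x - h x)\<^sup>2 \<le> e'\<^sup>2 * indicator (cball 0 (R + 1)) x" for x
    proof (cases "norm x > R + 1")
      case True
      then show ?thesis using h(2) \<delta> conv_eq_0_far[OF \<delta>(1) h(2), where x=x] by simp
    next
      case False
      have "\<bar>h x - h y\<bar> \<le> e'" if "norm (x - y) < \<delta>" for x y
        using d(2)[of x y] \<delta>(2) that by simp
      from conv_mollifier_close[OF \<delta>(1) h hi this] have "\<bar>?c h x - h x\<bar> \<le> e'" .
      then have "\<bar>?c h x - h x\<bar> \<le> \<bar>e'\<bar>" by simp
      then show ?thesis using False by (simp only: abs_le_square_iff) (simp add: indicator_def)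
    qed
    have c2: "integrable lebesgue (\<lambda>x. (?c h x - h x)\<^sup>2)"
      by (rule Bochner_Integration.integrable_bound[of _ "\<lambda>x. e'\<^sup>2 * indicator (cball 0 (R + 1)) x"])
         (use close in \<open>auto intro!: integrable_mult_right integrable_indicator_cball\<close>)
    have c3: "(LINT x|lebesgue. (?c h x - h x)\<^sup>2) \<le> e'\<^sup>2 * V"
    proof -
      have "(LINT x|lebesgue. (?c h x - h x)\<^sup>2)
          \<le> (LINT x|lebesgue. e'\<^sup>2 * indicator (cball (0::'a) (R + 1)) x)"
        using c2 close by (intro integral_mono integrable_mult_right integrable_indicator_cball) auto
      then show ?thesis by (simp add: V_def)
    qed
    have i: "integrable lebesgue (\<lambda>x. 3 * ((?c f x - ?c h x)\<^sup>2 + (?c h x - h x)\<^sup>2 + (f x - h x)\<^sup>2))"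
      using c1(1) c2 fh(1) by simp
    have le: "(?c f x - f x)\<^sup>2 \<le> 3 * ((?c f x - ?c h x)\<^sup>2 + (?c h x - h x)\<^sup>2 + (f x - h x)\<^sup>2)" for x
      using sum3_squares_le[of "?c f x - ?c h x" "?c h x - h x" "h x - f x"]
      by (simp add: power2_commute[of "h x" "f x"])
    have "(LINT x|lebesgue. (?c f x - f x)\<^sup>2)
       \<le> (LINT x|lebesgue. 3 * ((?c f x - ?c h x)\<^sup>2 + (?c h x - h x)\<^sup>2 + (f x - h x)\<^sup>2))"
      using i le by (intro integral_mono Bochner_Integration.integrable_bound[OF i] AE_I2) auto
    also have "\<dots> \<le> 3 * (e / 12 + e / 12 + e / 12)"
      using c1 c2 c3 fh e'V by simp
    also have "\<dots> < e" using \<open>e > 0\<close> by simp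
    finally show ?thesis .
  qed
  moreover have "eventually (\<lambda>n. \<epsilon> n < min d 1) sequentially"
    using \<epsilon>(2) d(1) by (intro order_tendstoD) auto
  ultimately have "eventually (\<lambda>n. (LINT x|lebesgue. (conv f (mollifier (\<epsilon> n)) x - f x)\<^sup>2) < e) sequentially"
    using \<epsilon>(1) by (auto elim!: eventually_mono)
  then show "\<exists>no. \<forall>n\<ge>no. norm ((LINT x|lebesgue. (conv f (mollifier (\<epsilon> n)) x - f x)\<^sup>2) - 0) < e"
    by (simp add: eventually_sequentially)
qed

lemma integrable_mollify_diff_L2:
  fixes f :: "'a::euclidean_space \<Rightarrow> real"
  assumes "\<epsilon> > 0" and f: "integrable lebesgue f" and f2: "integrable lebesgue (\<lambda>x. (f x)\<^sup>2)"
  shows "integrable lebesgue (\<lambda>x. (conv f (mollifier \<epsilon>) x - f x)\<^sup>2)"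
proof (rule integrable_square_diff)
  show "conv f (mollifier \<epsilon>) \<in> borel_measurable lebesgue"
    by (intro continuous_imp_lebesgue_measurable smooth_continuous
          smooth_conv[OF f smooth_mollifier[OF assms(1)], of \<epsilon>]) (simp add: mollifier_eq_0 assms(1))
qed (use assms conv_mollifier_L2 in auto)

section \<open>Weak derivatives\<close>

lemma test_functionsI:
  assumes "smooth \<phi>" and "compact K" and "K \<subseteq> \<Omega>" and "\<And>x. x \<notin> K \<Longrightarrow> \<phi> x = 0"
  shows "\<phi> \<in> test_functions \<Omega>"
proof -
  have sub: "closure {x. \<phi> x \<noteq> 0} \<subseteq> K"
    using assms(2,4) by (intro closure_minimal) (auto intro: compact_imp_closed)
  then have "compact (closure {x. \<phi> x \<noteq> 0})"
    using assms(2) by (meson closed_closure compact_imp_bounded bounded_subset compact_eq_bounded_closed)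
  then show ?thesis using sub assms by (auto simp: test_functions_def smooth_def)
qed

lemma test_functionsE:
  assumes "\<phi> \<in> test_functions \<Omega>"
  obtains K where "smooth \<phi>" and "compact K" and "K \<subseteq> \<Omega>"
    and "\<forall>x. x \<notin> K \<longrightarrow> \<phi> x = 0 \<and> grad \<phi> x = 0"
proof -
  let ?K = "closure {x. \<phi> x \<noteq> 0}"
  have s: "smooth \<phi>" "compact ?K" "?K \<subseteq> \<Omega>"
    using assms by (auto simp: test_functions_def smooth_def)
  have 0: "\<phi> x = 0" if "x \<notin> ?K" for x
    using closure_subset[of "{x. \<phi> x \<noteq> 0}"] that by blast
  have 1: "grad \<phi> x = 0" if "x \<notin> ?K" for x
  proof (rule grad_eqI)
    have "((\<lambda>z. 0) has_derivative (\<lambda>h. 0)) (at x)" by simp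
    then have "(\<phi> has_derivative (\<lambda>h. 0)) (at x)"
    proof (rule has_derivative_transform_within_open)
      show "open (- ?K)" by (intro open_Compl closed_closure)
      show "x \<in> - ?K" unfolding Compl_iff by (rule that)
      show "0 = \<phi> y" if "y \<in> - ?K" for y 
        using 0[OF that[unfolded Compl_iff]] by (rule sym)
    qed
    then show "(\<phi> has_derivative (\<lambda>h. 0 \<bullet> h)) (at x)" by simp
  qed
  have 2: "\<forall>x. x \<notin> ?K \<longrightarrow> \<phi> x = 0 \<and> grad \<phi> x = 0"
  proof (intro allI impI)
    fix x assume x: "x \<notin> ?K"
    show "\<phi> x = 0 \<and> grad \<phi> x = 0" by (rule conjI[OF 0[OF x] 1[OF x]])
  qed
  show thesis by (rule that[OF s 2])
qed

lemma compact_neighbourhood: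
  fixes K :: "'a::euclidean_space set"
  assumes "compact K" and "open \<Omega>" and "K \<subseteq> \<Omega>"
  obtains \<epsilon> K' where "\<epsilon> > 0" and "compact K'" and "K' \<subseteq> \<Omega>"
    and "\<forall>x\<in>K. \<forall>y. norm (x - y) < \<epsilon> \<longrightarrow> y \<in> K'"
proof -
  obtain \<epsilon> where \<epsilon>: "\<epsilon> > 0" "(\<Union>x\<in>K. cball x \<epsilon>) \<subseteq> \<Omega>"
    using compact_subset_open_imp_cball_epsilon_subset[OF assms] .
  let ?S = "{x + y | x y. x \<in> K \<and> y \<in> cball (0::'a) \<epsilon>}"
  have 1: "compact ?S"
    using assms(1) by (rule compact_sums) auto
  have 2: "?S \<subseteq> \<Omega>"
    using \<epsilon>(2) by (fastforce simp: dist_norm)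
  have 3: "\<forall>x\<in>K. \<forall>y. norm (x - y) < \<epsilon> \<longrightarrow> y \<in> ?S"
  proof (intro ballI allI impI)
    fix x y assume "x \<in> K" "norm (x - y) < \<epsilon>"
    then show "y \<in> ?S"
      by (intro CollectI exI[of _ x] exI[of _ "y - x"]) (simp add: norm_minus_commute)
  qed
  show thesis by (rule that[OF \<epsilon>(1) 1 2 3])
qed

lemma locally_integrable_onD:
  assumes "locally_integrable_on u \<Omega>" and "compact K" and "K \<subseteq> \<Omega>"
  shows "integrable lebesgue (\<lambda>x. indicator K x * u x)"
  using assms lmeasurable_compact[OF assms(2)]
  by (auto simp: locally_integrable_on_def integrable_restrict_space)

lemma integrable_locally_mult:
  fixes h :: "'a::euclidean_space \<Rightarrow> real"
  assumes u: "locally_integrable_on u \<Omega>" and "open \<Omega>" and K: "compact K" "K \<subseteq> \<Omega>"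
    and h: "continuous_on UNIV h" "\<And>x. x \<notin> K \<Longrightarrow> h x = 0"
  shows "integrable (lebesgue_on \<Omega>) (\<lambda>x. u x * h x)"
proof -
  have uK: "integrable lebesgue (\<lambda>x. indicator K x * u x)"
    using locally_integrable_onD[OF u K] .
  obtain R where R: "\<forall>x\<in>K. norm x \<le> R"
    using compact_imp_bounded[OF K(1)] unfolding bounded_iff by blast
  have "h z = 0" if "norm z > R" for z using h(2)[of z] R that by fastforce
  then obtain B where B: "B > 0" "\<And>z. norm (h z) \<le> B"
    using bounded_if_vanishing_outside_ball[OF h(1)] by blast
  have eq: "(\<lambda>x. indicator \<Omega> x *\<^sub>R (u x * h x)) = (\<lambda>x. (indicator K x * u x) * h x)"
    using h(2) K by (auto simp: indicator_def fun_eq_iff)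
  have "integrable lebesgue (\<lambda>x. (indicator K x * u x) * h x)"
  proof (rule Bochner_Integration.integrable_bound)
    show "integrable lebesgue (\<lambda>x. B * (indicator K x * u x))" using uK by (rule integrable_mult_right)
    show "(\<lambda>x. (indicator K x * u x) * h x) \<in> borel_measurable lebesgue"
      by (rule borel_measurable_times[OF borel_measurable_integrable[OF uK]
            continuous_imp_lebesgue_measurable[OF h(1)]])
    show "AE x in lebesgue. norm ((indicator K x * u x) * h x) \<le> norm (B * (indicator K x * u x))"
      using B(1) mult_left_mono[OF B(2) abs_ge_zero[of "indicator K _ * u _"]]
      by (intro AE_I2) (simp add: abs_mult mult.commute)
  qed
  then show ?thesis using \<open>open \<Omega>\<close> by (simp add: integrable_restrict_space eq[symmetric])
qed

text \<open>The mollifications of \<open>h\<close> are test functions with supports in one compact subset of \<open>\<Omega>\<close>, and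
  they converge boundedly to \<open>h\<close>.\<close>

lemma continuous_test:
  fixes h :: "'a::euclidean_space \<Rightarrow> real"
  assumes g: "locally_integrable_on g \<Omega>" and \<Omega>: "open \<Omega>"
    and test: "\<And>\<phi>. \<phi> \<in> test_functions \<Omega> \<Longrightarrow> (LINT x|lebesgue_on \<Omega>. g x * \<phi> x) = 0"
    and K: "compact K" "K \<subseteq> \<Omega>" and h: "continuous_on UNIV h" "\<And>x. x \<notin> K \<Longrightarrow> h x = 0"
  shows "(LINT x|lebesgue_on \<Omega>. g x * h x) = 0"
proof -
  obtain \<epsilon> K' where K': "\<epsilon> > 0" "compact K'" "K' \<subseteq> \<Omega>"
    and near: "\<forall>x\<in>K. \<forall>y. norm (x - y) < \<epsilon> \<longrightarrow> y \<in> K'"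
    by (rule compact_neighbourhood[OF K(1) \<Omega> K(2)])
  obtain R where R: "\<forall>x\<in>K. norm x \<le> R"
    using compact_imp_bounded[OF K(1)] unfolding bounded_iff by blast
  have hR: "h z = 0" if "norm z > R" for z using h(2)[of z] R that by fastforce
  then obtain B where B: "B > 0" "\<And>z. norm (h z) \<le> B"
    using bounded_if_vanishing_outside_ball[OF h(1)] by blast
  have hi: "integrable lebesgue h" by (rule integrable_if_vanishing_outside_ball[OF h(1) hR])
  define \<delta> where "\<delta> n = \<epsilon> * inverse (real (Suc n))" for n
  have \<delta>: "\<delta> n > 0" "\<delta> n \<le> \<epsilon>" for n using K'(1) by (auto simp: \<delta>_def field_simps)
  have \<delta>0: "\<delta> \<longlonglongrightarrow> 0"
    unfolding \<delta>_def by (rule tendsto_mult_right_zero[OF LIMSEQ_inverse_real_of_nat])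
  let ?h = "\<lambda>n. conv h (mollifier (\<delta> n))"
  have h0: "?h n x = 0" if "x \<notin> K'" for n x
  proof -
    have "h y * mollifier (\<delta> n) (x - y) = 0" for y
    proof (cases "y \<in> K")
      case True
      then have "\<delta> n \<le> norm (x - y)"
        using near that \<delta>(2)[of n] by (force simp: norm_minus_commute)
      then show ?thesis by (simp add: mollifier_eq_0 \<delta>)
    qed (simp add: h)
    then have "(\<lambda>y. h y * mollifier (\<delta> n) (x - y)) = (\<lambda>y. 0)" by blast
    then show ?thesis by (simp add: conv_def)
  qed
  have sm: "smooth (?h n)" for n
    by (rule smooth_conv[OF hi smooth_mollifier[OF \<delta>(1)[of n]], where \<epsilon>="\<delta> n"]) (simp add: mollifier_eq_0 \<delta>)
  have z: "(LINT x|lebesgue_on \<Omega>. g x * ?h n x) = 0" for n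
    by (rule test, rule test_functionsI[OF sm K'(2,3) h0])
  have hB: "\<bar>?h n x\<bar> \<le> B" for n x
    using conv_mollifier_bounds[OF \<delta>(1) hi, of "-B" B] B(2) by (simp add: abs_le_iff minus_le_iff)
  have conv: "(\<lambda>n. ?h n x) \<longlonglongrightarrow> h x" for x
  proof (rule LIMSEQ_I)
    fix e :: real assume "e > 0"
    then have "e / 2 > 0" by simp
    then obtain d where d: "d > 0" "\<And>x y. norm (x - y) < d \<Longrightarrow> norm (h x - h y) < e / 2"
      using uniformly_continuous_if_vanishing_outside_ball[OF h(1) hR] by blast
    have "eventually (\<lambda>n. \<delta> n < d) sequentially" using \<delta>0 d(1) by (rule order_tendstoD)
    then have "eventually (\<lambda>n. norm (?h n x - h x) < e) sequentially"
    proof (rule eventually_mono)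
      fix n assume "\<delta> n < d"
      then have "\<bar>h x - h y\<bar> \<le> e / 2" if "norm (x - y) < \<delta> n" for x y
        using d(2)[of x y] that by simp
      from conv_mollifier_close[OF \<delta>(1) h(1) hR hi this] have "\<bar>?h n x - h x\<bar> \<le> e / 2" .
      then show "norm (?h n x - h x) < e" using \<open>e > 0\<close> by simp
    qed
    then show "\<exists>no. \<forall>n\<ge>no. norm (?h n x - h x) < e" by (simp add: eventually_sequentially)
  qed
  have gK: "integrable (lebesgue_on \<Omega>) (\<lambda>x. B * (indicator K' x * \<bar>g x\<bar>))"
  proof -
    have "integrable lebesgue (\<lambda>x. \<bar>indicator K' x * g x\<bar>)"
      using locally_integrable_onD[OF g K'(2,3)] by (rule integrable_abs)
    also have "(\<lambda>x. \<bar>indicator K' x * g x\<bar>) = (\<lambda>x. indicator \<Omega> x *\<^sub>R (indicator K' x * \<bar>g x\<bar>))"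
      using K' by (auto simp: indicator_def fun_eq_iff)
    finally show ?thesis using \<Omega> by (simp add: integrable_restrict_space)
  qed
  have "(\<lambda>n. LINT x|lebesgue_on \<Omega>. g x * ?h n x) \<longlonglongrightarrow> (LINT x|lebesgue_on \<Omega>. g x * h x)"
  proof (rule integral_dominated_convergence[where w="\<lambda>x. B * (indicator K' x * \<bar>g x\<bar>)"])
    show "(\<lambda>x. g x * h x) \<in> borel_measurable (lebesgue_on \<Omega>)"
      using integrable_locally_mult[OF g \<Omega> K h] by (rule borel_measurable_integrable)
    show "(\<lambda>x. g x * ?h n x) \<in> borel_measurable (lebesgue_on \<Omega>)" for n
      using integrable_locally_mult[OF g \<Omega> K'(2,3) smooth_continuous[OF sm] h0]
      by (rule borel_measurable_integrable)
    show "AE x in lebesgue_on \<Omega>. (\<lambda>n. g x * ?h n x) \<longlonglongrightarrow> g x * h x"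
      by (intro AE_I2 tendsto_mult tendsto_const conv)
    show "AE x in lebesgue_on \<Omega>. norm (g x * ?h n x) \<le> B * (indicator K' x * \<bar>g x\<bar>)" for n
      using h0 mult_right_mono[OF hB abs_ge_zero]
      by (intro AE_I2) (auto simp: indicator_def abs_mult mult.commute)
  qed (rule gK)
  then show ?thesis by (simp only: z LIMSEQ_const_iff)
qed

text \<open>The fundamental lemma of the calculus of variations. By the previous lemma it is enough to test
  with continuous functions, and these approximate \<open>sgn g\<close> times a cut-off function boundedly, so
  that \<open>\<integral> \<bar>g\<bar> = 0\<close> locally.\<close>

theorem weakly_zero_imp_AE_zero:
  fixes g :: "'a::euclidean_space \<Rightarrow> real"
  assumes g: "locally_integrable_on g \<Omega>" and \<Omega>: "open \<Omega>"
    and test: "\<And>\<phi>. \<phi> \<in> test_functions \<Omega> \<Longrightarrow> (LINT x|lebesgue_on \<Omega>. g x * \<phi> x) = 0"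
  shows "AE x in lebesgue_on \<Omega>. g x = 0"
proof -
  have loc: "negligible {x \<in> ball x0 \<rho>. g x \<noteq> 0}" if K: "cball x0 \<rho> \<subseteq> \<Omega>" for x0 \<rho>
  proof -
    let ?K = "cball x0 \<rho>"
    define \<theta> where "\<theta> x = max 0 (\<rho> - dist x0 x)" for x
    have \<theta>: "continuous_on UNIV \<theta>" "\<And>x. x \<notin> ?K \<Longrightarrow> \<theta> x = 0" "\<And>x. \<theta> x \<ge> 0"
      "\<And>x. x \<in> ball x0 \<rho> \<Longrightarrow> \<theta> x > 0"
      proof -
      show "continuous_on UNIV \<theta>" unfolding \<theta>_def by (intro continuous_intros)
    qed (auto simp: \<theta>_def)
    have \<theta>_le: "\<theta> x \<le> \<bar>\<rho>\<bar>" for x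
      using zero_le_dist[of x0 x] unfolding \<theta>_def by linarith
    define G where "G x = indicator ?K x * g x" for x
    have G: "integrable lebesgue G"
      unfolding G_def by (rule locally_integrable_onD[OF g compact_cball K])
    have "(\<lambda>x. sgn (G x)) \<in> borel_measurable lebesgue"
      using borel_measurable_integrable[OF G] by (simp add: borel_measurable_sgn)
    then have "(\<lambda>x. sgn (G x)) measurable_on UNIV"
      by (intro lebesgue_measurable_imp_measurable_on) auto
    then obtain N s where N: "negligible N" and s: "\<And>m. continuous_on UNIV (s m)"
      and lim: "\<And>x. x \<notin> N \<Longrightarrow> (\<lambda>m. s m x) \<longlonglongrightarrow> sgn (G x)"
      unfolding measurable_on_def by auto
    let ?h = "\<lambda>m x. clip 1 (s m x) * \<theta> x"
    have hc: "continuous_on UNIV (?h m)" for m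
      by (intro continuous_on_mult continuous_clip s \<theta>)
    have eq: "(LINT x|lebesgue_on \<Omega>. g x * ?h m x) = (LINT x|lebesgue. G x * ?h m x)" for m
    proof -
      have "(\<lambda>x. indicator \<Omega> x *\<^sub>R (g x * ?h m x)) = (\<lambda>x. G x * ?h m x)"
        using \<theta>(2) K by (fastforce simp: indicator_def fun_eq_iff G_def)
      then show ?thesis using \<Omega> by (simp add: integral_restrict_space)
    qed
    have z: "(LINT x|lebesgue. G x * ?h m x) = 0" for m
      using continuous_test[OF g \<Omega> test compact_cball K hc] \<theta>(2) eq by simp
    have "(\<lambda>m. LINT x|lebesgue. G x * ?h m x) \<longlonglongrightarrow> (LINT x|lebesgue. \<bar>G x\<bar> * \<theta> x)"
    proof (rule integral_dominated_convergence[where w="\<lambda>x. \<bar>\<rho>\<bar> * \<bar>G x\<bar>"])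
      note [measurable] = borel_measurable_integrable[OF G] continuous_imp_lebesgue_measurable[OF \<theta>(1)]
        continuous_imp_lebesgue_measurable[OF hc]
      show "(\<lambda>x. \<bar>G x\<bar> * \<theta> x) \<in> borel_measurable lebesgue" by measurable
      show "(\<lambda>x. G x * ?h m x) \<in> borel_measurable lebesgue" for m by measurable
      show "integrable lebesgue (\<lambda>x. \<bar>\<rho>\<bar> * \<bar>G x\<bar>)" using G by simp
      have "AE x in lebesgue. x \<notin> N"
        using N by (intro AE_not_in) (simp add: negligible_iff_null_sets)
      then show "AE x in lebesgue. (\<lambda>m. G x * ?h m x) \<longlonglongrightarrow> \<bar>G x\<bar> * \<theta> x"
      proof (rule AE_mp, intro AE_I2 impI)
        fix x assume "x \<notin> N"
        have "(\<lambda>m. G x * ?h m x) \<longlonglongrightarrow> G x * (clip 1 (sgn (G x)) * \<theta> x)"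
          unfolding clip_def by (intro tendsto_intros tendsto_max tendsto_min lim \<open>x \<notin> N\<close>)
        moreover have "G x * (clip 1 (sgn (G x)) * \<theta> x) = \<bar>G x\<bar> * \<theta> x"
          by (simp add: clip_def sgn_if)
        ultimately show "(\<lambda>m. G x * ?h m x) \<longlonglongrightarrow> \<bar>G x\<bar> * \<theta> x" by simp
      qed
      have "\<bar>G x * ?h m x\<bar> \<le> \<bar>\<rho>\<bar> * \<bar>G x\<bar>" for m x
      proof -
        have "\<bar>\<theta> x\<bar> \<le> \<bar>\<rho>\<bar>" using \<theta>_le[of x] \<theta>(3)[of x] by simp
        then have "\<bar>?h m x\<bar> \<le> 1 * \<bar>\<rho>\<bar>"
          unfolding abs_mult using abs_clip_le[of 1 "s m x"] by (intro mult_mono) auto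
        then show ?thesis
          using mult_left_mono[of "\<bar>?h m x\<bar>" "\<bar>\<rho>\<bar>" "\<bar>G x\<bar>"] by (simp add: abs_mult mult.commute)
      qed
      then show "AE x in lebesgue. norm (G x * ?h m x) \<le> \<bar>\<rho>\<bar> * \<bar>G x\<bar>" for m by simp
    qed
    then have "(LINT x|lebesgue. \<bar>G x\<bar> * \<theta> x) = 0" by (simp only: z LIMSEQ_const_iff)
    moreover have "integrable lebesgue (\<lambda>x. \<bar>G x\<bar> * \<theta> x)"
    proof (rule Bochner_Integration.integrable_bound[of _ "\<lambda>x. \<bar>\<rho>\<bar> * \<bar>G x\<bar>"])
      have "\<bar>\<bar>G x\<bar> * \<theta> x\<bar> \<le> \<bar>\<bar>\<rho>\<bar> * \<bar>G x\<bar>\<bar>" for x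
        using mult_left_mono[of "\<theta> x" "\<bar>\<rho>\<bar>" "\<bar>G x\<bar>"] \<theta>(3)[of x] \<theta>_le[of x]
        by (simp add: abs_mult mult.commute)
      then show "AE x in lebesgue. norm (\<bar>G x\<bar> * \<theta> x) \<le> norm (\<bar>\<rho>\<bar> * \<bar>G x\<bar>)" by simp
    qed (use G continuous_imp_lebesgue_measurable[OF \<theta>(1)] in auto)
    ultimately have ae: "AE x in lebesgue. \<bar>G x\<bar> * \<theta> x = 0"
      using integral_nonneg_eq_0_iff_AE[of lebesgue "\<lambda>x. \<bar>G x\<bar> * \<theta> x"] \<theta>(3) by simp
    have "AE x in lebesgue. x \<notin> {x \<in> ball x0 \<rho>. g x \<noteq> 0}"
      using ae
    proof (rule AE_mp, intro AE_I2 impI)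
      fix x assume 0: "\<bar>G x\<bar> * \<theta> x = 0"
      show "x \<notin> {x \<in> ball x0 \<rho>. g x \<noteq> 0}"
        using 0 \<theta>(4)[of x] by (auto simp: G_def)
    qed
    then show ?thesis
      by (simp add: negligible_iff_null_sets completion.AE_iff_null_sets AE_iff_null_sets)
  qed
  have "negligible {x \<in> \<Omega>. g x \<noteq> 0}"
  proof (subst locally_negligible_alt, intro ballI)
    fix x0 assume x0: "x0 \<in> {x \<in> \<Omega>. g x \<noteq> 0}"
    then obtain \<rho> where \<rho>: "\<rho> > 0" "cball x0 \<rho> \<subseteq> \<Omega>"
      using \<Omega> by (auto simp: open_contains_cball)
    have "openin (top_of_set {x \<in> \<Omega>. g x \<noteq> 0}) ({x \<in> \<Omega>. g x \<noteq> 0} \<inter> ball x0 \<rho>)"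
      by (rule openin_open_Int) simp
    moreover have "negligible ({x \<in> \<Omega>. g x \<noteq> 0} \<inter> ball x0 \<rho>)"
      by (rule negligible_subset[OF loc[OF \<rho>(2)]]) auto
    ultimately show "\<exists>U. openin (top_of_set {x \<in> \<Omega>. g x \<noteq> 0}) U \<and> x0 \<in> U \<and> negligible U"
      using x0 \<rho> by (intro exI[of _ "{x \<in> \<Omega>. g x \<noteq> 0} \<inter> ball x0 \<rho>"]) auto
  qed
  then have "AE x in lebesgue. x \<notin> {x \<in> \<Omega>. g x \<noteq> 0}"
    by (intro AE_not_in) (simp add: negligible_iff_null_sets)
  then have "AE x in lebesgue. x \<in> \<Omega> \<longrightarrow> g x = 0" by (rule eventually_mono) auto
  then show ?thesis using \<Omega> by (subst AE_restrict_space_iff) auto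
qed

subsection \<open>Integration by parts\<close>

lemma lebesgue_integral_reflect:
  fixes \<psi> :: "'a::euclidean_space \<Rightarrow> real"
  assumes "continuous_on UNIV \<psi>"
  shows "(LINT y|lebesgue. \<psi> (x - y)) = (LINT y|lebesgue. \<psi> y)"
proof -
  have [measurable]: "\<psi> \<in> borel_measurable borel"
    using assms by (rule borel_measurable_continuous_onI)
  have "(LINT y|lebesgue. \<psi> y) = (LINT y|lborel. \<psi> y)"
    by (rule integral_completion) simp
  also have "\<dots> = (LINT y|lborel. \<psi> (x - y))"
    by (subst lborel_affine[of "-1" x], simp, subst integral_density) (simp_all add: integral_distr)
  also have "\<dots> = (LINT y|lebesgue. \<psi> (x - y))"
    by (rule integral_completion[symmetric]) simp
  finally show ?thesis by simp
qed

text \<open>Near the origin, the convolution of \<open>\<phi>\<close> with the indicator of a large ball is the constant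
  \<open>\<integral> \<phi>\<close>; its derivative \<open>\<integral> \<nabla>\<phi>\<close> therefore vanishes.\<close>

lemma integral_grad_eq_0:
  fixes \<phi> :: "'a::euclidean_space \<Rightarrow> real"
  assumes \<phi>: "smooth \<phi>" and supp: "\<And>z. norm z > R \<Longrightarrow> \<phi> z = 0" and i: "i \<in> Basis"
  shows "(LINT x|lebesgue. grad \<phi> x \<bullet> i) = 0"
proof -
  let ?f = "indicator (cball (0::'a) (R + 1)) :: 'a \<Rightarrow> real"
  have supp': "norm z > R \<Longrightarrow> grad \<phi> z = 0" for z
    using grad_eq_0_outside_ball[OF \<phi> supp] .
  have loc: "conv ?f \<psi> x = (LINT y|lebesgue. \<psi> y)"
    if \<psi>: "continuous_on UNIV \<psi>" "\<And>z. norm z > R \<Longrightarrow> \<psi> z = 0" and x: "norm x \<le> 1"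
    for \<psi> :: "'a \<Rightarrow> real" and x
  proof -
    have "?f y * \<psi> (x - y) = \<psi> (x - y)" for y
      using norm_triangle_sub[of y x] x \<psi>(2)[of "x - y"]
      by (auto simp: indicator_def norm_minus_commute)
    then have "(\<lambda>y. ?f y * \<psi> (x - y)) = (\<lambda>y. \<psi> (x - y))" by blast
    then have "conv ?f \<psi> x = (LINT y|lebesgue. \<psi> (x - y))" by (simp add: conv_def)
    then show ?thesis using lebesgue_integral_reflect[OF \<psi>(1)] by simp
  qed
  have "(conv ?f \<phi> has_derivative (\<lambda>h. 0)) (at 0)"
  proof (rule has_derivative_transform_within_open)
    show "((\<lambda>x. LINT y|lebesgue. \<phi> y) has_derivative (\<lambda>h. 0)) (at 0)" by simp
    show "(LINT y|lebesgue. \<phi> y) = conv ?f \<phi> x" if "x \<in> ball 0 1" for x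
      using loc[OF smooth_continuous[OF \<phi>] supp, of x] that by simp
  qed simp_all
  then have "grad (conv ?f \<phi>) 0 = 0" by (intro grad_eqI) simp
  then have "conv ?f (\<lambda>z. grad \<phi> z \<bullet> i) 0 = 0"
    using grad_conv[where x=0, OF integrable_indicator_cball[of 0 "R + 1"] \<phi> supp i] by simp
  then show ?thesis
    using loc[of "\<lambda>z. grad \<phi> z \<bullet> i" 0] supp' smooth_continuous[OF smooth_grad_component[OF \<phi> i]] by simp
qed

lemma integral_grad_test_eq_0:
  assumes "\<phi> \<in> test_functions \<Omega>" and "open \<Omega>" and "i \<in> Basis"
  shows "(LINT x|lebesgue_on \<Omega>. grad \<phi> x \<bullet> i) = 0"
proof -
  obtain K where \<phi>: "smooth \<phi>" "compact K" "K \<subseteq> \<Omega>"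
      and \<phi>0: "\<forall>x. x \<notin> K \<longrightarrow> \<phi> x = 0 \<and> grad \<phi> x = 0"
    using test_functionsE[OF assms(1)] .
  obtain R where R: "\<forall>x\<in>K. norm x \<le> R"
    using compact_imp_bounded[OF \<phi>(2)] unfolding bounded_iff by blast
  have "\<phi> z = 0" if "norm z > R" for z
  proof -
    have "z \<notin> K" using R that by (meson linorder_not_less)
    then show ?thesis using \<phi>0 by blast
  qed
  then have "(LINT x|lebesgue. grad \<phi> x \<bullet> i) = 0"
    using integral_grad_eq_0[OF \<phi>(1) _ assms(3)] by blast
  moreover have "(\<lambda>x. indicator \<Omega> x *\<^sub>R (grad \<phi> x \<bullet> i)) = (\<lambda>x. grad \<phi> x \<bullet> i)"
    using \<phi>(3) \<phi>0 by (fastforce simp: indicator_def fun_eq_iff)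
  ultimately show ?thesis using assms(2) by (simp add: integral_restrict_space)
qed

lemma test_functions_mult:
  assumes "\<phi> \<in> test_functions \<Omega>" and "smooth f"
  shows "(\<lambda>x. f x * \<phi> x) \<in> test_functions \<Omega>"
proof -
  obtain K where \<phi>: "smooth \<phi>" "compact K" "K \<subseteq> \<Omega>"
      and \<phi>0: "\<forall>x. x \<notin> K \<longrightarrow> \<phi> x = 0 \<and> grad \<phi> x = 0"
    using test_functionsE[OF assms(1)] .
  show ?thesis
    by (rule test_functionsI[OF smooth_mult[OF assms(2) \<phi>(1)] \<phi>(2,3)]) (simp add: \<phi>0)
qed

lemma locally_integrable_continuous:
  fixes f :: "'a::euclidean_space \<Rightarrow> real"
  assumes "continuous_on UNIV f"
  shows "locally_integrable_on f \<Omega>"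
  unfolding locally_integrable_on_def
proof (intro allI impI)
  fix K assume K: "compact K \<and> K \<subseteq> \<Omega>"
  have "integrable lebesgue (\<lambda>x. indicator K x *\<^sub>R f x)"
  proof -
    obtain B where B: "\<And>x. x \<in> K \<Longrightarrow> norm (f x) \<le> B"
      using compact_imp_bounded[OF compact_continuous_image[OF continuous_on_subset[OF assms] conjunct1[OF K]]]
      unfolding bounded_iff by auto
    have Km: "K \<in> sets lebesgue" "emeasure lebesgue K < \<infinity>"
      using lmeasurable_compact[of K] K by (auto simp: fmeasurable_def)
    show ?thesis
    proof (rule Bochner_Integration.integrable_bound)
      show "integrable lebesgue (\<lambda>x. B * indicator K x)"
        using Km by (intro integrable_mult_right integrable_real_indicator) auto
      show "(\<lambda>x. indicator K x *\<^sub>R f x) \<in> borel_measurable lebesgue"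
        using Km continuous_imp_lebesgue_measurable[OF assms] by simp
      show "AE x in lebesgue. norm (indicator K x *\<^sub>R f x) \<le> norm (B * indicator K x)"
        using B by (intro AE_I2) (force simp: indicator_def)
    qed
  qed
  then show "integrable (lebesgue_on K) f"
    using lmeasurable_compact[of K] K by (auto simp: integrable_restrict_space fmeasurable_def)
qed

definition has_weak_grad :: "'a::euclidean_space set \<Rightarrow> ('a \<Rightarrow> real) \<Rightarrow> ('a \<Rightarrow> 'a) \<Rightarrow> bool" where
  "has_weak_grad \<Omega> u G \<longleftrightarrow> (\<forall>i\<in>Basis. has_weak_pderiv \<Omega> i u (\<lambda>x. G x \<bullet> i))"

lemma has_weak_pderivD:
  assumes "has_weak_pderiv \<Omega> i u g" and "\<phi> \<in> test_functions \<Omega>"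
  shows "(LINT x|lebesgue_on \<Omega>. u x * (grad \<phi> x \<bullet> i)) = - (LINT x|lebesgue_on \<Omega>. g x * \<phi> x)"
proof -
  have s: "smooth \<phi>" using assms(2) by (auto elim: test_functionsE)
  show ?thesis using assms unfolding has_weak_pderiv_def frechet_derivative_smooth[OF s, symmetric] by blast
qed

lemma has_weak_pderivI:
  assumes "locally_integrable_on u \<Omega>" and "locally_integrable_on g \<Omega>"
    and "\<And>\<phi>. \<phi> \<in> test_functions \<Omega> \<Longrightarrow>
      (LINT x|lebesgue_on \<Omega>. u x * (grad \<phi> x \<bullet> i)) = - (LINT x|lebesgue_on \<Omega>. g x * \<phi> x)"
  shows "has_weak_pderiv \<Omega> i u g"
proof -
  have "smooth \<phi>" if "\<phi> \<in> test_functions \<Omega>" for \<phi> using that by (auto elim: test_functionsE)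
  then show ?thesis using assms by (simp add: has_weak_pderiv_def frechet_derivative_smooth)
qed

lemma integrable_test:
  assumes "locally_integrable_on u \<Omega>" and "open \<Omega>" and "\<phi> \<in> test_functions \<Omega>"
  shows "integrable (lebesgue_on \<Omega>) (\<lambda>x. u x * \<phi> x)"
    and "integrable (lebesgue_on \<Omega>) (\<lambda>x. u x * (grad \<phi> x \<bullet> i))"
proof -
  obtain K where \<phi>: "smooth \<phi>" "compact K" "K \<subseteq> \<Omega>"
      and \<phi>0: "\<forall>x. x \<notin> K \<longrightarrow> \<phi> x = 0 \<and> grad \<phi> x = 0"
    using test_functionsE[OF assms(3)] .
  show "integrable (lebesgue_on \<Omega>) (\<lambda>x. u x * \<phi> x)"
    by (rule integrable_locally_mult[OF assms(1,2) \<phi>(2,3) smooth_continuous[OF \<phi>(1)]]) (simp add: \<phi>0)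
  have "continuous_on UNIV (\<lambda>x. grad \<phi> x \<bullet> i)"
    by (intro continuous_on_inner continuous_grad[OF \<phi>(1)] continuous_on_const)
  then show "integrable (lebesgue_on \<Omega>) (\<lambda>x. u x * (grad \<phi> x \<bullet> i))"
    by (rule integrable_locally_mult[OF assms(1,2) \<phi>(2,3)]) (simp add: \<phi>0)
qed

lemma has_weak_pderiv_smooth:
  assumes f: "smooth f" and \<Omega>: "open \<Omega>" and i: "i \<in> Basis"
  shows "has_weak_pderiv \<Omega> i f (\<lambda>x. grad f x \<bullet> i)"
proof (rule has_weak_pderivI)
  show lf: "locally_integrable_on f \<Omega>" "locally_integrable_on (\<lambda>x. grad f x \<bullet> i) \<Omega>"
    by (intro locally_integrable_continuous smooth_continuous f smooth_grad_component i)+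
  fix \<phi> assume \<phi>: "\<phi> \<in> test_functions \<Omega>"
  have s: "smooth \<phi>" using \<phi> by (auto elim: test_functionsE)
  have "0 = (LINT x|lebesgue_on \<Omega>. grad (\<lambda>x. f x * \<phi> x) x \<bullet> i)"
    using integral_grad_test_eq_0[OF test_functions_mult[OF \<phi> f] \<Omega> i] by simp
  also have "\<dots> = (LINT x|lebesgue_on \<Omega>. f x * (grad \<phi> x \<bullet> i) + (grad f x \<bullet> i) * \<phi> x)"
    by (simp only: grad_mult[OF f s] inner_add_left inner_scaleR_left mult.commute[of "\<phi> _"])
  also have "\<dots> = (LINT x|lebesgue_on \<Omega>. f x * (grad \<phi> x \<bullet> i)) + (LINT x|lebesgue_on \<Omega>. (grad f x \<bullet> i) * \<phi> x)"
    using integrable_test(2)[OF lf(1) \<Omega> \<phi>] integrable_test(1)[OF lf(2) \<Omega> \<phi>] by simp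
  finally show "(LINT x|lebesgue_on \<Omega>. f x * (grad \<phi> x \<bullet> i)) = - (LINT x|lebesgue_on \<Omega>. (grad f x \<bullet> i) * \<phi> x)"
    by simp
qed

lemma locally_integrable_diff:
  "locally_integrable_on u \<Omega> \<Longrightarrow> locally_integrable_on v \<Omega> \<Longrightarrow> locally_integrable_on (\<lambda>x. u x - v x) \<Omega>"
  by (simp add: locally_integrable_on_def)

lemma has_weak_pderiv_diff:
  assumes u: "has_weak_pderiv \<Omega> i u g" and v: "has_weak_pderiv \<Omega> i v h" and \<Omega>: "open \<Omega>"
  shows "has_weak_pderiv \<Omega> i (\<lambda>x. u x - v x) (\<lambda>x. g x - h x)"
proof (rule has_weak_pderivI)
  have l: "locally_integrable_on u \<Omega>" "locally_integrable_on v \<Omega>"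
    "locally_integrable_on g \<Omega>" "locally_integrable_on h \<Omega>"
    using u v by (auto simp: has_weak_pderiv_def)
  then show "locally_integrable_on (\<lambda>x. u x - v x) \<Omega>" "locally_integrable_on (\<lambda>x. g x - h x) \<Omega>"
    by (auto intro: locally_integrable_diff)
  fix \<phi> assume \<phi>: "\<phi> \<in> test_functions \<Omega>"
  show "(LINT x|lebesgue_on \<Omega>. (u x - v x) * (grad \<phi> x \<bullet> i)) = - (LINT x|lebesgue_on \<Omega>. (g x - h x) * \<phi> x)"
    using has_weak_pderivD[OF u \<phi>] has_weak_pderivD[OF v \<phi>]
      integrable_test(2)[OF l(1) \<Omega> \<phi>] integrable_test(2)[OF l(2) \<Omega> \<phi>]
      integrable_test(1)[OF l(3) \<Omega> \<phi>] integrable_test(1)[OF l(4) \<Omega> \<phi>]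
    by (simp add: left_diff_distrib)
qed

lemma has_weak_pderiv_unique:
  assumes g: "has_weak_pderiv \<Omega> i u g" and h: "has_weak_pderiv \<Omega> i u h" and \<Omega>: "open \<Omega>"
  shows "AE x in lebesgue_on \<Omega>. g x = h x"
proof -
  have "AE x in lebesgue_on \<Omega>. g x - h x = 0"
  proof (rule weakly_zero_imp_AE_zero[OF _ \<Omega>])
    show "locally_integrable_on (\<lambda>x. g x - h x) \<Omega>"
      using g h by (auto simp: has_weak_pderiv_def intro: locally_integrable_diff)
    fix \<phi> assume \<phi>: "\<phi> \<in> test_functions \<Omega>"
    show "(LINT x|lebesgue_on \<Omega>. (g x - h x) * \<phi> x) = 0"
      using has_weak_pderivD[OF has_weak_pderiv_diff[OF g h \<Omega>] \<phi>] by simp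
  qed
  then show ?thesis by (rule eventually_mono) simp
qed

lemma AE_lebesgue_on_measurable:
  fixes f g :: "'a::euclidean_space \<Rightarrow> 'b::euclidean_space"
  assumes f: "f \<in> borel_measurable (lebesgue_on \<Omega>)" and \<Omega>: "\<Omega> \<in> sets lebesgue"
    and ae: "AE x in lebesgue_on \<Omega>. f x = g x"
  shows "g \<in> borel_measurable (lebesgue_on \<Omega>)"
proof -
  have "AE x in lebesgue. x \<in> \<Omega> \<longrightarrow> f x = g x"
    using ae \<Omega> by (subst (asm) AE_restrict_space_iff) auto
  then obtain N where N: "N \<in> null_sets lebesgue" "{x. \<not> (x \<in> \<Omega> \<longrightarrow> f x = g x)} \<subseteq> N"
    by (auto simp: eventually_ae_filter)
  have "(\<lambda>x. if x \<in> \<Omega> then f x else 0) measurable_on UNIV"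
    using f \<Omega> by (simp add: measurable_on_UNIV measurable_on_iff_borel_measurable)
  then have "(\<lambda>x. if x \<in> \<Omega> then g x else 0) measurable_on UNIV"
    by (rule measurable_on_spike[of _ _ N]) (use N in \<open>auto simp: negligible_iff_null_sets\<close>)
  then show ?thesis
    using \<Omega> by (simp add: measurable_on_UNIV measurable_on_iff_borel_measurable)
qed

subsection \<open>Square integrable functions\<close>

text \<open>\<open>L\<^sup>2\<close> and its norm for fields with values in a Euclidean space, over an arbitrary measure.\<close>

definition sqint :: "'c measure \<Rightarrow> ('c \<Rightarrow> 'b::euclidean_space) \<Rightarrow> bool" where
  "sqint M G \<longleftrightarrow> G \<in> borel_measurable M \<and> integrable M (\<lambda>x. (norm (G x))\<^sup>2)"

definition n2 :: "'c measure \<Rightarrow> ('c \<Rightarrow> 'b::euclidean_space) \<Rightarrow> real" where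
  "n2 M G = sqrt (LINT x|M. (norm (G x))\<^sup>2)"

lemma n2_nonneg [simp]: "n2 M G \<ge> 0"
  by (simp add: n2_def)

lemma n2_power2: "(n2 M G)\<^sup>2 = (LINT x|M. (norm (G x))\<^sup>2)"
  by (simp add: n2_def)

lemma sqint_measurable: "sqint M G \<Longrightarrow> G \<in> borel_measurable M"
  by (simp add: sqint_def)

lemma sqint_bound:
  fixes F :: "'c \<Rightarrow> 'b::euclidean_space" and G :: "'c \<Rightarrow> 'd::euclidean_space"
  assumes "sqint M F" and "G \<in> borel_measurable M" and "AE x in M. norm (G x) \<le> norm (F x)"
  shows "sqint M G" and "n2 M G \<le> n2 M F"
proof -
  have "AE x in M. (norm (G x))\<^sup>2 \<le> (norm (F x))\<^sup>2"
    using assms(3) by (rule eventually_mono) (simp add: power_mono)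
  then show G: "sqint M G"
    using assms by (auto simp: sqint_def intro!: Bochner_Integration.integrable_bound[of M "\<lambda>x. (norm (F x))\<^sup>2"])
  show "n2 M G \<le> n2 M F"
    unfolding n2_def real_sqrt_le_iff
    using G assms(1) \<open>AE x in M. (norm (G x))\<^sup>2 \<le> (norm (F x))\<^sup>2\<close>
    by (intro integral_mono_AE) (auto simp: sqint_def)
qed

lemma n2_cong_AE:
  assumes "F \<in> borel_measurable M" and "G \<in> borel_measurable M" and "AE x in M. F x = G x"
  shows "n2 M F = n2 M G"
  unfolding n2_def using assms by (intro arg_cong[of _ _ sqrt] integral_cong_AE) (auto elim!: eventually_mono)

lemma sqint_scaleR: "sqint M G \<Longrightarrow> sqint M (\<lambda>x. c *\<^sub>R G x)"
  by (auto simp: sqint_def power_mult_distrib)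

lemma n2_scaleR: "n2 M (\<lambda>x. c *\<^sub>R G x) = \<bar>c\<bar> * n2 M G"
  by (simp add: n2_def power_mult_distrib real_sqrt_mult)

lemma sqint_norm: "sqint M G \<Longrightarrow> sqint M (\<lambda>x. norm (G x))"
  by (auto simp: sqint_def)

lemma n2_norm: "n2 M (\<lambda>x. norm (G x)) = n2 M G"
  by (simp add: n2_def)

lemma norm_add_square_le: "(norm (a + b))\<^sup>2 \<le> 2 * ((norm a)\<^sup>2 + (norm b)\<^sup>2)"
  for a b :: "'b::real_normed_vector"
  using power_mono[OF norm_triangle_ineq[of a b] norm_ge_zero, of 2]
    sum2_squares_le[of "norm a" "norm b"] by linarith

lemma sqint_add:
  assumes "sqint M F" and "sqint M G"
  shows "sqint M (\<lambda>x. F x + G x)"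
proof -
  have "integrable M (\<lambda>x. (norm (F x + G x))\<^sup>2)"
    by (rule Bochner_Integration.integrable_bound[of M "\<lambda>x. 2 * ((norm (F x))\<^sup>2 + (norm (G x))\<^sup>2)"])
       (use assms norm_add_square_le in \<open>auto simp: sqint_def intro!: AE_I2\<close>)
  then show ?thesis using assms by (auto simp: sqint_def)
qed

lemma sqint_minus: "sqint M G \<Longrightarrow> sqint M (\<lambda>x. - G x)"
  by (auto simp: sqint_def)

lemma sqint_diff: "sqint M F \<Longrightarrow> sqint M G \<Longrightarrow> sqint M (\<lambda>x. F x - G x)"
  using sqint_add[OF _ sqint_minus, of M F G] by simp

lemma sqint_integrable_mult:
  fixes F G :: "'c \<Rightarrow> real"
  assumes "sqint M F" and "sqint M G"
  shows "integrable M (\<lambda>x. F x * G x)"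
proof (rule Bochner_Integration.integrable_bound[of M "\<lambda>x. (F x)\<^sup>2 + (G x)\<^sup>2"])
  have "\<bar>F x * G x\<bar> \<le> (F x)\<^sup>2 + (G x)\<^sup>2" for x
  proof -
    have "2 * (\<bar>F x\<bar> * \<bar>G x\<bar>) \<le> (F x)\<^sup>2 + (G x)\<^sup>2"
      using sum_squares_bound[of "\<bar>F x\<bar>" "\<bar>G x\<bar>"] by simp
    moreover have "0 \<le> \<bar>F x\<bar> * \<bar>G x\<bar>" by simp
    ultimately show ?thesis unfolding abs_mult by linarith
  qed
  then show "AE x in M. norm (F x * G x) \<le> norm ((F x)\<^sup>2 + (G x)\<^sup>2)" by simp
qed (use assms in \<open>auto simp: sqint_def\<close>)

lemma cauchy_schwarz_real:
  fixes F G :: "'c \<Rightarrow> real"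
  assumes F: "sqint M F" and G: "sqint M G"
  shows "(LINT x|M. F x * G x) \<le> n2 M F * n2 M G"
proof -
  \<comment> \<open>the quadratic polynomial \<open>t \<mapsto> \<integral> (F - t G)\<^sup>2\<close> is nonnegative\<close>
  let ?A = "LINT x|M. (F x)\<^sup>2" and ?B = "LINT x|M. (G x)\<^sup>2" and ?P = "LINT x|M. F x * G x"
  have iF: "integrable M (\<lambda>x. (F x)\<^sup>2)" and iG: "integrable M (\<lambda>x. (G x)\<^sup>2)"
    using assms by (auto simp: sqint_def)
  note iP = sqint_integrable_mult[OF F G]
  have AB: "?A \<ge> 0" "?B \<ge> 0" by simp_all
  have q: "0 \<le> ?A - 2 * t * ?P + t\<^sup>2 * ?B" for t
  proof -
    have "0 \<le> (LINT x|M. (F x - t * G x)\<^sup>2)" by simp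
    also have "\<dots> = (LINT x|M. (F x)\<^sup>2 - 2 * t * (F x * G x) + t\<^sup>2 * (G x)\<^sup>2)"
      by (simp add: power2_diff power_mult_distrib algebra_simps)
    also have "\<dots> = ?A - 2 * t * ?P + t\<^sup>2 * ?B" using iF iG iP by simp
    finally show ?thesis .
  qed
  have "?P\<^sup>2 \<le> ?A * ?B"
  proof (cases "?B = 0")
    case True
    have "?P = 0"
    proof (rule ccontr)
      assume "?P \<noteq> 0"
      then show False using q[of "(?A + 1) / (2 * ?P)"] True by simp
    qed
    then show ?thesis using AB by simp
  next
    case False
    then have "?B > 0" using AB(2) by linarith
    then show ?thesis using q[of "?P / ?B"] by (simp add: field_simps power2_eq_square)
  qed
  then have "\<bar>?P\<bar> \<le> sqrt (?A * ?B)" by (simp add: real_le_rsqrt)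
  then show ?thesis by (simp add: n2_def real_sqrt_mult)
qed

lemma sqint_integrable_inner:
  assumes "sqint M F" and "sqint M G"
  shows "integrable M (\<lambda>x. F x \<bullet> G x)"
  by (rule Bochner_Integration.integrable_bound[OF sqint_integrable_mult[OF sqint_norm[OF assms(1)] sqint_norm[OF assms(2)]]])
     (use assms Cauchy_Schwarz_ineq2 in \<open>auto simp: sqint_def intro!: AE_I2 borel_measurable_inner\<close>)

lemma cauchy_schwarz:
  assumes "sqint M F" and "sqint M G"
  shows "\<bar>LINT x|M. F x \<bullet> G x\<bar> \<le> n2 M F * n2 M G"
proof -
  have "\<bar>LINT x|M. F x \<bullet> G x\<bar> \<le> (LINT x|M. \<bar>F x \<bullet> G x\<bar>)"
    by (rule integral_abs_bound)
  also have "\<dots> \<le> (LINT x|M. norm (F x) * norm (G x))"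
    using sqint_integrable_inner[OF assms] sqint_integrable_mult[OF sqint_norm[OF assms(1)] sqint_norm[OF assms(2)]]
    by (intro integral_mono) (auto intro: Cauchy_Schwarz_ineq2)
  also have "\<dots> \<le> n2 M F * n2 M G"
    using cauchy_schwarz_real[OF sqint_norm[OF assms(1)] sqint_norm[OF assms(2)]] by (simp add: n2_norm)
  finally show ?thesis .
qed

lemma n2_triangle:
  assumes F: "sqint M F" and G: "sqint M G"
  shows "n2 M (\<lambda>x. F x + G x) \<le> n2 M F + n2 M G"
proof -
  have "(n2 M (\<lambda>x. F x + G x))\<^sup>2 = (LINT x|M. (norm (F x))\<^sup>2 + 2 * (F x \<bullet> G x) + (norm (G x))\<^sup>2)"
    by (simp add: n2_power2 power2_norm_eq_inner inner_add_left inner_add_right inner_commute algebra_simps)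
  also have "\<dots> = (n2 M F)\<^sup>2 + 2 * (LINT x|M. F x \<bullet> G x) + (n2 M G)\<^sup>2"
    using assms sqint_integrable_inner[OF assms] by (simp add: n2_power2 sqint_def)
  also have "\<dots> \<le> (n2 M F + n2 M G)\<^sup>2"
    using cauchy_schwarz[OF assms] by (simp add: power2_sum abs_le_iff)
  finally show ?thesis by (rule power2_le_imp_le) simp
qed

lemma sqint_bounded_mult:
  fixes H :: "'c \<Rightarrow> 'b::euclidean_space"
  assumes "b \<in> borel_measurable M" and "AE x in M. \<bar>b x\<bar> \<le> B" and "sqint M H"
  shows "sqint M (\<lambda>x. b x *\<^sub>R H x)" and "n2 M (\<lambda>x. b x *\<^sub>R H x) \<le> \<bar>B\<bar> * n2 M H"
proof -
  have "AE x in M. norm (b x *\<^sub>R H x) \<le> norm (B *\<^sub>R H x)"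
    using assms(2) by (rule eventually_mono) (auto intro!: mult_right_mono)
  moreover have "(\<lambda>x. b x *\<^sub>R H x) \<in> borel_measurable M"
    by (rule borel_measurable_scaleR[OF assms(1) sqint_measurable[OF assms(3)]])
  ultimately show "sqint M (\<lambda>x. b x *\<^sub>R H x)" "n2 M (\<lambda>x. b x *\<^sub>R H x) \<le> \<bar>B\<bar> * n2 M H"
    using sqint_bound[OF sqint_scaleR[OF assms(3)], of "\<lambda>x. b x *\<^sub>R H x" B] by (simp_all add: n2_scaleR)
qed

text \<open>In \<open>a\<^sub>n G'\<^sub>n - a' G = a\<^sub>n (G'\<^sub>n - G) + (a\<^sub>n - a') G\<close> the first term is small because \<open>a\<^sub>n\<close> is
  bounded, the second by dominated convergence.\<close>

lemma n2_tendsto_bounded_mult: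
  fixes G :: "'c \<Rightarrow> 'b::euclidean_space"
  assumes a: "\<And>n. a n \<in> borel_measurable M" "\<And>n. AE x in M. \<bar>a n x\<bar> \<le> B" "AE x in M. (\<lambda>n. a n x) \<longlonglongrightarrow> a' x"
      "a' \<in> borel_measurable M"
    and G: "\<And>n. sqint M (G' n)" "sqint M G" "(\<lambda>n. n2 M (\<lambda>x. G' n x - G x)) \<longlonglongrightarrow> 0"
  shows "\<And>n. sqint M (\<lambda>x. a n x *\<^sub>R G' n x)" and "sqint M (\<lambda>x. a' x *\<^sub>R G x)"
    and "(\<lambda>n. n2 M (\<lambda>x. a n x *\<^sub>R G' n x - a' x *\<^sub>R G x)) \<longlonglongrightarrow> 0"
proof -
  note [measurable] = a(1,4) sqint_measurable[OF G(1)] sqint_measurable[OF G(2)]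
  have all: "AE x in M. \<forall>n. \<bar>a n x\<bar> \<le> B" using a(2) by (simp add: AE_all_countable)
  have a'B: "AE x in M. \<bar>a' x\<bar> \<le> B"
    using all a(3)
  proof eventually_elim
    case (elim x)
    then show ?case by (intro LIMSEQ_le_const2[OF tendsto_rabs[OF elim(2)]]) auto
  qed
  note mul = sqint_bounded_mult
  show s1: "sqint M (\<lambda>x. a n x *\<^sub>R G' n x)" for n by (rule mul(1)[OF a(1,2) G(1)])
  show s2: "sqint M (\<lambda>x. a' x *\<^sub>R G x)" by (rule mul(1)[OF a(4) a'B G(2)])
  have s3: "sqint M (\<lambda>x. a n x *\<^sub>R G x)" for n by (rule mul(1)[OF a(1,2) G(2)])
  have "(\<lambda>n. LINT x|M. (norm (a n x *\<^sub>R G x - a' x *\<^sub>R G x))\<^sup>2) \<longlonglongrightarrow> (LINT x|M. 0)"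
  proof (rule integral_dominated_convergence[where w="\<lambda>x. (2 * B)\<^sup>2 * (norm (G x))\<^sup>2"])
    show "integrable M (\<lambda>x. (2 * B)\<^sup>2 * (norm (G x))\<^sup>2)" using G(2) by (simp add: sqint_def)
    show "AE x in M. (\<lambda>n. (norm (a n x *\<^sub>R G x - a' x *\<^sub>R G x))\<^sup>2) \<longlonglongrightarrow> 0"
      using a(3)
    proof (rule eventually_mono)
      fix x assume lim: "(\<lambda>n. a n x) \<longlonglongrightarrow> a' x"
      have "(\<lambda>n. (norm (a n x *\<^sub>R G x - a' x *\<^sub>R G x))\<^sup>2) \<longlonglongrightarrow> (norm (a' x *\<^sub>R G x - a' x *\<^sub>R G x))\<^sup>2"
        by (intro tendsto_intros lim)
      then show "(\<lambda>n. (norm (a n x *\<^sub>R G x - a' x *\<^sub>R G x))\<^sup>2) \<longlonglongrightarrow> 0" by simp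
    qed
    show "AE x in M. norm ((norm (a n x *\<^sub>R G x - a' x *\<^sub>R G x))\<^sup>2) \<le> (2 * B)\<^sup>2 * (norm (G x))\<^sup>2" for n
      using a(2)[of n] a'B
    proof eventually_elim
      case (elim x)
      then have "\<bar>a n x - a' x\<bar> \<le> \<bar>2 * B\<bar>" by linarith
      then have "(a n x - a' x)\<^sup>2 \<le> (2 * B)\<^sup>2" by (simp only: abs_le_square_iff)
      then show ?case
        by (simp add: scaleR_diff_left[symmetric] power_mult_distrib mult_right_mono)
    qed
  qed measurable
  then have t: "(\<lambda>n. n2 M (\<lambda>x. a n x *\<^sub>R G x - a' x *\<^sub>R G x)) \<longlonglongrightarrow> 0"
    unfolding n2_def using tendsto_real_sqrt by fastforce
  show "(\<lambda>n. n2 M (\<lambda>x. a n x *\<^sub>R G' n x - a' x *\<^sub>R G x)) \<longlonglongrightarrow> 0"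
  proof (rule tendsto_sandwich[OF _ _ tendsto_const])
    have "(\<lambda>n. \<bar>B\<bar> * n2 M (\<lambda>x. G' n x - G x) + n2 M (\<lambda>x. a n x *\<^sub>R G x - a' x *\<^sub>R G x))
      \<longlonglongrightarrow> \<bar>B\<bar> * 0 + 0"
      by (intro tendsto_intros G(3) t)
    then show "(\<lambda>n. \<bar>B\<bar> * n2 M (\<lambda>x. G' n x - G x) + n2 M (\<lambda>x. a n x *\<^sub>R G x - a' x *\<^sub>R G x)) \<longlonglongrightarrow> 0"
      by simp
    have "n2 M (\<lambda>x. a n x *\<^sub>R G' n x - a' x *\<^sub>R G x)
        \<le> \<bar>B\<bar> * n2 M (\<lambda>x. G' n x - G x) + n2 M (\<lambda>x. a n x *\<^sub>R G x - a' x *\<^sub>R G x)" for n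
    proof -
      have d: "sqint M (\<lambda>x. G' n x - G x)" by (rule sqint_diff[OF G(1,2)])
      have "n2 M (\<lambda>x. a n x *\<^sub>R (G' n x - G x) + (a n x *\<^sub>R G x - a' x *\<^sub>R G x))
        \<le> n2 M (\<lambda>x. a n x *\<^sub>R (G' n x - G x)) + n2 M (\<lambda>x. a n x *\<^sub>R G x - a' x *\<^sub>R G x)"
        by (rule n2_triangle[OF mul(1)[OF a(1,2) d] sqint_diff[OF s3 s2]])
      also have "\<dots> \<le> \<bar>B\<bar> * n2 M (\<lambda>x. G' n x - G x) + n2 M (\<lambda>x. a n x *\<^sub>R G x - a' x *\<^sub>R G x)"
        using mul(2)[OF a(1,2) d] by simp
      finally show ?thesis by (simp add: scaleR_diff_right)
    qed
    then show "\<forall>\<^sub>F n in sequentially. n2 M (\<lambda>x. a n x *\<^sub>R G' n x - a' x *\<^sub>R G x)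
        \<le> \<bar>B\<bar> * n2 M (\<lambda>x. G' n x - G x) + n2 M (\<lambda>x. a n x *\<^sub>R G x - a' x *\<^sub>R G x)" by simp
  qed simp
qed

lemma n2_tendsto_add:
  assumes "\<And>n. sqint M (F' n)" "sqint M F" "(\<lambda>n. n2 M (\<lambda>x. F' n x - F x)) \<longlonglongrightarrow> 0"
    and "\<And>n. sqint M (G' n)" "sqint M G" "(\<lambda>n. n2 M (\<lambda>x. G' n x - G x)) \<longlonglongrightarrow> 0"
  shows "(\<lambda>n. n2 M (\<lambda>x. (F' n x + G' n x) - (F x + G x))) \<longlonglongrightarrow> 0"
proof (rule tendsto_sandwich[OF _ _ tendsto_const])
  show "(\<lambda>n. n2 M (\<lambda>x. F' n x - F x) + n2 M (\<lambda>x. G' n x - G x)) \<longlonglongrightarrow> 0"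
    using tendsto_add[OF assms(3,6)] by simp
  have "n2 M (\<lambda>x. (F' n x + G' n x) - (F x + G x)) \<le> n2 M (\<lambda>x. F' n x - F x) + n2 M (\<lambda>x. G' n x - G x)" for n
    using n2_triangle[OF sqint_diff[OF assms(1,2)] sqint_diff[OF assms(4,5)], of n n]
    by (simp add: algebra_simps)
  then show "\<forall>\<^sub>F n in sequentially. n2 M (\<lambda>x. (F' n x + G' n x) - (F x + G x))
      \<le> n2 M (\<lambda>x. F' n x - F x) + n2 M (\<lambda>x. G' n x - G x)" by simp
qed simp

lemma n2_tendsto_inner:
  assumes "sqint M H" "\<And>n. sqint M (G' n)" "sqint M G" "(\<lambda>n. n2 M (\<lambda>x. G' n x - G x)) \<longlonglongrightarrow> 0"
  shows "(\<lambda>n. LINT x|M. H x \<bullet> G' n x) \<longlonglongrightarrow> (LINT x|M. H x \<bullet> G x)"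
proof -
  have "(\<lambda>n. LINT x|M. H x \<bullet> (G' n x - G x)) \<longlonglongrightarrow> 0"
  proof (rule Lim_null_comparison)
    show "\<forall>\<^sub>F n in sequentially. norm (LINT x|M. H x \<bullet> (G' n x - G x)) \<le> n2 M H * n2 M (\<lambda>x. G' n x - G x)"
      using cauchy_schwarz[OF assms(1) sqint_diff[OF assms(2,3)]] by simp
    show "(\<lambda>n. n2 M H * n2 M (\<lambda>x. G' n x - G x)) \<longlonglongrightarrow> 0"
      using tendsto_mult_right_zero[OF assms(4)] .
  qed
  moreover have "(LINT x|M. H x \<bullet> (G' n x - G x)) = (LINT x|M. H x \<bullet> G' n x) - (LINT x|M. H x \<bullet> G x)" for n
    using sqint_integrable_inner[OF assms(1,2)] sqint_integrable_inner[OF assms(1,3)]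
    by (simp add: inner_diff_right)
  ultimately show ?thesis by (simp add: LIM_zero_iff)
qed

lemma n2_tendsto_AE_subseq:
  fixes G :: "'c \<Rightarrow> 'b::euclidean_space"
  assumes "\<And>n. sqint M (G' n)" "sqint M G" "(\<lambda>n. n2 M (\<lambda>x. G' n x - G x)) \<longlonglongrightarrow> 0"
  obtains \<rho> where "strict_mono \<rho>" and "AE x in M. (\<lambda>n. G' (\<rho> n) x) \<longlonglongrightarrow> G x"
proof -
  have "(\<lambda>n. (n2 M (\<lambda>x. G' n x - G x))\<^sup>2) \<longlonglongrightarrow> 0\<^sup>2" by (intro tendsto_intros assms(3))
  then have "(\<lambda>n. LINT x|M. norm ((norm (G' n x - G x))\<^sup>2)) \<longlonglongrightarrow> 0" by (simp add: n2_power2)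
  then obtain \<rho> where \<rho>: "strict_mono \<rho>" "AE x in M. (\<lambda>n. (norm (G' (\<rho> n) x - G x))\<^sup>2) \<longlonglongrightarrow> 0"
    using tendsto_L1_AE_subseq[of M "\<lambda>n x. (norm (G' n x - G x))\<^sup>2"] sqint_diff[OF assms(1,2)]
    unfolding sqint_def by blast
  have "AE x in M. (\<lambda>n. G' (\<rho> n) x) \<longlonglongrightarrow> G x"
    using \<rho>(2)
  proof (rule eventually_mono)
    fix x assume "(\<lambda>n. (norm (G' (\<rho> n) x - G x))\<^sup>2) \<longlonglongrightarrow> 0"
    then have "(\<lambda>n. sqrt ((norm (G' (\<rho> n) x - G x))\<^sup>2)) \<longlonglongrightarrow> sqrt 0" by (rule tendsto_real_sqrt)
    then have "(\<lambda>n. G' (\<rho> n) x - G x) \<longlonglongrightarrow> 0" by (simp add: tendsto_norm_zero_iff)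
    then show "(\<lambda>n. G' (\<rho> n) x) \<longlonglongrightarrow> G x" by (simp add: LIM_zero_iff)
  qed
  then show thesis using that \<rho>(1) by blast
qed

section \<open>Weak gradients and their smooth approximation\<close>

lemma norm_square_eq_sum: "(norm v)\<^sup>2 = (\<Sum>i\<in>Basis. (v \<bullet> i)\<^sup>2)" for v :: "'a::euclidean_space"
  unfolding power2_norm_eq_inner by (subst euclidean_inner) (simp add: power2_eq_square)

locale bounded_open =
  fixes \<Omega> :: "'a::euclidean_space set"
  assumes open_\<Omega>: "open \<Omega>" and bounded_\<Omega>: "bounded \<Omega>"
begin

abbreviation M :: "'a measure" where "M \<equiv> lebesgue_on \<Omega>"

lemma \<Omega>_sets [simp]: "\<Omega> \<in> sets lebesgue" "\<Omega> \<inter> space lebesgue \<in> sets lebesgue"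
  using open_\<Omega> by auto

lemma finite_M: "finite_measure M"
  by (rule finite_measure_lebesgue_on[OF lmeasurable_open[OF bounded_\<Omega> open_\<Omega>]])

lemma sqint_const: "sqint M (\<lambda>x. c)"
  using finite_M by (auto simp: sqint_def intro!: finite_measure.integrable_const)

lemma sqint_bounded:
  fixes a :: "'a \<Rightarrow> real"
  assumes "a \<in> borel_measurable M" and "AE x in M. \<bar>a x\<bar> \<le> B"
  shows "sqint M a"
  by (rule sqint_bound(1)[OF sqint_const[of B] assms(1)])
     (use assms(2) in \<open>auto elim!: eventually_mono\<close>)

lemma sqint_integrable: "sqint M (u :: 'a \<Rightarrow> real) \<Longrightarrow> integrable M u"
  using sqint_integrable_mult[OF _ sqint_const[of 1], of u] by simp

lemma L2_iff_sqint: "u \<in> L2 \<Omega> \<longleftrightarrow> sqint M u"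
  by (simp add: L2_def sqint_def)

lemma sqint_extend:
  fixes u :: "'a \<Rightarrow> real"
  assumes "sqint M u"
  shows "integrable lebesgue (\<lambda>x. indicator \<Omega> x * u x)"
    and "integrable lebesgue (\<lambda>x. (indicator \<Omega> x * u x)\<^sup>2)"
proof -
  show "integrable lebesgue (\<lambda>x. indicator \<Omega> x * u x)"
    using sqint_integrable[OF assms] by (simp add: integrable_restrict_space)
  have "integrable lebesgue (\<lambda>x. indicator \<Omega> x *\<^sub>R (u x)\<^sup>2)"
    using assms by (simp add: sqint_def integrable_restrict_space)
  moreover have "(\<lambda>x. indicator \<Omega> x *\<^sub>R (u x)\<^sup>2) = (\<lambda>x. (indicator \<Omega> x * u x)\<^sup>2)"
    by (auto simp: indicator_def fun_eq_iff)
  ultimately show "integrable lebesgue (\<lambda>x. (indicator \<Omega> x * u x)\<^sup>2)" by simp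
qed

lemma sqint_continuous_on_compact:
  fixes G :: "'a \<Rightarrow> 'b::euclidean_space"
  assumes "continuous_on UNIV G" and K: "compact K"
  shows "sqint M (\<lambda>x. indicator K x *\<^sub>R G x)"
proof -
  obtain B where B: "\<And>x. x \<in> K \<Longrightarrow> norm (G x) \<le> B"
    using compact_imp_bounded[OF compact_continuous_image[OF continuous_on_subset[OF assms(1)] K]]
    unfolding bounded_iff by auto
  have "K \<in> sets lebesgue" using lmeasurable_compact[OF K] by (simp add: fmeasurable_def)
  then have m: "(\<lambda>x. indicator K x *\<^sub>R G x) \<in> borel_measurable M"
    using continuous_imp_lebesgue_measurable[OF assms(1)]
    by (intro measurable_restrict_space1 borel_measurable_scaleR borel_measurable_indicator)
  show ?thesis
    by (rule sqint_bound(1)[OF sqint_const[of "\<bar>B\<bar>"] m])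
       (use B in \<open>force simp: indicator_def\<close>)
qed

lemma sqint_test:
  assumes "\<phi> \<in> test_functions \<Omega>"
  shows "sqint M \<phi>" and "sqint M (grad \<phi>)"
proof -
  obtain K where \<phi>: "smooth \<phi>" "compact K" "K \<subseteq> \<Omega>"
      and \<phi>0: "\<forall>x. x \<notin> K \<longrightarrow> \<phi> x = 0 \<and> grad \<phi> x = 0"
    using test_functionsE[OF assms] .
  have "(\<lambda>x. indicator K x *\<^sub>R \<phi> x) = \<phi>" "(\<lambda>x. indicator K x *\<^sub>R grad \<phi> x) = grad \<phi>"
    using \<phi>0 by (auto simp: indicator_def fun_eq_iff)
  then show "sqint M \<phi>" "sqint M (grad \<phi>)"
    using sqint_continuous_on_compact[OF smooth_continuous[OF \<phi>(1)] \<phi>(2)]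
      sqint_continuous_on_compact[OF continuous_grad[OF \<phi>(1)] \<phi>(2)] by simp_all
qed

lemma sqint_componentwise:
  fixes G :: "'c \<Rightarrow> 'b::euclidean_space"
  assumes "\<And>i. i \<in> Basis \<Longrightarrow> sqint N (\<lambda>x. G x \<bullet> i)"
  shows "sqint N G"
proof -
  have "(\<lambda>x. (norm (G x))\<^sup>2) = (\<lambda>x. \<Sum>i\<in>Basis. (G x \<bullet> i)\<^sup>2)"
    by (simp add: norm_square_eq_sum)
  moreover have "integrable N (\<lambda>x. \<Sum>i\<in>Basis. (G x \<bullet> i)\<^sup>2)"
    using assms by (intro Bochner_Integration.integrable_sum) (simp add: sqint_def)
  moreover have "G \<in> borel_measurable N"
    using assms by (subst borel_measurable_euclidean_space) (auto simp: sqint_def)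
  ultimately show ?thesis by (simp add: sqint_def)
qed

lemma sqint_component:
  assumes "sqint N G" and "i \<in> Basis"
  shows "sqint N (\<lambda>x. G x \<bullet> i)"
proof (rule sqint_bound(1)[OF assms(1)])
  show "(\<lambda>x. G x \<bullet> i) \<in> borel_measurable N"
    using sqint_measurable[OF assms(1)] by simp
  show "AE x in N. norm (G x \<bullet> i) \<le> norm (G x)"
    using Basis_le_norm[OF assms(2)] by simp
qed

text \<open>By uniqueness of weak derivatives, the representative chosen in \<open>weak_grad\<close> is immaterial.\<close>

lemma weak_grad_AE_eq:
  assumes "has_weak_grad \<Omega> u G"
  shows "AE x in M. weak_grad \<Omega> u x = G x"
proof -
  let ?h = "\<lambda>i. SOME g. has_weak_pderiv \<Omega> i u g"
  have h: "AE x in M. ?h i x = G x \<bullet> i" if "i \<in> Basis" for i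
  proof -
    have G: "has_weak_pderiv \<Omega> i u (\<lambda>x. G x \<bullet> i)"
      using assms that by (simp add: has_weak_grad_def)
    then have "has_weak_pderiv \<Omega> i u (?h i)" by (rule someI[of "has_weak_pderiv \<Omega> i u"])
    then show ?thesis using G open_\<Omega> by (rule has_weak_pderiv_unique)
  qed
  have "AE x in M. \<forall>i\<in>Basis. ?h i x = G x \<bullet> i"
    using h by (intro AE_finite_allI) auto
  then show ?thesis
    by (rule eventually_mono) (simp add: weak_grad_def euclidean_representation)
qed

lemma has_weak_grad_weak_grad:
  assumes "\<And>i. i \<in> Basis \<Longrightarrow> \<exists>g. has_weak_pderiv \<Omega> i u g"
  shows "has_weak_grad \<Omega> u (weak_grad \<Omega> u)"
  unfolding has_weak_grad_def
proof
  fix i :: 'a assume i: "i \<in> Basis"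
  have "(\<lambda>x. weak_grad \<Omega> u x \<bullet> i) = (SOME g. has_weak_pderiv \<Omega> i u g)"
    using i by (simp add: weak_grad_def fun_eq_iff inner_sum_left_Basis)
  then show "has_weak_pderiv \<Omega> i u (\<lambda>x. weak_grad \<Omega> u x \<bullet> i)"
    using someI_ex[OF assms[OF i]] by simp
qed

lemma has_weak_grad_diff:
  "has_weak_grad \<Omega> u G \<Longrightarrow> has_weak_grad \<Omega> v H \<Longrightarrow> has_weak_grad \<Omega> (\<lambda>x. u x - v x) (\<lambda>x. G x - H x)"
  unfolding has_weak_grad_def inner_diff_left using has_weak_pderiv_diff[OF _ _ open_\<Omega>] by blast

lemma has_weak_grad_smooth: "smooth f \<Longrightarrow> has_weak_grad \<Omega> f (grad f)"
  unfolding has_weak_grad_def using has_weak_pderiv_smooth[OF _ open_\<Omega>] by blast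

lemma measurable_AE_eq:
  fixes f g :: "'a \<Rightarrow> 'b::euclidean_space"
  assumes "f \<in> borel_measurable M" and "AE x in M. f x = g x"
  shows "g \<in> borel_measurable M"
  using AE_lebesgue_on_measurable[OF assms(1) _ assms(2)] by simp

text \<open>The chosen representative of the weak gradient agrees almost everywhere with square integrable
  weak derivatives, and inherits measurability from them by completeness of the measure.\<close>

lemma sobolev_1:
  assumes "u \<in> sobolev L2 1 \<Omega>"
  shows "sqint M u" and "has_weak_grad \<Omega> u (weak_grad \<Omega> u)" and "sqint M (weak_grad \<Omega> u)"
proof -
  have *: "\<exists>g. sqint M g \<and> has_weak_pderiv \<Omega> i u g" if "i \<in> Basis" for i
    using assms that by (simp add: L2_iff_sqint Bex_def)
  show "sqint M u" using assms by (simp add: L2_iff_sqint)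
  show W: "has_weak_grad \<Omega> u (weak_grad \<Omega> u)"
    using * by (intro has_weak_grad_weak_grad) blast
  show "sqint M (weak_grad \<Omega> u)"
  proof (rule sqint_componentwise)
    fix i :: 'a assume i: "i \<in> Basis"
    obtain g where g: "sqint M g" "has_weak_pderiv \<Omega> i u g" using *[OF i] by blast
    have ae: "AE x in M. g x = weak_grad \<Omega> u x \<bullet> i"
      using W i by (intro has_weak_pderiv_unique[OF g(2) _ open_\<Omega>]) (simp add: has_weak_grad_def)
    show "sqint M (\<lambda>x. weak_grad \<Omega> u x \<bullet> i)"
      by (rule sqint_bound(1)[OF g(1) measurable_AE_eq[OF sqint_measurable[OF g(1)] ae]])
         (use ae in \<open>auto elim!: eventually_mono\<close>)
  qed
qed

text \<open>Inside \<open>\<Omega>\<close>, the functions \<open>y \<mapsto> \<eta>\<^sub>\<delta> (x - y)\<close> are test functions, and mollification commutes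
  with weak differentiation.\<close>

lemma grad_conv_mollifier:
  assumes u: "sqint M u" and g: "has_weak_pderiv \<Omega> i u g" and i: "i \<in> Basis"
    and K': "compact K'" "K' \<subseteq> \<Omega>" and near: "\<forall>y. norm (x - y) < \<epsilon> \<longrightarrow> y \<in> K'"
    and \<delta>: "0 < \<delta>" "\<delta> \<le> \<epsilon>"
  shows "grad (conv (\<lambda>y. indicator \<Omega> y * u y) (mollifier \<delta>)) x \<bullet> i
    = conv (\<lambda>y. indicator \<Omega> y * g y) (mollifier \<delta>) x"
proof -
  let ?\<eta> = "mollifier \<delta> :: 'a \<Rightarrow> real"
  let ?\<phi> = "\<lambda>y. ?\<eta> (x - y)"
  note sm = smooth_mollifier[OF \<delta>(1), where 'a='a]
  have s: "smooth ?\<phi>" using smooth_affine[OF sm, of x "-1"] by simp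
  have G: "grad ?\<phi> y = - grad ?\<eta> (x - y)" for y
  proof (rule grad_eqI)
    have "((\<lambda>y. x - y) has_derivative (\<lambda>h. - h)) (at y)" by (auto intro!: derivative_eq_intros)
    from has_derivative_compose[OF this smooth_has_derivative[OF sm]]
    show "(?\<phi> has_derivative (\<lambda>h. - grad ?\<eta> (x - y) \<bullet> h)) (at y)" by simp
  qed
  have test: "?\<phi> \<in> test_functions \<Omega>"
  proof (rule test_functionsI[OF s K'])
    fix y assume "y \<notin> K'"
    then have "\<delta> \<le> norm (x - y)" using near \<delta>(2) by (meson linorder_not_less order_trans)
    then show "?\<eta> (x - y) = 0" by (rule mollifier_eq_0[OF \<delta>(1)])
  qed
  have supp: "norm z > \<delta> \<Longrightarrow> ?\<eta> z = 0" for z by (simp add: mollifier_eq_0[OF \<delta>(1)])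
  have to_\<Omega>: "(LINT y|lebesgue. indicator \<Omega> y * a y * b y) = (LINT y|M. a y * b y)" for a b :: "'a \<Rightarrow> real"
    by (simp add: integral_restrict_space mult.assoc)
  have "grad (conv (\<lambda>y. indicator \<Omega> y * u y) ?\<eta>) x \<bullet> i = (LINT y|M. u y * (grad ?\<eta> (x - y) \<bullet> i))"
    by (subst grad_conv[OF sqint_extend(1)[OF u] sm supp i]) (simp_all only: conv_def to_\<Omega>)
  also have "\<dots> = - (LINT y|M. u y * (grad ?\<phi> y \<bullet> i))" by (simp add: G)
  also have "\<dots> = (LINT y|M. g y * ?\<phi> y)" using has_weak_pderivD[OF g test] by simp
  also have "\<dots> = conv (\<lambda>y. indicator \<Omega> y * g y) ?\<eta> x" unfolding conv_def to_\<Omega> ..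
  finally show ?thesis .
qed

text \<open>Pairs of a bounded function and a field that are limits of smooth functions with values in
  \<open>[lo, hi]\<close>, the gradients converging in \<open>L\<^sup>2\<close> on compact subsets. Working with this property instead
  of with the weak gradient reduces the product and quotient rules to those for smooth functions.\<close>

definition smooth_approx :: "real \<Rightarrow> real \<Rightarrow> ('a \<Rightarrow> real) \<Rightarrow> ('a \<Rightarrow> 'a) \<Rightarrow> bool" where
  "smooth_approx lo hi r R \<longleftrightarrow> r \<in> borel_measurable M \<and> sqint M R \<and>
     (\<forall>K. compact K \<and> K \<subseteq> \<Omega> \<longrightarrow> (\<exists>s. (\<forall>n::nat. smooth (s n)) \<and> (\<forall>n x. lo \<le> s n x \<and> s n x \<le> hi) \<and>
        (AE x in M. (\<lambda>n. s n x) \<longlonglongrightarrow> r x) \<and>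
        (\<lambda>n. n2 M (\<lambda>x. indicator K x *\<^sub>R grad (s n) x - indicator K x *\<^sub>R R x)) \<longlonglongrightarrow> 0))"

lemma smooth_approxE:
  assumes "smooth_approx lo hi r R" and "compact K" and "K \<subseteq> \<Omega>"
  obtains s where "\<forall>n::nat. smooth (s n)" and "\<forall>n x. lo \<le> s n x \<and> s n x \<le> hi"
    and "AE x in M. (\<lambda>n. s n x) \<longlonglongrightarrow> r x"
    and "(\<lambda>n. n2 M (\<lambda>x. indicator K x *\<^sub>R grad (s n) x - indicator K x *\<^sub>R R x)) \<longlonglongrightarrow> 0"
  using assms unfolding smooth_approx_def by blast

lemma smooth_approx_bounds:
  assumes "smooth_approx lo hi r R"
  shows "AE x in M. lo \<le> r x \<and> r x \<le> hi"
proof -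
  obtain s where "\<forall>n::nat. smooth (s n)" and s: "\<forall>n x. lo \<le> s n x \<and> s n x \<le> hi" "AE x in M. (\<lambda>n. s n x) \<longlonglongrightarrow> r x"
    and "(\<lambda>n. n2 M (\<lambda>x. indicator {} x *\<^sub>R grad (s n) x - indicator {} x *\<^sub>R R x)) \<longlonglongrightarrow> 0"
    by (rule smooth_approxE[OF assms compact_empty empty_subsetI])
  show ?thesis
    using s(2)
  proof (rule eventually_mono)
    fix x assume "(\<lambda>n. s n x) \<longlonglongrightarrow> r x"
    then show "lo \<le> r x \<and> r x \<le> hi"
      using s(1) LIMSEQ_le_const[of _ "r x" lo] LIMSEQ_le_const2[of _ "r x" hi] by blast
  qed
qed

lemma sqint_indicator:
  assumes "sqint M G" and "compact K"
  shows "sqint M (\<lambda>x. indicator K x *\<^sub>R G x)"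
proof (rule sqint_bound(1)[OF assms(1)])
  have "K \<in> sets lebesgue" using lmeasurable_compact[OF assms(2)] by (simp add: fmeasurable_def)
  then have "(indicator K :: 'a \<Rightarrow> real) \<in> borel_measurable M"
    by (intro measurable_restrict_space1 borel_measurable_indicator)
  then show "(\<lambda>x. indicator K x *\<^sub>R G x) \<in> borel_measurable M"
    using sqint_measurable[OF assms(1)] by (rule borel_measurable_scaleR)
qed (auto simp: indicator_def)

lemma smooth_measurable: "smooth s \<Longrightarrow> s \<in> borel_measurable M"
  by (intro measurable_restrict_space1 continuous_imp_lebesgue_measurable smooth_continuous)

lemma interval_abs_bound: "lo \<le> t \<Longrightarrow> t \<le> hi \<Longrightarrow> \<bar>t\<bar> \<le> max \<bar>lo\<bar> \<bar>hi\<bar>" for t :: real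
  by linarith

lemma smooth_approx_mult:
  assumes r: "smooth_approx lo hi r R" and s: "smooth_approx lo' hi' s S"
  defines "B \<equiv> max \<bar>lo\<bar> \<bar>hi\<bar>" and "B' \<equiv> max \<bar>lo'\<bar> \<bar>hi'\<bar>"
  shows "smooth_approx (- (B * B')) (B * B') (\<lambda>x. r x * s x) (\<lambda>x. r x *\<^sub>R S x + s x *\<^sub>R R x)"
  unfolding smooth_approx_def
proof (intro conjI allI impI; (elim conjE)?)
  have rm: "r \<in> borel_measurable M" "sqint M R" and smm: "s \<in> borel_measurable M" "sqint M S"
    using r s by (auto simp: smooth_approx_def)
  show "(\<lambda>x. r x * s x) \<in> borel_measurable M" using rm smm by simp
  have bd: "AE x in M. \<bar>r x\<bar> \<le> B" "AE x in M. \<bar>s x\<bar> \<le> B'"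
    unfolding B_def B'_def
    by (rule eventually_mono[OF smooth_approx_bounds[OF r]], simp add: interval_abs_bound)
       (rule eventually_mono[OF smooth_approx_bounds[OF s]], simp add: interval_abs_bound)
  show "sqint M (\<lambda>x. r x *\<^sub>R S x + s x *\<^sub>R R x)"
    by (intro sqint_add sqint_bounded_mult(1)[OF rm(1) bd(1) smm(2)] sqint_bounded_mult(1)[OF smm(1) bd(2) rm(2)])
  fix K assume K: "compact K" "K \<subseteq> \<Omega>"
  obtain rn where rn: "\<forall>n::nat. smooth (rn n)" "\<forall>n x. lo \<le> rn n x \<and> rn n x \<le> hi"
      "AE x in M. (\<lambda>n. rn n x) \<longlonglongrightarrow> r x"
      "(\<lambda>n. n2 M (\<lambda>x. indicator K x *\<^sub>R grad (rn n) x - indicator K x *\<^sub>R R x)) \<longlonglongrightarrow> 0"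
    by (rule smooth_approxE[OF r K])
  obtain sn where sn: "\<forall>n::nat. smooth (sn n)" "\<forall>n x. lo' \<le> sn n x \<and> sn n x \<le> hi'"
      "AE x in M. (\<lambda>n. sn n x) \<longlonglongrightarrow> s x"
      "(\<lambda>n. n2 M (\<lambda>x. indicator K x *\<^sub>R grad (sn n) x - indicator K x *\<^sub>R S x)) \<longlonglongrightarrow> 0"
    by (rule smooth_approxE[OF s K])
  have rB: "\<bar>rn n x\<bar> \<le> B" and sB: "\<bar>sn n x\<bar> \<le> B'" for n x
    using rn(2) sn(2) unfolding B_def B'_def by (auto intro: interval_abs_bound)
  have gr: "sqint M (\<lambda>x. indicator K x *\<^sub>R grad (rn n) x)" "sqint M (\<lambda>x. indicator K x *\<^sub>R grad (sn n) x)" for n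
    using rn(1) sn(1) by (auto intro!: sqint_continuous_on_compact continuous_grad K)
  show "\<exists>p. (\<forall>n::nat. smooth (p n)) \<and> (\<forall>n x. - (B * B') \<le> p n x \<and> p n x \<le> B * B') \<and>
        (AE x in M. (\<lambda>n. p n x) \<longlonglongrightarrow> r x * s x) \<and>
        (\<lambda>n. n2 M (\<lambda>x. indicator K x *\<^sub>R grad (p n) x - indicator K x *\<^sub>R (r x *\<^sub>R S x + s x *\<^sub>R R x))) \<longlonglongrightarrow> 0"
  proof (intro exI[of _ "\<lambda>n x. rn n x * sn n x"] conjI allI)
    show "smooth (\<lambda>x. rn n x * sn n x)" for n using rn(1) sn(1) by (simp add: smooth_mult)
    have "\<bar>rn n x * sn n x\<bar> \<le> B * B'" for n x
      unfolding abs_mult by (intro mult_mono rB sB) (auto simp: B_def)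
    then show "- (B * B') \<le> rn n x * sn n x" "rn n x * sn n x \<le> B * B'" for n x
      by (auto simp: abs_le_iff minus_le_iff)
    show "AE x in M. (\<lambda>n. rn n x * sn n x) \<longlonglongrightarrow> r x * s x"
      using rn(3) sn(3) by eventually_elim (rule tendsto_mult)
    have t1: "sqint M (\<lambda>x. rn n x *\<^sub>R (indicator K x *\<^sub>R grad (sn n) x))"
      "sqint M (\<lambda>x. r x *\<^sub>R (indicator K x *\<^sub>R S x))"
      "(\<lambda>n. n2 M (\<lambda>x. rn n x *\<^sub>R (indicator K x *\<^sub>R grad (sn n) x) - r x *\<^sub>R (indicator K x *\<^sub>R S x))) \<longlonglongrightarrow> 0" for n
      using n2_tendsto_bounded_mult[where a=rn and a'=r and B=B and G'="\<lambda>n x. indicator K x *\<^sub>R grad (sn n) x"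
          and G="\<lambda>x. indicator K x *\<^sub>R S x" and M=M] rn rB rm gr sn(4) sqint_indicator[OF smm(2) K(1)] smooth_measurable
      by simp_all
    have t2: "sqint M (\<lambda>x. sn n x *\<^sub>R (indicator K x *\<^sub>R grad (rn n) x))"
      "sqint M (\<lambda>x. s x *\<^sub>R (indicator K x *\<^sub>R R x))"
      "(\<lambda>n. n2 M (\<lambda>x. sn n x *\<^sub>R (indicator K x *\<^sub>R grad (rn n) x) - s x *\<^sub>R (indicator K x *\<^sub>R R x))) \<longlonglongrightarrow> 0" for n
      using n2_tendsto_bounded_mult[where a=sn and a'=s and B=B' and G'="\<lambda>n x. indicator K x *\<^sub>R grad (rn n) x"
          and G="\<lambda>x. indicator K x *\<^sub>R R x" and M=M] sn sB smm gr rn(4) sqint_indicator[OF rm(2) K(1)] smooth_measurable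
      by simp_all
    have g: "grad (\<lambda>x. rn n x * sn n x) x = rn n x *\<^sub>R grad (sn n) x + sn n x *\<^sub>R grad (rn n) x" for n x
      using rn(1) sn(1) by (intro grad_mult) auto
    show "(\<lambda>n. n2 M (\<lambda>x. indicator K x *\<^sub>R grad (\<lambda>x. rn n x * sn n x) x
            - indicator K x *\<^sub>R (r x *\<^sub>R S x + s x *\<^sub>R R x))) \<longlonglongrightarrow> 0"
      using n2_tendsto_add[OF t1 t2] unfolding g by (simp add: scaleR_add_right mult.commute)
  qed
qed

lemma smooth_approx_one_minus:
  assumes r: "smooth_approx lo hi r R"
  shows "smooth_approx (1 - hi) (1 - lo) (\<lambda>x. 1 - r x) (\<lambda>x. - R x)"
  unfolding smooth_approx_def
proof (intro conjI allI impI; (elim conjE)?)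
  show "(\<lambda>x. 1 - r x) \<in> borel_measurable M" "sqint M (\<lambda>x. - R x)"
    using r by (auto simp: smooth_approx_def intro: sqint_minus)
  fix K assume K: "compact K" "K \<subseteq> \<Omega>"
  obtain rn where rn: "\<forall>n::nat. smooth (rn n)" "\<forall>n x. lo \<le> rn n x \<and> rn n x \<le> hi"
      "AE x in M. (\<lambda>n. rn n x) \<longlonglongrightarrow> r x"
      "(\<lambda>n. n2 M (\<lambda>x. indicator K x *\<^sub>R grad (rn n) x - indicator K x *\<^sub>R R x)) \<longlonglongrightarrow> 0"
    by (rule smooth_approxE[OF r K])
  show "\<exists>p. (\<forall>n::nat. smooth (p n)) \<and> (\<forall>n x. 1 - hi \<le> p n x \<and> p n x \<le> 1 - lo) \<and>
        (AE x in M. (\<lambda>n. p n x) \<longlonglongrightarrow> 1 - r x) \<and>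
        (\<lambda>n. n2 M (\<lambda>x. indicator K x *\<^sub>R grad (p n) x - indicator K x *\<^sub>R (- R x))) \<longlonglongrightarrow> 0"
  proof (intro exI[of _ "\<lambda>n x. 1 - rn n x"] conjI allI)
    show "smooth (\<lambda>x. 1 - rn n x)" for n using rn(1) by (simp add: smooth_diff smooth_const)
    show "1 - hi \<le> 1 - rn n x" "1 - rn n x \<le> 1 - lo" for n x using rn(2) by simp_all
    show "AE x in M. (\<lambda>n. 1 - rn n x) \<longlonglongrightarrow> 1 - r x"
      using rn(3) by (rule eventually_mono) (intro tendsto_intros)
    have g: "grad (\<lambda>x. 1 - rn n x) x = - grad (rn n) x" for n x
      using grad_diff[OF smooth_const[of 1], of "rn n" x] rn(1) by simp
    have "n2 M (\<lambda>x. indicator K x *\<^sub>R grad (\<lambda>x. 1 - rn n x) x - indicator K x *\<^sub>R (- R x))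
      = n2 M (\<lambda>x. indicator K x *\<^sub>R grad (rn n) x - indicator K x *\<^sub>R R x)" for n
      unfolding g n2_def by (simp add: norm_minus_commute)
    then show "(\<lambda>n. n2 M (\<lambda>x. indicator K x *\<^sub>R grad (\<lambda>x. 1 - rn n x) x - indicator K x *\<^sub>R (- R x))) \<longlonglongrightarrow> 0"
      using rn(4) by simp
  qed
qed

lemma smooth_approx_inverse:
  assumes r: "smooth_approx lo hi r R" and lo: "0 < lo"
  shows "smooth_approx (inverse hi) (inverse lo) (\<lambda>x. inverse (r x)) (\<lambda>x. - (inverse (r x))\<^sup>2 *\<^sub>R R x)"
  unfolding smooth_approx_def
proof (intro conjI allI impI; (elim conjE)?)
  have rm: "r \<in> borel_measurable M" "sqint M R" using r by (auto simp: smooth_approx_def)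
  show "(\<lambda>x. inverse (r x)) \<in> borel_measurable M" using rm by simp
  let ?B = "(inverse lo)\<^sup>2"
  have inv: "(inverse t)\<^sup>2 \<le> ?B" if "lo \<le> t" for t
    using that lo by (intro power_mono le_imp_inverse_le) auto
  have b2: "AE x in M. \<bar>- (inverse (r x))\<^sup>2\<bar> \<le> ?B"
    using smooth_approx_bounds[OF r] by (rule eventually_mono) (simp only: abs_minus_cancel abs_power2 inv)
  have m2: "(\<lambda>x. - (inverse (r x))\<^sup>2) \<in> borel_measurable M" using rm by simp
  show "sqint M (\<lambda>x. - (inverse (r x))\<^sup>2 *\<^sub>R R x)"
    by (rule sqint_bounded_mult(1)[OF m2 b2 rm(2)])
  fix K assume K: "compact K" "K \<subseteq> \<Omega>"
  obtain rn where rn: "\<forall>n::nat. smooth (rn n)" "\<forall>n x. lo \<le> rn n x \<and> rn n x \<le> hi"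
      "AE x in M. (\<lambda>n. rn n x) \<longlonglongrightarrow> r x"
      "(\<lambda>n. n2 M (\<lambda>x. indicator K x *\<^sub>R grad (rn n) x - indicator K x *\<^sub>R R x)) \<longlonglongrightarrow> 0"
    by (rule smooth_approxE[OF r K])
  have pos: "rn n x > 0" for n x using rn(2) lo by (meson less_le_trans)
  have gr: "sqint M (\<lambda>x. indicator K x *\<^sub>R grad (rn n) x)" for n
    using rn(1) by (auto intro!: sqint_continuous_on_compact continuous_grad K)
  have sm: "smooth (\<lambda>x. inverse (rn n x))" for n
    using rn(1) pos by (intro smooth_inverse) (auto simp: less_imp_neq[symmetric])
  show "\<exists>p. (\<forall>n::nat. smooth (p n)) \<and> (\<forall>n x. inverse hi \<le> p n x \<and> p n x \<le> inverse lo) \<and>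
        (AE x in M. (\<lambda>n. p n x) \<longlonglongrightarrow> inverse (r x)) \<and>
        (\<lambda>n. n2 M (\<lambda>x. indicator K x *\<^sub>R grad (p n) x - indicator K x *\<^sub>R (- (inverse (r x))\<^sup>2 *\<^sub>R R x))) \<longlonglongrightarrow> 0"
  proof (intro exI[of _ "\<lambda>n x. inverse (rn n x)"] conjI allI sm)
    show "inverse hi \<le> inverse (rn n x)" "inverse (rn n x) \<le> inverse lo" for n x
      using rn(2) pos[of n x] lo by (auto intro!: le_imp_inverse_le)
    show lim: "AE x in M. (\<lambda>n. inverse (rn n x)) \<longlonglongrightarrow> inverse (r x)"
      using rn(3) smooth_approx_bounds[OF r]
    proof eventually_elim
      case (elim x)
      then have "r x \<noteq> 0" using lo by linarith
      with elim(1) show ?case by (intro tendsto_inverse)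
    qed
    have g: "grad (\<lambda>x. inverse (rn n x)) x = - (inverse (rn n x))\<^sup>2 *\<^sub>R grad (rn n) x" for n x
      using rn(1) pos[of n x] by (intro grad_inverse) auto
    have lim2: "AE x in M. (\<lambda>n. - (inverse (rn n x))\<^sup>2) \<longlonglongrightarrow> - (inverse (r x))\<^sup>2"
      using lim by (rule eventually_mono) (intro tendsto_minus tendsto_power)
    have "(\<lambda>n. n2 M (\<lambda>x. - (inverse (rn n x))\<^sup>2 *\<^sub>R (indicator K x *\<^sub>R grad (rn n) x)
        - (- (inverse (r x))\<^sup>2) *\<^sub>R (indicator K x *\<^sub>R R x))) \<longlonglongrightarrow> 0"
    proof (rule n2_tendsto_bounded_mult(3)[OF _ _ lim2 m2 gr sqint_indicator[OF rm(2) K(1)] rn(4)])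
      show "(\<lambda>x. - (inverse (rn n x))\<^sup>2) \<in> borel_measurable M" for n
        using smooth_measurable[OF sm] by simp
      show "AE x in M. \<bar>- (inverse (rn n x))\<^sup>2\<bar> \<le> ?B" for n
        using inv rn(2) by (simp only: abs_minus_cancel abs_power2) simp
    qed
    then show "(\<lambda>n. n2 M (\<lambda>x. indicator K x *\<^sub>R grad (\<lambda>x. inverse (rn n x)) x
        - indicator K x *\<^sub>R (- (inverse (r x))\<^sup>2 *\<^sub>R R x))) \<longlonglongrightarrow> 0"
      unfolding g by (simp add: mult.commute)
  qed
qed

lemma n2_mollify_tendsto:
  fixes f :: "'a \<Rightarrow> real"
  assumes "integrable lebesgue f" and "integrable lebesgue (\<lambda>x. (f x)\<^sup>2)"
    and "\<And>n. \<delta> n > 0" and "\<delta> \<longlonglongrightarrow> 0"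
  shows "(\<lambda>n. n2 lebesgue (\<lambda>x. conv f (mollifier (\<delta> n)) x - f x)) \<longlonglongrightarrow> 0"
  using tendsto_real_sqrt[OF mollify_tendsto_L2[OF assms]] by (simp add: n2_def)

text \<open>Subtracting \<open>cl\<close> before mollifying keeps the values of the approximations above \<open>cl\<close> on the
  whole space, also near and outside the boundary of \<open>\<Omega>\<close>.\<close>

lemma smooth_approx_sobolev:
  assumes q: "q \<in> sobolev L2 1 \<Omega>" and b: "AE x in M. cl \<le> q x \<and> q x \<le> cu" and "cl \<le> cu"
  shows "smooth_approx cl cu q (weak_grad \<Omega> q)"
  unfolding smooth_approx_def
proof (intro conjI allI impI; (elim conjE)?)
  let ?Q = "weak_grad \<Omega> q"
  note Q = sobolev_1[OF q]
  show "q \<in> borel_measurable M" "sqint M ?Q" using Q sqint_measurable by auto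
  let ?v = "\<lambda>x. q x - cl"
  have v: "sqint M ?v" by (rule sqint_diff[OF Q(1) sqint_const])
  have vQ: "has_weak_pderiv \<Omega> i ?v (\<lambda>x. ?Q x \<bullet> i)" if "i \<in> Basis" for i
  proof -
    have "has_weak_grad \<Omega> ?v (\<lambda>x. ?Q x - 0)"
      using has_weak_grad_diff[OF Q(2) has_weak_grad_smooth[OF smooth_const]] by simp
    then show ?thesis using that by (simp add: has_weak_grad_def)
  qed
  define f where "f x = indicator \<Omega> x * ?v x" for x
  have f: "integrable lebesgue f" "integrable lebesgue (\<lambda>x. (f x)\<^sup>2)"
    unfolding f_def using sqint_extend[OF v] by auto
  have fb: "AE x in lebesgue. 0 \<le> f x \<and> f x \<le> cu - cl"
  proof -
    have "AE x in lebesgue. x \<in> \<Omega> \<longrightarrow> cl \<le> q x \<and> q x \<le> cu"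
      using b by (subst (asm) AE_restrict_space_iff) auto
    then show ?thesis
      by (rule eventually_mono) (use \<open>cl \<le> cu\<close> in \<open>auto simp: f_def indicator_def\<close>)
  qed
  define \<delta> where "\<delta> n = inverse (real (Suc n))" for n
  have \<delta>: "\<delta> n > 0" for n by (simp add: \<delta>_def)
  have \<delta>0: "\<delta> \<longlonglongrightarrow> 0" unfolding \<delta>_def by (rule LIMSEQ_inverse_real_of_nat)
  let ?c = "\<lambda>n. conv f (mollifier (\<delta> n))"
  have sm: "smooth (?c n)" for n
    by (rule smooth_conv[OF f(1) smooth_mollifier[OF \<delta>, of n], where \<epsilon>="\<delta> n"])
       (simp add: mollifier_eq_0[OF \<delta>])
  have "sqint lebesgue (?c n)" for n
    using conv_mollifier_L2(1)[OF \<delta> f] continuous_imp_lebesgue_measurable[OF smooth_continuous[OF sm]]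
    by (simp add: sqint_def)
  moreover have "sqint lebesgue f" using f by (simp add: sqint_def)
  ultimately obtain \<rho> where \<rho>: "strict_mono \<rho>" "AE x in lebesgue. (\<lambda>n. ?c (\<rho> n) x) \<longlonglongrightarrow> f x"
    using n2_tendsto_AE_subseq[OF _ _ n2_mollify_tendsto[OF f \<delta> \<delta>0]] by blast
  define \<delta>' where "\<delta>' n = \<delta> (\<rho> n)" for n
  have \<delta>': "\<delta>' n > 0" for n by (simp add: \<delta>'_def \<delta>)
  have \<delta>'0: "\<delta>' \<longlonglongrightarrow> 0"
    using LIMSEQ_subseq_LIMSEQ[OF \<delta>0 \<rho>(1)] by (simp add: \<delta>'_def[abs_def] comp_def)
  let ?s = "\<lambda>n x. cl + conv f (mollifier (\<delta>' n)) x"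
  fix K assume K: "compact K" "K \<subseteq> \<Omega>"
  obtain \<epsilon> K' where \<epsilon>: "\<epsilon> > 0" and K': "compact K'" "K' \<subseteq> \<Omega>"
    and near: "\<forall>x\<in>K. \<forall>y. norm (x - y) < \<epsilon> \<longrightarrow> y \<in> K'"
    by (rule compact_neighbourhood[OF K(1) open_\<Omega> K(2)])
  show "\<exists>s. (\<forall>n::nat. smooth (s n)) \<and> (\<forall>n x. cl \<le> s n x \<and> s n x \<le> cu) \<and>
        (AE x in M. (\<lambda>n. s n x) \<longlonglongrightarrow> q x) \<and>
        (\<lambda>n. n2 M (\<lambda>x. indicator K x *\<^sub>R grad (s n) x - indicator K x *\<^sub>R ?Q x)) \<longlonglongrightarrow> 0"
  proof (intro exI[of _ ?s] conjI allI)
    have smc: "smooth (conv f (mollifier (\<delta>' n)))" for n using sm by (simp add: \<delta>'_def)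
    show "smooth (?s n)" for n by (intro smooth_add smooth_const smc)
    show "cl \<le> ?s n x" "?s n x \<le> cu" for n x
      using conv_mollifier_bounds[OF \<delta>'[of n] f(1) fb, of x] by simp_all
    have "AE x in lebesgue. x \<in> \<Omega> \<longrightarrow> (\<lambda>n. ?s n x) \<longlonglongrightarrow> q x"
      using \<rho>(2)
    proof (rule eventually_mono, intro impI)
      fix x assume "(\<lambda>n. ?c (\<rho> n) x) \<longlonglongrightarrow> f x" "x \<in> \<Omega>"
      then show "(\<lambda>n. ?s n x) \<longlonglongrightarrow> q x"
        using tendsto_add[OF tendsto_const[of cl], of "\<lambda>n. ?c (\<rho> n) x" "f x"] by (simp add: f_def \<delta>'_def)
    qed
    then show "AE x in M. (\<lambda>n. ?s n x) \<longlonglongrightarrow> q x"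
      by (subst AE_restrict_space_iff) auto
    let ?g = "\<lambda>i x. indicator \<Omega> x * (?Q x \<bullet> i)"
    let ?d = "\<lambda>i n x. conv (?g i) (mollifier (\<delta>' n)) x - ?g i x"
    have gi: "integrable lebesgue (?g i)" "integrable lebesgue (\<lambda>x. (?g i x)\<^sup>2)" if "i \<in> Basis" for i
      using sqint_extend[OF sqint_component[OF Q(3) that]] by auto
    have di: "integrable lebesgue (\<lambda>x. (?d i n x)\<^sup>2)" if "i \<in> Basis" for i n
      by (rule integrable_mollify_diff_L2[OF \<delta>' gi[OF that]])
    have "eventually (\<lambda>n. \<delta>' n < \<epsilon>) sequentially" using \<delta>'0 \<epsilon> by (rule order_tendstoD)
    then have ev: "eventually (\<lambda>n. n2 M (\<lambda>x. indicator K x *\<^sub>R grad (?s n) x - indicator K x *\<^sub>R ?Q x)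
      \<le> sqrt (\<Sum>i\<in>Basis. (n2 lebesgue (?d i n))\<^sup>2)) sequentially"
    proof (rule eventually_mono)
      fix n assume n: "\<delta>' n < \<epsilon>"
      let ?D = "\<lambda>x. indicator K x *\<^sub>R grad (?s n) x - indicator K x *\<^sub>R ?Q x"
      have gs: "grad (?s n) x \<bullet> i = conv (?g i) (mollifier (\<delta>' n)) x" if "x \<in> K" "i \<in> Basis" for x i
      proof -
        have "grad (?s n) x = grad (conv f (mollifier (\<delta>' n))) x"
          using grad_add[OF smooth_const[of cl] smc, of n x] by simp
        moreover have "\<forall>y. norm (x - y) < \<epsilon> \<longrightarrow> y \<in> K'" using near that(1) by blast
        ultimately show ?thesis
          using grad_conv_mollifier[OF v vQ[OF that(2)] that(2) K' _ \<delta>' less_imp_le[OF n]]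
          by (simp add: f_def[abs_def])
      qed
      have pw: "(norm (?D x))\<^sup>2 \<le> (\<Sum>i\<in>Basis. (?d i n x)\<^sup>2)" if "x \<in> \<Omega>" for x
      proof (cases "x \<in> K")
        case True
        have "(norm (?D x))\<^sup>2 = (\<Sum>i\<in>Basis. ((grad (?s n) x - ?Q x) \<bullet> i)\<^sup>2)"
          using True by (simp add: norm_square_eq_sum)
        also have "\<dots> = (\<Sum>i\<in>Basis. (?d i n x)\<^sup>2)"
          using gs[OF True] that by (intro sum.cong refl) (simp add: inner_diff_left)
        finally show ?thesis by simp
      qed (simp add: sum_nonneg)
      have iD: "integrable M (\<lambda>x. (norm (?D x))\<^sup>2)"
        using sqint_diff[OF sqint_continuous_on_compact[OF continuous_grad K(1)] sqint_indicator[OF Q(3) K(1)]]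
          smooth_add[OF smooth_const smc] by (simp add: sqint_def)
      have "(LINT x|M. (norm (?D x))\<^sup>2) = (LINT x|lebesgue. indicator \<Omega> x *\<^sub>R (norm (?D x))\<^sup>2)"
        by (simp add: integral_restrict_space)
      also have "\<dots> \<le> (LINT x|lebesgue. (\<Sum>i\<in>Basis. (?d i n x)\<^sup>2))"
      proof (rule integral_mono)
        show "integrable lebesgue (\<lambda>x. indicator \<Omega> x *\<^sub>R (norm (?D x))\<^sup>2)"
          using iD by (subst (asm) integrable_restrict_space) simp_all
        show "integrable lebesgue (\<lambda>x. \<Sum>i\<in>Basis. (?d i n x)\<^sup>2)"
          using di by (intro Bochner_Integration.integrable_sum) auto
        show "indicator \<Omega> x *\<^sub>R (norm (?D x))\<^sup>2 \<le> (\<Sum>i\<in>Basis. (?d i n x)\<^sup>2)" for x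
          using pw[of x] by (cases "x \<in> \<Omega>") (auto simp: sum_nonneg)
      qed
      also have "\<dots> = (\<Sum>i\<in>Basis. (LINT x|lebesgue. (?d i n x)\<^sup>2))"
        using di by (intro Bochner_Integration.integral_sum) auto
      also have "\<dots> = (\<Sum>i\<in>Basis. (n2 lebesgue (?d i n))\<^sup>2)" by (simp add: n2_power2)
      finally show "n2 M ?D \<le> sqrt (\<Sum>i\<in>Basis. (n2 lebesgue (?d i n))\<^sup>2)" by (simp add: n2_def)
    qed
    have "(\<lambda>n. sqrt (\<Sum>i\<in>Basis. (n2 lebesgue (?d i n))\<^sup>2)) \<longlonglongrightarrow> sqrt (\<Sum>i\<in>(Basis::'a set). 0\<^sup>2)"
      using n2_mollify_tendsto[OF gi \<delta>' \<delta>'0] by (intro tendsto_intros)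
    then have lim: "(\<lambda>n. sqrt (\<Sum>i\<in>Basis. (n2 lebesgue (?d i n))\<^sup>2)) \<longlonglongrightarrow> 0" by simp
    show "(\<lambda>n. n2 M (\<lambda>x. indicator K x *\<^sub>R grad (?s n) x - indicator K x *\<^sub>R ?Q x)) \<longlonglongrightarrow> 0"
      by (rule tendsto_sandwich[OF _ ev tendsto_const lim]) simp
  qed
qed

section \<open>Testing with products\<close>

text \<open>\<open>div_eq P F\<close> is the equation \<open>-\<nabla>\<cdot>P = F\<close> in the sense of distributions, for square
  integrable \<open>P\<close> and \<open>F\<close>.\<close>

definition div_eq :: "('a \<Rightarrow> 'a) \<Rightarrow> ('a \<Rightarrow> real) \<Rightarrow> bool" where
  "div_eq P F \<longleftrightarrow> sqint M P \<and> sqint M F \<and>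
     (\<forall>\<phi>\<in>test_functions \<Omega>. (LINT x|M. P x \<bullet> grad \<phi> x) = (LINT x|M. F x * \<phi> x))"

text \<open>An approximation of \<open>w \<in> W\<^sub>0\<^sup>1\<^sup>,\<^sup>2\<close> with gradient \<open>W\<close> by test functions, in the form in which limits are
  taken: the gradients converge in \<open>L\<^sup>2\<close>, the functions themselves almost everywhere.\<close>

definition test_approx :: "('a \<Rightarrow> real) \<Rightarrow> ('a \<Rightarrow> 'a) \<Rightarrow> (nat \<Rightarrow> 'a \<Rightarrow> real) \<Rightarrow> bool" where
  "test_approx w W \<phi> \<longleftrightarrow> sqint M w \<and> sqint M W \<and> (\<forall>n. \<phi> n \<in> test_functions \<Omega>) \<and>
     (\<lambda>n. n2 M (\<lambda>x. grad (\<phi> n) x - W x)) \<longlonglongrightarrow> 0 \<and> (AE x in M. (\<lambda>n. \<phi> n x) \<longlonglongrightarrow> w x)"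

lemma test_smooth: "\<phi> \<in> test_functions \<Omega> \<Longrightarrow> smooth \<phi>"
  by (auto elim: test_functionsE)

lemma test_bounded:
  assumes "\<phi> \<in> test_functions \<Omega>"
  obtains B where "\<And>x. \<bar>\<phi> x\<bar> \<le> B"
proof -
  obtain K where \<phi>: "smooth \<phi>" "compact K" "K \<subseteq> \<Omega>"
      and \<phi>0: "\<forall>x. x \<notin> K \<longrightarrow> \<phi> x = 0 \<and> grad \<phi> x = 0"
    using test_functionsE[OF assms] .
  obtain R where R: "\<forall>x\<in>K. norm x \<le> R"
    using compact_imp_bounded[OF \<phi>(2)] unfolding bounded_iff by blast
  have "\<phi> z = 0" if "norm z > R" for z
  proof -
    have "z \<notin> K" using R that by (meson linorder_not_less)
    then show ?thesis using \<phi>0 by blast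
  qed
  then obtain B where "\<And>z. norm (\<phi> z) \<le> B"
    using bounded_if_vanishing_outside_ball[OF smooth_continuous[OF \<phi>(1)]] by blast
  then have "\<And>z. \<bar>\<phi> z\<bar> \<le> B" by simp
  then show thesis by (rule that)
qed

text \<open>If \<open>s\<^sub>n\<close> are smooth approximations of \<open>r\<close>, then \<open>s\<^sub>n \<phi>\<close> is a test function, and convergence of the
  gradients of \<open>s\<^sub>n\<close> is needed on the compact support of \<open>\<phi>\<close> only.\<close>

lemma div_eq_test_mult:
  assumes D: "div_eq P F" and r: "smooth_approx lo hi r R" and test: "\<phi> \<in> test_functions \<Omega>"
  shows "(LINT x|M. P x \<bullet> (r x *\<^sub>R grad \<phi> x + \<phi> x *\<^sub>R R x)) = (LINT x|M. F x * (r x * \<phi> x))"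
proof -
  have P: "sqint M P" and F: "sqint M F"
    and eq: "\<And>\<phi>. \<phi> \<in> test_functions \<Omega> \<Longrightarrow> (LINT x|M. P x \<bullet> grad \<phi> x) = (LINT x|M. F x * \<phi> x)"
    using D by (auto simp: div_eq_def)
  have rm: "r \<in> borel_measurable M" "sqint M R" using r by (auto simp: smooth_approx_def)
  obtain K where \<phi>: "smooth \<phi>" and K: "compact K" "K \<subseteq> \<Omega>"
      and \<phi>0: "\<forall>x. x \<notin> K \<longrightarrow> \<phi> x = 0 \<and> grad \<phi> x = 0"
    using test_functionsE[OF test] .
  obtain s where s: "\<forall>n::nat. smooth (s n)" "\<forall>n x. lo \<le> s n x \<and> s n x \<le> hi"
      "AE x in M. (\<lambda>n. s n x) \<longlonglongrightarrow> r x"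
      "(\<lambda>n. n2 M (\<lambda>x. indicator K x *\<^sub>R grad (s n) x - indicator K x *\<^sub>R R x)) \<longlonglongrightarrow> 0"
    by (rule smooth_approxE[OF r K])
  let ?B = "max \<bar>lo\<bar> \<bar>hi\<bar>"
  have sB: "\<bar>s n x\<bar> \<le> ?B" for n x using s(2) by (intro interval_abs_bound) auto
  obtain B' where B': "\<And>x. \<bar>\<phi> x\<bar> \<le> B'" using test_bounded[OF test] by blast
  have sm: "s n \<in> borel_measurable M" for n using s(1) smooth_measurable by blast
  have gs: "sqint M (\<lambda>x. indicator K x *\<^sub>R grad (s n) x)" for n
    using s(1) by (auto intro!: sqint_continuous_on_compact continuous_grad K)
  note g\<phi> = sqint_test[OF test]
  have t1: "sqint M (\<lambda>x. s n x *\<^sub>R grad \<phi> x)" "sqint M (\<lambda>x. r x *\<^sub>R grad \<phi> x)"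
      "(\<lambda>n. n2 M (\<lambda>x. s n x *\<^sub>R grad \<phi> x - r x *\<^sub>R grad \<phi> x)) \<longlonglongrightarrow> 0" for n
    using n2_tendsto_bounded_mult[where a=s and a'=r and B="?B" and G'="\<lambda>n. grad \<phi>" and G="grad \<phi>" and M=M]
      sm sB s(3) rm(1) g\<phi>(2) by (simp_all add: n2_def)
  have t2: "sqint M (\<lambda>x. \<phi> x *\<^sub>R (indicator K x *\<^sub>R grad (s n) x))"
      "sqint M (\<lambda>x. \<phi> x *\<^sub>R (indicator K x *\<^sub>R R x))"
      "(\<lambda>n. n2 M (\<lambda>x. \<phi> x *\<^sub>R (indicator K x *\<^sub>R grad (s n) x) - \<phi> x *\<^sub>R (indicator K x *\<^sub>R R x))) \<longlonglongrightarrow> 0" for n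
    using n2_tendsto_bounded_mult[where a="\<lambda>n. \<phi>" and a'=\<phi> and B=B' and
        G'="\<lambda>n x. indicator K x *\<^sub>R grad (s n) x" and G="\<lambda>x. indicator K x *\<^sub>R R x" and M=M]
      smooth_measurable[OF \<phi>] B' gs s(4) sqint_indicator[OF rm(2) K(1)] by simp_all
  have t3: "sqint M (\<lambda>x. s n x *\<^sub>R \<phi> x)" "sqint M (\<lambda>x. r x *\<^sub>R \<phi> x)"
      "(\<lambda>n. n2 M (\<lambda>x. s n x *\<^sub>R \<phi> x - r x *\<^sub>R \<phi> x)) \<longlonglongrightarrow> 0" for n
    using n2_tendsto_bounded_mult[where a=s and a'=r and B="?B" and G'="\<lambda>n. \<phi>" and G=\<phi> and M=M]
      sm sB s(3) rm(1) g\<phi>(1) by (simp_all add: n2_def)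
  have i\<phi>: "\<phi> x *\<^sub>R (indicator K x *\<^sub>R v) = \<phi> x *\<^sub>R v" for x and v :: 'a
    using \<phi>0 by (cases "x \<in> K") auto
  have "(\<lambda>n. LINT x|M. P x \<bullet> (s n x *\<^sub>R grad \<phi> x + \<phi> x *\<^sub>R (indicator K x *\<^sub>R grad (s n) x)))
    \<longlonglongrightarrow> (LINT x|M. P x \<bullet> (r x *\<^sub>R grad \<phi> x + \<phi> x *\<^sub>R (indicator K x *\<^sub>R R x)))"
    by (rule n2_tendsto_inner[OF P sqint_add[OF t1(1) t2(1)] sqint_add[OF t1(2) t2(2)] n2_tendsto_add[OF t1 t2]])
  moreover have "(LINT x|M. P x \<bullet> (s n x *\<^sub>R grad \<phi> x + \<phi> x *\<^sub>R grad (s n) x)) = (LINT x|M. F x * (s n x * \<phi> x))" for n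
    using eq[OF test_functions_mult[OF test, of "s n"]] s(1) grad_mult[OF _ \<phi>, of "s n"] by simp
  ultimately have "(\<lambda>n. LINT x|M. F x * (s n x * \<phi> x)) \<longlonglongrightarrow> (LINT x|M. P x \<bullet> (r x *\<^sub>R grad \<phi> x + \<phi> x *\<^sub>R R x))"
    unfolding i\<phi> by simp
  moreover have "(\<lambda>n. LINT x|M. F x * (s n x * \<phi> x)) \<longlonglongrightarrow> (LINT x|M. F x * (r x * \<phi> x))"
    using n2_tendsto_inner[OF F t3] by simp
  ultimately show ?thesis by (rule LIMSEQ_unique)
qed

lemma tendsto_mult_sin_divide: "(\<lambda>n. real (Suc n) * sin (t / real (Suc n))) \<longlonglongrightarrow> t"
proof (cases "t = 0")
  case False
  have "((\<lambda>h. (sin (0 + h) - sin 0) / h) \<longlongrightarrow> cos (0::real)) (at 0)"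
    using DERIV_sin[of "0::real"] unfolding DERIV_def .
  then have lim: "((\<lambda>h. sin h / h) \<longlongrightarrow> 1) (at (0::real))" by simp
  have h: "(\<lambda>n. t * inverse (real (Suc n))) \<longlonglongrightarrow> 0"
    by (rule tendsto_mult_right_zero[OF LIMSEQ_inverse_real_of_nat])
  have "filterlim (\<lambda>n. t / real (Suc n)) (at 0) sequentially"
    using h False by (auto simp: filterlim_at divide_inverse)
  from filterlim_compose[OF lim this]
  have "(\<lambda>n. t * (sin (t / real (Suc n)) / (t / real (Suc n)))) \<longlonglongrightarrow> t * 1"
    by (intro tendsto_mult tendsto_const)
  moreover have "t * (sin (t / real (Suc n)) / (t / real (Suc n))) = real (Suc n) * sin (t / real (Suc n))" for n
    using False by simp
  ultimately show ?thesis by simp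
qed simp

text \<open>A bounded element \<open>w\<close> of \<open>W\<^sub>0\<^sup>1\<^sup>,\<^sup>2\<close> may be used in place of the test function, although its
  approximations \<open>\<phi>\<^sub>m\<close> by test functions need not be bounded uniformly: \<open>k sin (\<phi>\<^sub>m / k)\<close> is a
  test function bounded by \<open>k\<close>, and the limits \<open>m \<rightarrow> \<infinity>\<close> and then \<open>k \<rightarrow> \<infinity>\<close> exist.\<close>

lemma div_eq_mult:
  assumes D: "div_eq P F" and r: "smooth_approx lo hi r R" and w: "test_approx w W \<phi>"
    and wB: "AE x in M. \<bar>w x\<bar> \<le> B"
  shows "sqint M (\<lambda>x. r x *\<^sub>R W x + w x *\<^sub>R R x)"
    and "(LINT x|M. P x \<bullet> (r x *\<^sub>R W x + w x *\<^sub>R R x)) = (LINT x|M. F x * (r x * w x))"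
proof -
  have P: "sqint M P" and F: "sqint M F" using D by (auto simp: div_eq_def)
  have rm: "r \<in> borel_measurable M" "sqint M R" using r by (auto simp: smooth_approx_def)
  have W: "sqint M w" "sqint M W" "\<And>n. \<phi> n \<in> test_functions \<Omega>"
      "(\<lambda>n. n2 M (\<lambda>x. grad (\<phi> n) x - W x)) \<longlonglongrightarrow> 0" "AE x in M. (\<lambda>n. \<phi> n x) \<longlonglongrightarrow> w x"
    using w by (auto simp: test_approx_def)
  let ?Br = "max \<bar>lo\<bar> \<bar>hi\<bar>"
  have rB: "AE x in M. \<bar>r x\<bar> \<le> ?Br"
    using smooth_approx_bounds[OF r] by (rule eventually_mono) (simp add: interval_abs_bound)
  note [measurable] = rm(1) sqint_measurable[OF W(1)]
  have \<phi>m [measurable]: "\<phi> n \<in> borel_measurable M" for n using smooth_measurable[OF test_smooth[OF W(3)]] .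
  note g\<phi> = sqint_test(2)[OF W(3)]
  define T where "T k t = real (Suc k) * sin (t / real (Suc k))" for k t
  define C where "C k t = cos (t / real (Suc k))" for k t
  have T: "\<bar>T k t\<bar> \<le> real (Suc k)" "\<bar>T k t\<bar> \<le> \<bar>t\<bar>" for k t
  proof -
    have "\<bar>real (Suc k) * sin (t / real (Suc k))\<bar> \<le> real (Suc k) * 1"
      unfolding abs_mult by (intro mult_mono) auto
    then show "\<bar>T k t\<bar> \<le> real (Suc k)" by (simp add: T_def)
    have "\<bar>real (Suc k) * sin (t / real (Suc k))\<bar> \<le> real (Suc k) * \<bar>t / real (Suc k)\<bar>"
      unfolding abs_mult using abs_sin_x_le_abs_x[of "t / real (Suc k)"] by (intro mult_mono) auto
    then show "\<bar>T k t\<bar> \<le> \<bar>t\<bar>" by (simp add: T_def)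
  qed
  have C: "\<bar>C k t\<bar> \<le> 1" for k t by (simp add: C_def)
  have Tm [measurable]: "T k \<in> borel_measurable borel" and Cm [measurable]: "C k \<in> borel_measurable borel" for k
    unfolding T_def C_def by measurable
  have rC: "AE x in M. \<bar>r x * C k (u x)\<bar> \<le> ?Br" for k and u :: "'a \<Rightarrow> real"
    using rB
  proof (rule eventually_mono)
    fix x assume "\<bar>r x\<bar> \<le> ?Br"
    then have "\<bar>r x\<bar> * \<bar>C k (u x)\<bar> \<le> ?Br * 1" by (intro mult_mono C) auto
    then show "\<bar>r x * C k (u x)\<bar> \<le> ?Br" by (simp add: abs_mult)
  qed
  have rT: "AE x in M. \<bar>r x * T k (u x)\<bar> \<le> ?Br * real (Suc k)" for k and u :: "'a \<Rightarrow> real"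
    using rB
  proof (rule eventually_mono)
    fix x assume "\<bar>r x\<bar> \<le> ?Br"
    then have "\<bar>r x\<bar> * \<bar>T k (u x)\<bar> \<le> ?Br * real (Suc k)" by (intro mult_mono T) auto
    then show "\<bar>r x * T k (u x)\<bar> \<le> ?Br * real (Suc k)" by (simp add: abs_mult)
  qed
  have one: "(LINT x|M. F x * a x) = (LINT x|M. 1 \<bullet> (a x *\<^sub>R F x))" for a :: "'a \<Rightarrow> real"
    by (simp add: mult.commute)
  \<comment> \<open>the limit of the approximating sequence, for a fixed truncation level\<close>
  have eqk: "(LINT x|M. P x \<bullet> ((r x * C k (w x)) *\<^sub>R W x + T k (w x) *\<^sub>R R x)) = (LINT x|M. F x * (r x * T k (w x)))" for k
  proof -
    have test: "(\<lambda>x. T k (\<phi> m x)) \<in> test_functions \<Omega>" for m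
    proof -
      obtain K where \<phi>: "smooth (\<phi> m)" "compact K" "K \<subseteq> \<Omega>"
        and \<phi>0: "\<forall>x. x \<notin> K \<longrightarrow> \<phi> m x = 0 \<and> grad (\<phi> m) x = 0"
        using test_functionsE[OF W(3)] .
      have "smooth (\<lambda>x. T k (\<phi> m x))"
        unfolding T_def divide_inverse
        by (rule smooth_mult[OF smooth_const smooth_compose[OF smooth_sin smooth_mult[OF \<phi>(1) smooth_const]]])
      then show ?thesis by (rule test_functionsI[OF _ \<phi>(2,3)]) (simp add: \<phi>0 T_def)
    qed
    have gT: "grad (\<lambda>x. T k (\<phi> m x)) x = C k (\<phi> m x) *\<^sub>R grad (\<phi> m) x" for m x
    proof (rule grad_compose[OF test_smooth[OF W(3)]])
      show "(T k has_field_derivative C k (\<phi> m x)) (at (\<phi> m x))"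
        unfolding T_def C_def by (auto intro!: derivative_eq_intros)
    qed
    have "(LINT x|M. P x \<bullet> (r x *\<^sub>R grad (\<lambda>x. T k (\<phi> m x)) x + T k (\<phi> m x) *\<^sub>R R x))
        = (LINT x|M. F x * (r x * T k (\<phi> m x)))" for m
      by (rule div_eq_test_mult[OF D r test])
    then have eqm: "(LINT x|M. P x \<bullet> ((r x * C k (\<phi> m x)) *\<^sub>R grad (\<phi> m) x + T k (\<phi> m x) *\<^sub>R R x))
        = (LINT x|M. F x * (r x * T k (\<phi> m x)))" for m
      unfolding gT by simp
    have limC: "AE x in M. (\<lambda>m. r x * C k (\<phi> m x)) \<longlonglongrightarrow> r x * C k (w x)"
      using W(5) by (rule eventually_mono) (auto simp: C_def intro!: tendsto_intros)
    have limT: "AE x in M. (\<lambda>m. T k (\<phi> m x)) \<longlonglongrightarrow> T k (w x)"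
      using W(5) by (rule eventually_mono) (auto simp: T_def intro!: tendsto_intros)
    have limrT: "AE x in M. (\<lambda>m. r x * T k (\<phi> m x)) \<longlonglongrightarrow> r x * T k (w x)"
      using limT by (rule eventually_mono) (intro tendsto_mult tendsto_const)
    have t1: "sqint M (\<lambda>x. (r x * C k (\<phi> m x)) *\<^sub>R grad (\<phi> m) x)" "sqint M (\<lambda>x. (r x * C k (w x)) *\<^sub>R W x)"
      "(\<lambda>m. n2 M (\<lambda>x. (r x * C k (\<phi> m x)) *\<^sub>R grad (\<phi> m) x - (r x * C k (w x)) *\<^sub>R W x)) \<longlonglongrightarrow> 0" for m
      using n2_tendsto_bounded_mult[where a="\<lambda>m x. r x * C k (\<phi> m x)" and a'="\<lambda>x. r x * C k (w x)"
          and G'="\<lambda>m. grad (\<phi> m)" and G=W and M=M, OF _ rC limC _ g\<phi> W(2,4)] by measurable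
    have t2: "sqint M (\<lambda>x. T k (\<phi> m x) *\<^sub>R R x)" "sqint M (\<lambda>x. T k (w x) *\<^sub>R R x)"
      "(\<lambda>m. n2 M (\<lambda>x. T k (\<phi> m x) *\<^sub>R R x - T k (w x) *\<^sub>R R x)) \<longlonglongrightarrow> 0" for m
      using n2_tendsto_bounded_mult[where a="\<lambda>m x. T k (\<phi> m x)" and a'="\<lambda>x. T k (w x)"
          and G'="\<lambda>m. R" and G=R and M=M, OF _ AE_I2[OF T(1)] limT _ rm(2) rm(2)] by (simp_all add: n2_def)
    have t3: "sqint M (\<lambda>x. (r x * T k (\<phi> m x)) *\<^sub>R F x)" "sqint M (\<lambda>x. (r x * T k (w x)) *\<^sub>R F x)"
      "(\<lambda>m. n2 M (\<lambda>x. (r x * T k (\<phi> m x)) *\<^sub>R F x - (r x * T k (w x)) *\<^sub>R F x)) \<longlonglongrightarrow> 0" for m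
      using n2_tendsto_bounded_mult[where a="\<lambda>m x. r x * T k (\<phi> m x)" and a'="\<lambda>x. r x * T k (w x)"
          and G'="\<lambda>m. F" and G=F and M=M, OF _ rT limrT _ F F] by (simp_all add: n2_def)
    have "(\<lambda>m. LINT x|M. P x \<bullet> ((r x * C k (\<phi> m x)) *\<^sub>R grad (\<phi> m) x + T k (\<phi> m x) *\<^sub>R R x))
      \<longlonglongrightarrow> (LINT x|M. P x \<bullet> ((r x * C k (w x)) *\<^sub>R W x + T k (w x) *\<^sub>R R x))"
      by (rule n2_tendsto_inner[OF P sqint_add[OF t1(1) t2(1)] sqint_add[OF t1(2) t2(2)] n2_tendsto_add[OF t1 t2]])
    moreover have "(\<lambda>m. LINT x|M. F x * (r x * T k (\<phi> m x))) \<longlonglongrightarrow> (LINT x|M. F x * (r x * T k (w x)))"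
      unfolding one by (rule n2_tendsto_inner[OF sqint_const t3])
    ultimately show ?thesis unfolding eqm by (rule LIMSEQ_unique)
  qed
  have limC: "AE x in M. (\<lambda>k. r x * C k (w x)) \<longlonglongrightarrow> r x"
  proof (rule AE_I2)
    fix x
    have "(\<lambda>k. w x * inverse (real (Suc k))) \<longlonglongrightarrow> 0"
      by (rule tendsto_mult_right_zero[OF LIMSEQ_inverse_real_of_nat])
    then have "(\<lambda>k. r x * cos (w x * inverse (real (Suc k)))) \<longlonglongrightarrow> r x * cos 0"
      by (intro tendsto_intros)
    then show "(\<lambda>k. r x * C k (w x)) \<longlonglongrightarrow> r x" by (simp add: C_def divide_inverse)
  qed
  have limT: "AE x in M. (\<lambda>k. T k (w x)) \<longlonglongrightarrow> w x"
    unfolding T_def by (intro AE_I2 tendsto_mult_sin_divide)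
  have limrT: "AE x in M. (\<lambda>k. r x * T k (w x)) \<longlonglongrightarrow> r x * w x"
    using limT by (rule eventually_mono) (intro tendsto_mult tendsto_const)
  have TB: "AE x in M. \<bar>T k (w x)\<bar> \<le> B" for k
    using wB by (rule eventually_mono) (use T(2) order_trans in blast)
  have rTB: "AE x in M. \<bar>r x * T k (w x)\<bar> \<le> ?Br * B" for k
    using rB TB[of k] by eventually_elim (auto simp: abs_mult intro!: mult_mono)
  have t1: "sqint M (\<lambda>x. (r x * C k (w x)) *\<^sub>R W x)" "sqint M (\<lambda>x. r x *\<^sub>R W x)"
    "(\<lambda>k. n2 M (\<lambda>x. (r x * C k (w x)) *\<^sub>R W x - r x *\<^sub>R W x)) \<longlonglongrightarrow> 0" for k
    using n2_tendsto_bounded_mult[where a="\<lambda>k x. r x * C k (w x)" and a'=r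
        and G'="\<lambda>k. W" and G=W and M=M, OF _ rC limC _ W(2) W(2)] by (simp_all add: n2_def)
  have t2: "sqint M (\<lambda>x. T k (w x) *\<^sub>R R x)" "sqint M (\<lambda>x. w x *\<^sub>R R x)"
    "(\<lambda>k. n2 M (\<lambda>x. T k (w x) *\<^sub>R R x - w x *\<^sub>R R x)) \<longlonglongrightarrow> 0" for k
    using n2_tendsto_bounded_mult[where a="\<lambda>k x. T k (w x)" and a'=w
        and G'="\<lambda>k. R" and G=R and M=M, OF _ TB limT _ rm(2) rm(2)] by (simp_all add: n2_def)
  have t3: "sqint M (\<lambda>x. (r x * T k (w x)) *\<^sub>R F x)" "sqint M (\<lambda>x. (r x * w x) *\<^sub>R F x)"
    "(\<lambda>k. n2 M (\<lambda>x. (r x * T k (w x)) *\<^sub>R F x - (r x * w x) *\<^sub>R F x)) \<longlonglongrightarrow> 0" for k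
    using n2_tendsto_bounded_mult[where a="\<lambda>k x. r x * T k (w x)" and a'="\<lambda>x. r x * w x"
        and G'="\<lambda>k. F" and G=F and M=M, OF _ rTB limrT _ F F] by (simp_all add: n2_def)
  show "sqint M (\<lambda>x. r x *\<^sub>R W x + w x *\<^sub>R R x)" by (rule sqint_add[OF t1(2) t2(2)])
  have "(\<lambda>k. LINT x|M. P x \<bullet> ((r x * C k (w x)) *\<^sub>R W x + T k (w x) *\<^sub>R R x))
      \<longlonglongrightarrow> (LINT x|M. P x \<bullet> (r x *\<^sub>R W x + w x *\<^sub>R R x))"
    by (rule n2_tendsto_inner[OF P sqint_add[OF t1(1) t2(1)] sqint_add[OF t1(2) t2(2)] n2_tendsto_add[OF t1 t2]])
  moreover have "(\<lambda>k. LINT x|M. F x * (r x * T k (w x))) \<longlonglongrightarrow> (LINT x|M. F x * (r x * w x))"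
    unfolding one by (rule n2_tendsto_inner[OF sqint_const t3])
  ultimately show "(LINT x|M. P x \<bullet> (r x *\<^sub>R W x + w x *\<^sub>R R x)) = (LINT x|M. F x * (r x * w x))"
    unfolding eqk by (rule LIMSEQ_unique)
qed

section \<open>Boundedness of weak solutions\<close>

lemma continuous_bounded_on_\<Omega>:
  fixes f :: "'a \<Rightarrow> 'b::euclidean_space"
  assumes "continuous_on UNIV f"
  obtains B where "\<And>x. x \<in> \<Omega> \<Longrightarrow> norm (f x) \<le> B"
proof -
  have "compact (f ` closure \<Omega>)"
    using bounded_\<Omega>
    by (intro compact_continuous_image continuous_on_subset[OF assms]) (simp_all add: compact_closure)
  from compact_imp_bounded[OF this] obtain B where B: "\<forall>y\<in>f ` closure \<Omega>. norm y \<le> B"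
    unfolding bounded_iff by blast
  have "norm (f x) \<le> B" if "x \<in> \<Omega>" for x
    using B closure_subset[of \<Omega>] that by blast
  then show thesis by (rule that)
qed

lemma continuous_measurable:
  "continuous_on UNIV (f :: 'a \<Rightarrow> 'b::euclidean_space) \<Longrightarrow> f \<in> borel_measurable M"
  by (intro measurable_restrict_space1 continuous_imp_lebesgue_measurable)

lemma sqint_continuous:
  fixes f :: "'a \<Rightarrow> 'b::euclidean_space"
  assumes "continuous_on UNIV f"
  shows "sqint M f"
proof -
  obtain B where B: "\<And>x. x \<in> \<Omega> \<Longrightarrow> norm (f x) \<le> B"
    using continuous_bounded_on_\<Omega>[OF assms] by blast
  have "norm (f x) \<le> norm \<bar>B\<bar>" if "x \<in> space M" for x
    using B[of x] that by simp
  then show ?thesis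
    by (rule sqint_bound(1)[OF sqint_const continuous_measurable[OF assms] AE_I2])
qed

text \<open>The weak maximum principle. As \<open>flat 0\<close> vanishes exactly on \<open>t \<le> 0\<close> and \<open>\<psi> \<ge> 0\<close> everywhere,
  \<open>flat 0 (w - \<psi>)\<close> is a limit of test functions. Its derivative is \<open>flat 2\<close>, so the difference of
  the two equations gives
  \<open>\<integral> q flat\<^sub>2 (w - \<psi>) \<bar>\<nabla>(w - \<psi>)\<bar>\<^sup>2 = \<integral> (F - f) flat\<^sub>0 (w - \<psi>)\<close>. The left side is nonnegative, and the
  right side negative unless \<open>w \<le> \<psi>\<close>.\<close>

lemma comparison:
  assumes q: "q \<in> borel_measurable M" "AE x in M. 0 < q x \<and> q x \<le> cu"
    and w: "test_approx w W \<phi>" and D: "div_eq (\<lambda>x. q x *\<^sub>R W x) F"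
    and \<psi>: "smooth \<psi>" "\<And>x. \<psi> x \<ge> 0" and D\<psi>: "div_eq (\<lambda>x. q x *\<^sub>R grad \<psi> x) f"
    and gt: "AE x in M. F x < f x"
  shows "AE x in M. w x \<le> \<psi> x"
proof -
  have W: "sqint M w" "sqint M W" "\<And>n. \<phi> n \<in> test_functions \<Omega>"
      "(\<lambda>n. n2 M (\<lambda>x. grad (\<phi> n) x - W x)) \<longlonglongrightarrow> 0" "AE x in M. (\<lambda>n. \<phi> n x) \<longlonglongrightarrow> w x"
    using w by (auto simp: test_approx_def)
  have F: "sqint M F" "sqint M f" and P: "sqint M (\<lambda>x. q x *\<^sub>R W x)" "sqint M (\<lambda>x. q x *\<^sub>R grad \<psi> x)"
    using D D\<psi> by (auto simp: div_eq_def)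
  have \<psi>m [measurable]: "\<psi> \<in> borel_measurable M" by (rule smooth_measurable[OF \<psi>(1)])
  note [measurable] = sqint_measurable[OF W(1)] sqint_measurable[OF W(2)] q(1)
    sqint_measurable[OF F(1)] sqint_measurable[OF F(2)]
  have \<phi>m [measurable]: "\<phi> n \<in> borel_measurable M" for n using smooth_measurable[OF test_smooth[OF W(3)]] .
  have flatm [measurable]: "flat j \<in> borel_measurable borel" for j
    by (intro borel_measurable_continuous_onI smooth_continuous smooth_flat)
  have g\<psi>: "sqint M (grad \<psi>)" by (rule sqint_continuous[OF continuous_grad[OF \<psi>(1)]])
  let ?P = "\<lambda>x. q x *\<^sub>R W x - q x *\<^sub>R grad \<psi> x"
  have PP: "sqint M ?P" by (rule sqint_diff[OF P])
  let ?d = "\<lambda>n x. \<phi> n x - \<psi> x"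
  have sd: "smooth (?d n)" for n by (rule smooth_diff[OF test_smooth[OF W(3)] \<psi>(1)])
  have gd: "grad (?d n) x = grad (\<phi> n) x - grad \<psi> x" for n x
    by (rule grad_diff[OF test_smooth[OF W(3)] \<psi>(1)])
  have test: "(\<lambda>x. flat 0 (?d n x)) \<in> test_functions \<Omega>" for n
  proof -
    obtain K where K: "smooth (\<phi> n)" "compact K" "K \<subseteq> \<Omega>"
      and \<phi>0: "\<forall>x. x \<notin> K \<longrightarrow> \<phi> n x = 0 \<and> grad (\<phi> n) x = 0"
      using test_functionsE[OF W(3)] .
    show ?thesis
      by (rule test_functionsI[OF smooth_compose[OF smooth_flat sd] K(2,3)]) (simp add: \<phi>0 \<psi>(2) flat_eq_0)
  qed
  have gflat: "grad (\<lambda>x. flat 0 (?d n x)) x = flat 2 (?d n x) *\<^sub>R (grad (\<phi> n) x - grad \<psi> x)" for n x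
    unfolding gd[symmetric] by (rule grad_compose[OF sd]) (use DERIV_flat[of 0 "?d n x"] in \<open>simp add: numeral_2_eq_2\<close>)
  obtain B0 where B0: "\<And>t. flat 0 t \<le> B0" using flat_bounded by blast
  obtain B2 where B2: "\<And>t. flat 2 t \<le> B2" using flat_bounded by blast
  have B0': "\<bar>flat 0 t\<bar> \<le> B0" and B2': "\<bar>flat 2 t\<bar> \<le> B2" for t
    using B0[of t] B2[of t] flat_nonneg[of 0 t] flat_nonneg[of 2 t] by auto
  have limflat: "AE x in M. (\<lambda>n. flat j (?d n x)) \<longlonglongrightarrow> flat j (w x - \<psi> x)" for j
    using W(5)
  proof (rule eventually_mono)
    fix x assume "(\<lambda>n. \<phi> n x) \<longlonglongrightarrow> w x"
    then have "(\<lambda>n. ?d n x) \<longlonglongrightarrow> w x - \<psi> x" by (intro tendsto_intros)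
    then show "(\<lambda>n. flat j (?d n x)) \<longlonglongrightarrow> flat j (w x - \<psi> x)"
      by (rule isCont_tendsto_compose[rotated]) (rule DERIV_isCont[OF DERIV_flat])
  qed
  have eqn: "(LINT x|M. ?P x \<bullet> (flat 2 (?d n x) *\<^sub>R (grad (\<phi> n) x - grad \<psi> x)))
      = (LINT x|M. (F x - f x) \<bullet> (flat 0 (?d n x) *\<^sub>R 1))" for n
  proof -
    have "(LINT x|M. ?P x \<bullet> grad (\<lambda>x. flat 0 (?d n x)) x)
      = (LINT x|M. (q x *\<^sub>R W x) \<bullet> grad (\<lambda>x. flat 0 (?d n x)) x)
        - (LINT x|M. (q x *\<^sub>R grad \<psi> x) \<bullet> grad (\<lambda>x. flat 0 (?d n x)) x)"
      using sqint_integrable_inner[OF P(1) sqint_test(2)[OF test]]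
        sqint_integrable_inner[OF P(2) sqint_test(2)[OF test]] by (simp add: inner_diff_left)
    also have "\<dots> = (LINT x|M. F x * flat 0 (?d n x)) - (LINT x|M. f x * flat 0 (?d n x))"
      using D D\<psi> test by (simp add: div_eq_def)
    also have "\<dots> = (LINT x|M. (F x - f x) \<bullet> (flat 0 (?d n x) *\<^sub>R 1))"
      using sqint_integrable_mult[OF F(1) sqint_test(1)[OF test]]
        sqint_integrable_mult[OF F(2) sqint_test(1)[OF test]] by (simp add: left_diff_distrib)
    finally show ?thesis unfolding gflat .
  qed
  have gdn: "sqint M (\<lambda>x. grad (\<phi> n) x - grad \<psi> x)" for n
    by (rule sqint_diff[OF sqint_test(2)[OF W(3)] g\<psi>])
  have W\<psi>: "sqint M (\<lambda>x. W x - grad \<psi> x)" by (rule sqint_diff[OF W(2) g\<psi>])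
  have t1: "sqint M (\<lambda>x. flat 2 (?d n x) *\<^sub>R (grad (\<phi> n) x - grad \<psi> x))"
      "sqint M (\<lambda>x. flat 2 (w x - \<psi> x) *\<^sub>R (W x - grad \<psi> x))"
      "(\<lambda>n. n2 M (\<lambda>x. flat 2 (?d n x) *\<^sub>R (grad (\<phi> n) x - grad \<psi> x)
          - flat 2 (w x - \<psi> x) *\<^sub>R (W x - grad \<psi> x))) \<longlonglongrightarrow> 0" for n
    using n2_tendsto_bounded_mult[where a="\<lambda>n x. flat 2 (?d n x)" and a'="\<lambda>x. flat 2 (w x - \<psi> x)" and B=B2
        and G'="\<lambda>n x. grad (\<phi> n) x - grad \<psi> x" and G="\<lambda>x. W x - grad \<psi> x" and M=M,
        OF _ AE_I2[OF B2'] limflat _ gdn W\<psi>] W(4) by simp_all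
  have t2: "sqint M (\<lambda>x. flat 0 (?d n x) *\<^sub>R (1::real))" "sqint M (\<lambda>x. flat 0 (w x - \<psi> x) *\<^sub>R (1::real))"
      "(\<lambda>n. n2 M (\<lambda>x. flat 0 (?d n x) *\<^sub>R (1::real) - flat 0 (w x - \<psi> x) *\<^sub>R 1)) \<longlonglongrightarrow> 0" for n
    using n2_tendsto_bounded_mult[where a="\<lambda>n x. flat 0 (?d n x)" and a'="\<lambda>x. flat 0 (w x - \<psi> x)" and B=B0
        and G'="\<lambda>n x. 1::real" and G="\<lambda>x. 1" and M=M,
        OF _ AE_I2[OF B0'] limflat _ sqint_const sqint_const] by (simp_all add: n2_def)
  have "(\<lambda>n. LINT x|M. ?P x \<bullet> (flat 2 (?d n x) *\<^sub>R (grad (\<phi> n) x - grad \<psi> x)))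
      \<longlonglongrightarrow> (LINT x|M. ?P x \<bullet> (flat 2 (w x - \<psi> x) *\<^sub>R (W x - grad \<psi> x)))"
    by (rule n2_tendsto_inner[OF PP t1])
  moreover have "(\<lambda>n. LINT x|M. (F x - f x) \<bullet> (flat 0 (?d n x) *\<^sub>R 1))
      \<longlonglongrightarrow> (LINT x|M. (F x - f x) \<bullet> (flat 0 (w x - \<psi> x) *\<^sub>R 1))"
    by (rule n2_tendsto_inner[OF sqint_diff[OF F] t2])
  ultimately have eq: "(LINT x|M. ?P x \<bullet> (flat 2 (w x - \<psi> x) *\<^sub>R (W x - grad \<psi> x)))
      = (LINT x|M. (F x - f x) * flat 0 (w x - \<psi> x))"
    unfolding eqn using LIMSEQ_unique by fastforce
  have "0 \<le> (LINT x|M. ?P x \<bullet> (flat 2 (w x - \<psi> x) *\<^sub>R (W x - grad \<psi> x)))"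
  proof (rule integral_nonneg_AE, rule eventually_mono[OF q(2)])
    fix x assume "0 < q x \<and> q x \<le> cu"
    then show "0 \<le> ?P x \<bullet> (flat 2 (w x - \<psi> x) *\<^sub>R (W x - grad \<psi> x))"
      unfolding scaleR_diff_right[of "q x", symmetric] inner_scaleR_left inner_scaleR_right
      by (intro mult_nonneg_nonneg flat_nonneg inner_ge_zero) simp
  qed
  then have le0: "(LINT x|M. (f x - F x) * flat 0 (w x - \<psi> x)) \<le> 0"
    unfolding eq using Bochner_Integration.integral_minus[of M "\<lambda>x. (F x - f x) * flat 0 (w x - \<psi> x)"]
    by (simp add: algebra_simps)
  have i: "integrable M (\<lambda>x. (f x - F x) * flat 0 (w x - \<psi> x))"
    using sqint_integrable_mult[OF sqint_diff[OF F(2,1)] t2(2)] by simp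
  have nn: "AE x in M. 0 \<le> (f x - F x) * flat 0 (w x - \<psi> x)"
    using gt by (rule eventually_mono) (simp add: flat_nonneg)
  have "AE x in M. (f x - F x) * flat 0 (w x - \<psi> x) = 0"
    using integral_nonneg_eq_0_iff_AE[OF i nn] integral_nonneg_AE[OF nn] le0 by simp
  then show ?thesis
    using gt
  proof eventually_elim
    case (elim x)
    then have "flat 0 (w x - \<psi> x) = 0" by simp
    then show ?case using flat_pos[of "w x - \<psi> x" 0] by (cases "w x > \<psi> x") auto
  qed
qed

text \<open>An explicit barrier, using one weak derivative \<open>g\<close> of \<open>q\<close>: with \<open>E x = exp (l x\<^sub>b)\<close> and
  \<open>\<psi> = N' (A - E)\<^sup>2\<close> one finds \<open>-\<nabla>\<cdot>(q\<nabla>\<psi>) = 2 N' l E (q l (A - 2 E) + g (A - E))\<close>, and on \<open>\<Omega>\<close> the term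
  with \<open>q\<close> dominates when \<open>l\<close> is large and \<open>A \<ge> 4 E\<close>. The square, instead of \<open>A - E\<close>, makes \<open>\<psi>\<close>
  nonnegative on the whole space.\<close>

lemma barrier:
  assumes q: "q \<in> borel_measurable M" "AE x in M. cl \<le> q x \<and> q x \<le> cu" and cl: "0 < cl"
    and b: "b \<in> Basis" and g: "has_weak_pderiv \<Omega> b q g" "g \<in> borel_measurable M" "AE x in M. \<bar>g x\<bar> \<le> G"
  obtains \<psi> f where "smooth \<psi>" and "\<And>x. \<psi> x \<ge> 0" and "div_eq (\<lambda>x. q x *\<^sub>R grad \<psi> x) f"
    and "AE x in M. N < f x"
proof -
  obtain R where R: "\<And>x. x \<in> \<Omega> \<Longrightarrow> norm x \<le> R" and "R \<ge> 0"
  proof -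
    obtain R where "\<forall>x\<in>\<Omega>. norm x \<le> R" using bounded_\<Omega> unfolding bounded_iff by blast
    then have "\<And>x. x \<in> \<Omega> \<Longrightarrow> norm x \<le> \<bar>R\<bar>" by force
    then show thesis using that[of "\<bar>R\<bar>"] by simp
  qed
  define l where "l = 2 * (\<bar>G\<bar> + 1) / cl + 1"
  have l: "l \<ge> 1" "cl * l / 2 - \<bar>G\<bar> \<ge> 1"
    using cl by (auto simp: l_def field_simps)
  define N' where "N' = \<bar>N\<bar> + 1"
  have N': "N' > 0" "N' > N" by (auto simp: N'_def)
  define A where "A = 4 * exp (l * R)"
  define E where "E x = exp (l * (x \<bullet> b))" for x :: 'a
  have sE: "smooth E"
    unfolding E_def by (rule smooth_compose[OF smooth_exp smooth_mult[OF smooth_const smooth_inner]])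
  have gE: "grad E x = (l * E x) *\<^sub>R b" for x
    unfolding E_def
    by (rule grad_eqI) (auto intro!: derivative_eq_intros simp: inner_commute[of b])
  have E\<Omega>: "exp (- l * R) \<le> E x" "E x \<le> A / 4" if "x \<in> \<Omega>" for x
  proof -
    have "\<bar>x \<bullet> b\<bar> \<le> R" using Basis_le_norm[OF b, of x] R[OF that] by linarith
    then have "\<bar>l * (x \<bullet> b)\<bar> \<le> l * R" using l(1) by (simp add: abs_mult mult_left_mono)
    then show "exp (- l * R) \<le> E x" "E x \<le> A / 4" by (auto simp: E_def A_def abs_le_iff)
  qed
  define \<psi> where "\<psi> x = N' * ((A - E x) * (A - E x))" for x
  define h where "h x = (2 * N' * l) * (E x * (A - E x))" for x
  note sAE = smooth_diff[OF smooth_const[of A] sE]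
  have gAE: "grad (\<lambda>x. A - E x) x = - (l * E x) *\<^sub>R b" for x
    using grad_diff[OF smooth_const[of A] sE, of x] by (simp add: gE)
  have s\<psi>: "smooth \<psi>" unfolding \<psi>_def by (intro smooth_mult smooth_const sAE)
  have g\<psi>: "grad \<psi> x = - h x *\<^sub>R b" for x
  proof -
    have "grad \<psi> x = N' *\<^sub>R ((A - E x) *\<^sub>R (- (l * E x) *\<^sub>R b) + (A - E x) *\<^sub>R (- (l * E x) *\<^sub>R b))"
      unfolding \<psi>_def grad_mult[OF smooth_const smooth_mult[OF sAE sAE]] grad_mult[OF sAE sAE] gAE by simp
    also have "\<dots> = - h x *\<^sub>R b"
      unfolding scaleR_scaleR scaleR_add_left[symmetric]
      by (rule arg_cong[where f="\<lambda>c. c *\<^sub>R b"]) (simp add: h_def algebra_simps)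
    finally show ?thesis .
  qed
  have sh: "smooth h" unfolding h_def by (intro smooth_mult smooth_const sAE sE)
  have gh: "grad h x \<bullet> b = 2 * N' * l\<^sup>2 * (E x * (A - 2 * E x))" for x
  proof -
    have "grad h x = (2 * N' * l) *\<^sub>R (E x *\<^sub>R (- (l * E x) *\<^sub>R b) + (A - E x) *\<^sub>R ((l * E x) *\<^sub>R b))"
      unfolding h_def grad_mult[OF smooth_const smooth_mult[OF sE sAE]] grad_mult[OF sE sAE] gAE gE by simp
    then have "grad h x \<bullet> b = (2 * N' * l) * (E x * (- (l * E x)) + (A - E x) * (l * E x))"
      using b by (simp add: inner_add_left inner_diff_left)
    then show ?thesis by (simp add: power2_eq_square algebra_simps)
  qed
  define f where "f x = q x * (grad h x \<bullet> b) + g x * h x" for x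
  have qs: "sqint M q"
  proof (rule sqint_bounded[OF q(1)])
    show "AE x in M. \<bar>q x\<bar> \<le> max \<bar>cl\<bar> \<bar>cu\<bar>"
      using q(2) by (rule eventually_mono) (simp add: interval_abs_bound)
  qed
  have gs: "sqint M g" by (rule sqint_bounded[OF g(2,3)])
  have mult: "sqint M (\<lambda>x. a x * u x)" if u: "sqint M u" and a: "continuous_on UNIV a" for a u :: "'a \<Rightarrow> real"
  proof -
    obtain B where "\<And>x. x \<in> \<Omega> \<Longrightarrow> norm (a x) \<le> B" using continuous_bounded_on_\<Omega>[OF a] by blast
    then have "AE x in M. \<bar>a x\<bar> \<le> B" by (intro AE_I2) simp
    from sqint_bounded_mult(1)[OF continuous_measurable[OF a] this u] show ?thesis by simp
  qed
  have fs: "sqint M f"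
    using sqint_add[OF mult[OF qs smooth_continuous[OF smooth_grad_component[OF sh b]]]
        mult[OF gs smooth_continuous[OF sh]]]
    unfolding f_def by (simp add: mult.commute)
  have Ps: "sqint M (\<lambda>x. q x *\<^sub>R grad \<psi> x)"
  proof -
    have "AE x in M. \<bar>q x\<bar> \<le> max \<bar>cl\<bar> \<bar>cu\<bar>"
      using q(2) by (rule eventually_mono) (simp add: interval_abs_bound)
    then show ?thesis
      by (rule sqint_bounded_mult(1)[OF q(1) _ sqint_continuous[OF continuous_grad[OF s\<psi>]]])
  qed
  have "div_eq (\<lambda>x. q x *\<^sub>R grad \<psi> x) f"
    unfolding div_eq_def
  proof (intro conjI ballI Ps fs)
    fix v assume v: "v \<in> test_functions \<Omega>"
    have sv: "smooth v" by (rule test_smooth[OF v])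
    note hv = test_functions_mult[OF v sh]
    have ghv: "grad (\<lambda>x. h x * v x) x \<bullet> b = h x * (grad v x \<bullet> b) + v x * (grad h x \<bullet> b)" for x
      by (simp add: grad_mult[OF sh sv] inner_add_left)
    have i1: "integrable M (\<lambda>x. q x * (h x * (grad v x \<bullet> b)))"
      using sqint_integrable_mult[OF mult[OF qs smooth_continuous[OF sh]] sqint_component[OF sqint_test(2)[OF v] b]]
      by (simp add: mult_ac)
    have i2: "integrable M (\<lambda>x. q x * (v x * (grad h x \<bullet> b)))"
      using sqint_integrable_mult[OF mult[OF qs smooth_continuous[OF smooth_grad_component[OF sh b]]] sqint_test(1)[OF v]]
      by (simp add: mult_ac)
    have i3: "integrable M (\<lambda>x. g x * (h x * v x))"
      by (rule sqint_integrable_mult[OF gs sqint_test(1)[OF hv]])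
    have "(LINT x|M. q x * (grad (\<lambda>x. h x * v x) x \<bullet> b)) = - (LINT x|M. g x * (h x * v x))"
      by (rule has_weak_pderivD[OF g(1) hv])
    then have *: "(LINT x|M. q x * (h x * (grad v x \<bullet> b))) + (LINT x|M. q x * (v x * (grad h x \<bullet> b)))
      = - (LINT x|M. g x * (h x * v x))"
      unfolding ghv distrib_left using i1 i2 by simp
    have "(LINT x|M. (q x *\<^sub>R grad \<psi> x) \<bullet> grad v x) = - (LINT x|M. q x * (h x * (grad v x \<bullet> b)))"
      by (simp add: g\<psi> inner_commute[of b] mult.assoc)
    also have "\<dots> = (LINT x|M. q x * (v x * (grad h x \<bullet> b))) + (LINT x|M. g x * (h x * v x))"
      using * by simp
    also have "\<dots> = (LINT x|M. q x * (v x * (grad h x \<bullet> b)) + g x * (h x * v x))"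
      using i2 i3 by simp
    also have "\<dots> = (LINT x|M. f x * v x)"
      by (simp add: f_def distrib_left distrib_right mult_ac)
    finally show "(LINT x|M. (q x *\<^sub>R grad \<psi> x) \<bullet> grad v x) = (LINT x|M. f x * v x)" .
  qed
  moreover have "AE x in M. N < f x"
  proof -
    have "AE x in M. x \<in> \<Omega>" by (rule AE_I2) simp
    then show ?thesis
      using q(2) g(3)
    proof eventually_elim
      case (elim x)
      note Ex = E\<Omega>[OF elim(1)]
      have E0: "E x > 0" by (simp add: E_def)
      have A0: "A > 0" by (simp add: A_def)
      have "cl * (l * (A / 2)) \<le> q x * (l * (A - 2 * E x))"
        using elim(2) cl l(1) Ex A0 by (intro mult_mono) auto
      moreover have "- (\<bar>G\<bar> * A) \<le> g x * (A - E x)"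
      proof -
        have "\<bar>g x\<bar> * \<bar>A - E x\<bar> \<le> \<bar>G\<bar> * A"
          using elim(3) Ex E0 A0 by (intro mult_mono) auto
        then show ?thesis by (simp add: abs_mult[symmetric] abs_le_iff)
      qed
      moreover have "cl * (l * (A / 2)) - \<bar>G\<bar> * A = (cl * l / 2 - \<bar>G\<bar>) * A"
        by (simp add: algebra_simps)
      moreover have "1 * A \<le> (cl * l / 2 - \<bar>G\<bar>) * A"
        using l(2) A0 by (intro mult_right_mono) auto
      ultimately have dom: "A \<le> q x * (l * (A - 2 * E x)) + g x * (A - E x)" by linarith
      have "f x = (2 * N' * l * E x) * (q x * (l * (A - 2 * E x)) + g x * (A - E x))"
        by (simp add: f_def gh h_def power2_eq_square algebra_simps)
      moreover have "(2 * N' * l * E x) * A \<le> (2 * N' * l * E x) * (q x * (l * (A - 2 * E x)) + g x * (A - E x))"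
        using dom N'(1) l(1) E0 by (intro mult_left_mono) auto
      moreover have "N' * 1 \<le> (2 * N' * l * E x) * A"
      proof -
        have "1 = exp (- l * R) * exp (l * R)" by (simp add: exp_minus)
        also have "\<dots> \<le> E x * A"
          using Ex(1) E0 by (intro mult_mono) (auto simp: A_def)
        finally have "1 \<le> E x * A" .
        moreover have "1 \<le> 2 * l" using l(1) by simp
        ultimately have "1 * 1 \<le> (2 * l) * (E x * A)" by (intro mult_mono) auto
        then have "N' * (1 * 1) \<le> N' * ((2 * l) * (E x * A))" using N'(1) by (intro mult_left_mono) auto
        then show ?thesis by (simp add: mult_ac)
      qed
      ultimately show ?case using N'(2) by linarith
    qed
  qed
  moreover have "\<psi> x \<ge> 0" for x using N'(1) by (simp add: \<psi>_def)
  ultimately show thesis using that s\<psi> by blast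
qed

lemma div_eq_minus:
  assumes "div_eq P F"
  shows "div_eq (\<lambda>x. - P x) (\<lambda>x. - F x)"
  using assms by (auto simp: div_eq_def intro: sqint_minus)

lemma test_minus: "\<phi> \<in> test_functions \<Omega> \<Longrightarrow> (\<lambda>x. - \<phi> x) \<in> test_functions \<Omega>"
  using test_functions_mult[OF _ smooth_const[of "-1"], of \<phi> \<Omega>] by simp

lemma test_approx_minus:
  assumes "test_approx w W \<phi>"
  shows "test_approx (\<lambda>x. - w x) (\<lambda>x. - W x) (\<lambda>n x. - \<phi> n x)"
proof -
  have s: "smooth (\<phi> n)" for n using assms test_smooth by (auto simp: test_approx_def)
  have g: "grad (\<lambda>x. - \<phi> n x) x = - grad (\<phi> n) x" for n x
    using grad_diff[OF smooth_const[of 0] s, of n x] by simp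
  have "n2 M (\<lambda>x. grad (\<lambda>x. - \<phi> n x) x - - W x) = n2 M (\<lambda>x. grad (\<phi> n) x - W x)" for n
    unfolding g n2_def by (simp add: norm_minus_commute)
  moreover have "AE x in M. (\<lambda>n. - \<phi> n x) \<longlonglongrightarrow> - w x"
    using assms unfolding test_approx_def by (auto elim!: eventually_mono intro: tendsto_minus)
  ultimately show ?thesis
    using assms by (simp add: test_approx_def sqint_minus test_minus)
qed

text \<open>The barrier is independent of the solution and bounded on \<open>\<Omega>\<close>; it is compared with \<open>w\<close> and, as the
  equation is linear, with \<open>-w\<close>.\<close>

lemma weak_solution_bounded:
  assumes q: "q \<in> borel_measurable M" "AE x in M. cl \<le> q x \<and> q x \<le> cu" and cl: "0 < cl"
    and b: "b \<in> Basis" and g: "has_weak_pderiv \<Omega> b q g" "g \<in> borel_measurable M" "AE x in M. \<bar>g x\<bar> \<le> G"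
    and F: "AE x in M. \<bar>F x\<bar> \<le> N"
  obtains B where "B \<ge> 0"
    and "\<And>w W \<phi>. test_approx w W \<phi> \<Longrightarrow> div_eq (\<lambda>x. q x *\<^sub>R W x) F \<Longrightarrow> AE x in M. \<bar>w x\<bar> \<le> B"
proof -
  obtain \<psi> f where \<psi>: "smooth \<psi>" "\<And>x. \<psi> x \<ge> 0" and D: "div_eq (\<lambda>x. q x *\<^sub>R grad \<psi> x) f"
    and f: "AE x in M. N < f x"
    using barrier[OF q cl b g, of N] by blast
  obtain B where B: "\<And>x. x \<in> \<Omega> \<Longrightarrow> norm (\<psi> x) \<le> B"
    using continuous_bounded_on_\<Omega>[OF smooth_continuous[OF \<psi>(1)]] by blast
  have q': "AE x in M. 0 < q x \<and> q x \<le> cu"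
    using q(2) by (rule eventually_mono) (use cl in auto)
  have "AE x in M. \<bar>w x\<bar> \<le> \<bar>B\<bar>" if w: "test_approx w W \<phi>" and Dw: "div_eq (\<lambda>x. q x *\<^sub>R W x) F" for w W \<phi>
  proof -
    have lt: "AE x in M. F x < f x" "AE x in M. - F x < f x"
      using F f by (eventually_elim, simp add: abs_le_iff)+
    have "AE x in M. w x \<le> \<psi> x"
      by (rule comparison[OF q(1) q' w Dw \<psi> D lt(1)])
    moreover have "AE x in M. - w x \<le> \<psi> x"
      using div_eq_minus[OF Dw] by (intro comparison[OF q(1) q' test_approx_minus[OF w] _ \<psi> D lt(2)]) simp
    moreover have "AE x in M. x \<in> \<Omega>" by (rule AE_I2) simp
    ultimately show ?thesis
    proof eventually_elim
      case (elim x)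
      then show ?case using B[of x] by auto
    qed
  qed
  then show thesis using that[of "\<bar>B\<bar>"] by simp
qed

section \<open>Weak solutions in \<open>W\<^sub>0\<^sup>1\<^sup>,\<^sup>2\<close>\<close>

lemma W12_norm_eq: "W12_norm \<Omega> u = sqrt ((n2 M u)\<^sup>2 + (n2 M (weak_grad \<Omega> u))\<^sup>2)"
  by (simp add: W12_norm_def n2_power2)

lemma n2_le_W12_norm: "n2 M u \<le> W12_norm \<Omega> u" "n2 M (weak_grad \<Omega> u) \<le> W12_norm \<Omega> u"
  unfolding W12_norm_eq by (simp_all add: real_le_rsqrt)

lemma L2_norm_eq: "L2_norm \<Omega> u = n2 M u"
  by (simp add: L2_norm_def n2_def)

lemma n2_weak_grad_eq:
  assumes "has_weak_grad \<Omega> u G" and "sqint M G"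
  shows "n2 M (weak_grad \<Omega> u) = n2 M G"
proof (rule n2_cong_AE)
  have ae: "AE x in M. G x = weak_grad \<Omega> u x"
    using weak_grad_AE_eq[OF assms(1)] by (rule eventually_mono) simp
  then show "weak_grad \<Omega> u \<in> borel_measurable M"
    using sqint_measurable[OF assms(2)] by (rule measurable_AE_eq[rotated])
qed (use assms weak_grad_AE_eq sqint_measurable in auto)

lemma n2_diff_commute: "n2 N (\<lambda>x. F x - G x) = n2 N (\<lambda>x. G x - F x)"
  unfolding n2_def by (simp add: norm_minus_commute)

lemma W12_0_test_approx:
  assumes "w \<in> W12_0 \<Omega>"
  obtains \<phi> where "test_approx w (weak_grad \<Omega> w) \<phi>"
proof -
  let ?W = "weak_grad \<Omega> w"
  have s: "w \<in> sobolev L2 1 \<Omega>" using assms by (simp add: W12_0_def del: One_nat_def)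
  obtain \<phi> where \<phi>: "\<And>n::nat. \<phi> n \<in> test_functions \<Omega>"
    and lim: "(\<lambda>n. W12_norm \<Omega> (\<lambda>x. w x - \<phi> n x)) \<longlonglongrightarrow> 0"
    using assms by (auto simp: W12_0_def)
  note w = sobolev_1[OF s]
  have sW: "sqint M (\<lambda>x. ?W x - grad (\<phi> n) x)" for n
    by (rule sqint_diff[OF w(3) sqint_test(2)[OF \<phi>]])
  have hw: "has_weak_grad \<Omega> (\<lambda>x. w x - \<phi> n x) (\<lambda>x. ?W x - grad (\<phi> n) x)" for n
    by (rule has_weak_grad_diff[OF w(2) has_weak_grad_smooth[OF test_smooth[OF \<phi>]]])
  have "n2 M (\<lambda>x. \<phi> n x - w x) \<le> W12_norm \<Omega> (\<lambda>x. w x - \<phi> n x)" for n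
    using n2_le_W12_norm(1)[of "\<lambda>x. w x - \<phi> n x"] by (subst n2_diff_commute)
  then have l1: "(\<lambda>n. n2 M (\<lambda>x. \<phi> n x - w x)) \<longlonglongrightarrow> 0"
    by (intro tendsto_sandwich[OF _ _ tendsto_const lim]) simp_all
  have "n2 M (\<lambda>x. grad (\<phi> n) x - ?W x) \<le> W12_norm \<Omega> (\<lambda>x. w x - \<phi> n x)" for n
    using n2_le_W12_norm(2)[of "\<lambda>x. w x - \<phi> n x"] unfolding n2_weak_grad_eq[OF hw sW]
    by (subst n2_diff_commute)
  then have l2: "(\<lambda>n. n2 M (\<lambda>x. grad (\<phi> n) x - ?W x)) \<longlonglongrightarrow> 0"
    by (intro tendsto_sandwich[OF _ _ tendsto_const lim]) simp_all
  obtain \<rho> where \<rho>: "strict_mono \<rho>" "AE x in M. (\<lambda>n. \<phi> (\<rho> n) x) \<longlonglongrightarrow> w x"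
    using n2_tendsto_AE_subseq[OF sqint_test(1)[OF \<phi>] w(1) l1] by blast
  have "(\<lambda>n. n2 M (\<lambda>x. grad (\<phi> (\<rho> n)) x - ?W x)) \<longlonglongrightarrow> 0"
    using LIMSEQ_subseq_LIMSEQ[OF l2 \<rho>(1)] by (simp add: comp_def)
  then have "test_approx w ?W (\<lambda>n. \<phi> (\<rho> n))"
    using w \<phi> \<rho>(2) by (simp add: test_approx_def)
  then show thesis by (rule that)
qed

lemma test_in_W12_0:
  assumes \<phi>: "\<phi> \<in> test_functions \<Omega>"
  shows "\<phi> \<in> W12_0 \<Omega>"
proof -
  have "has_weak_pderiv \<Omega> i \<phi> (\<lambda>x. grad \<phi> x \<bullet> i)" "(\<lambda>x. grad \<phi> x \<bullet> i) \<in> L2 \<Omega>" if "i \<in> Basis" for i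
    using has_weak_pderiv_smooth[OF test_smooth[OF \<phi>] open_\<Omega> that]
      sqint_component[OF sqint_test(2)[OF \<phi>] that] by (simp_all add: L2_iff_sqint)
  moreover have "\<phi> \<in> L2 \<Omega>" using sqint_test(1)[OF \<phi>] by (simp add: L2_iff_sqint)
  ultimately have "\<phi> \<in> sobolev L2 1 \<Omega>" by auto
  moreover have "W12_norm \<Omega> (\<lambda>x. \<phi> x - \<phi> x) = 0"
  proof -
    have z: "grad (\<lambda>x::'a. 0::real) = (\<lambda>x. 0)" by (rule ext) simp
    have "has_weak_grad \<Omega> (\<lambda>x. 0) (\<lambda>x. 0)"
      using has_weak_grad_smooth[OF smooth_const[of 0]] unfolding z .
    from n2_weak_grad_eq[OF this sqint_const]
    have "n2 M (weak_grad \<Omega> (\<lambda>x. 0)) = n2 M (\<lambda>x. 0 :: 'a)" .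
    then show ?thesis by (simp add: W12_norm_eq n2_def)
  qed
  ultimately show ?thesis using \<phi> by (auto simp: W12_0_def intro!: exI[of _ "\<lambda>n. \<phi>"])
qed

lemma weak_solution_sobolev: "weak_solution \<Omega> q F w \<Longrightarrow> w \<in> sobolev L2 1 \<Omega>"
  by (simp add: weak_solution_def W12_0_def del: One_nat_def)

lemma weak_solution_div_eq:
  assumes w: "weak_solution \<Omega> q F w" and F: "sqint M F"
    and q: "q \<in> borel_measurable M" "AE x in M. \<bar>q x\<bar> \<le> B"
  shows "div_eq (\<lambda>x. q x *\<^sub>R weak_grad \<Omega> w x) F"
proof -
  let ?W = "weak_grad \<Omega> w"
  note W = sobolev_1[OF weak_solution_sobolev[OF w]]
  have P: "sqint M (\<lambda>x. q x *\<^sub>R ?W x)" by (rule sqint_bounded_mult(1)[OF q W(3)])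
  have "(LINT x|M. (q x *\<^sub>R ?W x) \<bullet> grad \<phi> x) = (LINT x|M. F x * \<phi> x)" if \<phi>: "\<phi> \<in> test_functions \<Omega>" for \<phi>
  proof -
    have g: "AE x in M. grad \<phi> x = weak_grad \<Omega> \<phi> x"
      using weak_grad_AE_eq[OF has_weak_grad_smooth[OF test_smooth[OF \<phi>]]] by (rule eventually_mono) simp
    note gm = sqint_measurable[OF sqint_test(2)[OF \<phi>]]
    note [measurable] = gm measurable_AE_eq[OF gm g] q(1) sqint_measurable[OF W(3)]
    have "(LINT x|M. (q x *\<^sub>R ?W x) \<bullet> grad \<phi> x) = (LINT x|M. q x * (?W x \<bullet> weak_grad \<Omega> \<phi> x))"
      by (rule integral_cong_AE) (use g in \<open>auto elim!: eventually_mono\<close>)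
    also have "\<dots> = (LINT x|M. F x * \<phi> x)"
      using w test_in_W12_0[OF \<phi>] by (simp add: weak_solution_def)
    finally show ?thesis .
  qed
  then show ?thesis using P F by (simp add: div_eq_def)
qed

text \<open>The energy estimate: the equation is tested with \<open>w\<close> itself.\<close>

lemma weak_solution_energy:
  assumes w: "weak_solution \<Omega> q F w" and F: "sqint M F"
    and q: "q \<in> borel_measurable M" "AE x in M. cl \<le> q x \<and> q x \<le> cu" and cl: "0 < cl"
  shows "cl * (n2 M (weak_grad \<Omega> w))\<^sup>2 \<le> n2 M F * n2 M w"
proof -
  let ?W = "weak_grad \<Omega> w"
  note W = sobolev_1[OF weak_solution_sobolev[OF w]]
  have qB: "AE x in M. \<bar>q x\<bar> \<le> max \<bar>cl\<bar> \<bar>cu\<bar>"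
    using q(2) by (rule eventually_mono) (simp add: interval_abs_bound)
  have i: "integrable M (\<lambda>x. q x * (?W x \<bullet> ?W x))"
    using sqint_integrable_inner[OF sqint_bounded_mult(1)[OF q(1) qB W(3)] W(3)] by simp
  have "cl * (n2 M ?W)\<^sup>2 = (LINT x|M. cl * (?W x \<bullet> ?W x))"
    by (simp add: n2_power2 power2_norm_eq_inner)
  also have "\<dots> \<le> (LINT x|M. q x * (?W x \<bullet> ?W x))"
    using sqint_integrable_inner[OF W(3) W(3)] i q(2)
    by (intro integral_mono_AE) (auto elim!: eventually_mono intro: mult_right_mono)
  also have "\<dots> = (LINT x|M. F x * w x)" using w by (simp add: weak_solution_def)
  also have "\<dots> \<le> n2 M F * n2 M w" by (rule cauchy_schwarz_real[OF F W(1)])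
  finally show ?thesis .
qed

section \<open>The weighted estimate\<close>

text \<open>With \<open>r = (q - qt) / q\<close>, testing the equation of \<open>w\<close> with \<open>r\<^sup>2 w\<close> removes \<open>F\<close> from the weighted
  integral and leaves \<open>2 \<integral> (q - qt) \<nabla>w \<bullet> \<nabla>(r w)\<close>; testing both equations with \<open>r w\<close> turns this into
  the data \<open>F - Ft\<close> and \<open>\<nabla>(w - wt)\<close>.\<close>

lemma weighted_identity:
  assumes D: "div_eq (\<lambda>x. q x *\<^sub>R W x) F" and Dt: "div_eq (\<lambda>x. qt x *\<^sub>R Wt x) Ft"
    and w: "test_approx w W \<phi>" and wB: "AE x in M. \<bar>w x\<bar> \<le> B" and Wt: "sqint M Wt"
    and r: "smooth_approx lo hi r R" and rq: "AE x in M. r x * q x = q x - qt x"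
    and qt: "qt \<in> borel_measurable M" "AE x in M. \<bar>qt x\<bar> \<le> Bt" and qm: "q \<in> borel_measurable M"
  shows "integrable M (\<lambda>x. (r x)\<^sup>2 * (q x * (norm (W x))\<^sup>2 + F x * w x))"
    and "(LINT x|M. (r x)\<^sup>2 * (q x * (norm (W x))\<^sup>2 + F x * w x))
      = 2 * ((LINT x|M. (F x - Ft x) * (r x * w x))
        - (LINT x|M. (qt x *\<^sub>R (W x - Wt x)) \<bullet> (r x *\<^sub>R W x + w x *\<^sub>R R x)))"
proof -
  let ?P = "\<lambda>x. q x *\<^sub>R W x" and ?V = "\<lambda>x. r x *\<^sub>R W x + w x *\<^sub>R R x"
  have P: "sqint M ?P" "sqint M F" and Pt: "sqint M (\<lambda>x. qt x *\<^sub>R Wt x)" "sqint M Ft"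
    using D Dt by (auto simp: div_eq_def)
  have W: "sqint M w" "sqint M W" using w by (auto simp: test_approx_def)
  have rm: "r \<in> borel_measurable M" "sqint M R" using r by (auto simp: smooth_approx_def)
  let ?Br = "max \<bar>lo\<bar> \<bar>hi\<bar>"
  have rB: "AE x in M. \<bar>r x\<bar> \<le> ?Br"
    using smooth_approx_bounds[OF r] by (rule eventually_mono) (simp add: interval_abs_bound)
  have rrB: "AE x in M. \<bar>r x * r x\<bar> \<le> ?Br * ?Br"
    using rB
  proof (rule eventually_mono)
    fix x assume "\<bar>r x\<bar> \<le> ?Br"
    then show "\<bar>r x * r x\<bar> \<le> ?Br * ?Br" unfolding abs_mult by (intro mult_mono) simp_all
  qed
  note r2 = smooth_approx_mult[OF r r]
  note V = div_eq_mult[OF D r w wB] and Vt = div_eq_mult(2)[OF Dt r w wB] and V2 = div_eq_mult[OF D r2 w wB]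
  have rrm: "(\<lambda>x. r x * r x) \<in> borel_measurable M" using rm by simp
  have rrW: "sqint M (\<lambda>x. (r x * r x) *\<^sub>R W x)" by (rule sqint_bounded_mult(1)[OF rrm rrB W(2)])
  have rrw: "sqint M (\<lambda>x. (r x * r x) * w x)" using sqint_bounded_mult(1)[OF rrm rrB W(1)] by simp
  have rw: "sqint M (\<lambda>x. r x * w x)" using sqint_bounded_mult(1)[OF rm(1) rB W(1)] by simp
  have rP: "sqint M (\<lambda>x. r x *\<^sub>R ?P x)" by (rule sqint_bounded_mult(1)[OF rm(1) rB P(1)])
  have qtW: "sqint M (\<lambda>x. qt x *\<^sub>R W x)" by (rule sqint_bounded_mult(1)[OF qt W(2)])
  have split: "(r x)\<^sup>2 * (q x * (norm (W x))\<^sup>2 + F x * w x)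
      = ?P x \<bullet> ((r x * r x) *\<^sub>R W x) + F x * ((r x * r x) * w x)" for x
    unfolding power2_norm_eq_inner by (simp add: power2_eq_square algebra_simps)
  have i1: "integrable M (\<lambda>x. ?P x \<bullet> ((r x * r x) *\<^sub>R W x))"
    by (rule sqint_integrable_inner[OF P(1) rrW])
  have i2: "integrable M (\<lambda>x. F x * ((r x * r x) * w x))"
    by (rule sqint_integrable_mult[OF P(2) rrw])
  show "integrable M (\<lambda>x. (r x)\<^sup>2 * (q x * (norm (W x))\<^sup>2 + F x * w x))"
    unfolding split using i1 i2 by simp
  have i3: "integrable M (\<lambda>x. ?P x \<bullet> ((r x * r x) *\<^sub>R W x + w x *\<^sub>R (r x *\<^sub>R R x + r x *\<^sub>R R x)))"
    by (rule sqint_integrable_inner[OF P(1) V2(1)])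
  have "(LINT x|M. (r x)\<^sup>2 * (q x * (norm (W x))\<^sup>2 + F x * w x))
    = (LINT x|M. ?P x \<bullet> ((r x * r x) *\<^sub>R W x))
      + (LINT x|M. ?P x \<bullet> ((r x * r x) *\<^sub>R W x + w x *\<^sub>R (r x *\<^sub>R R x + r x *\<^sub>R R x)))"
    unfolding split V2(2) using i1 i2 by simp
  also have "\<dots> = (LINT x|M. ?P x \<bullet> ((r x * r x) *\<^sub>R W x)
      + ?P x \<bullet> ((r x * r x) *\<^sub>R W x + w x *\<^sub>R (r x *\<^sub>R R x + r x *\<^sub>R R x)))"
    using i1 i3 by simp
  also have "\<dots> = (LINT x|M. 2 * ((r x *\<^sub>R ?P x) \<bullet> ?V x))"
    by (intro Bochner_Integration.integral_cong refl) (simp add: inner_add_right algebra_simps)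
  also have "\<dots> = 2 * (LINT x|M. (r x *\<^sub>R ?P x) \<bullet> ?V x)" by simp
  also have "(LINT x|M. (r x *\<^sub>R ?P x) \<bullet> ?V x) = (LINT x|M. (?P x - qt x *\<^sub>R W x) \<bullet> ?V x)"
  proof (rule integral_cong_AE)
    show "AE x in M. (r x *\<^sub>R ?P x) \<bullet> ?V x = (?P x - qt x *\<^sub>R W x) \<bullet> ?V x"
      using rq by (rule eventually_mono) (simp add: scaleR_diff_left[symmetric])
    show "(\<lambda>x. (r x *\<^sub>R ?P x) \<bullet> ?V x) \<in> borel_measurable M"
      by (rule borel_measurable_integrable[OF sqint_integrable_inner[OF rP V(1)]])
    show "(\<lambda>x. (?P x - qt x *\<^sub>R W x) \<bullet> ?V x) \<in> borel_measurable M"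
      by (rule borel_measurable_integrable[OF sqint_integrable_inner[OF sqint_diff[OF P(1) qtW] V(1)]])
  qed
  also have "\<dots> = (LINT x|M. ?P x \<bullet> ?V x) - (LINT x|M. (qt x *\<^sub>R W x) \<bullet> ?V x)"
    unfolding inner_diff_left
    using sqint_integrable_inner[OF P(1) V(1)] sqint_integrable_inner[OF qtW V(1)] by simp
  also have "(LINT x|M. (qt x *\<^sub>R W x) \<bullet> ?V x)
      = (LINT x|M. (qt x *\<^sub>R Wt x) \<bullet> ?V x) + (LINT x|M. (qt x *\<^sub>R (W x - Wt x)) \<bullet> ?V x)"
    unfolding scaleR_diff_right inner_diff_left
    using sqint_integrable_inner[OF Pt(1) V(1)] sqint_integrable_inner[OF qtW V(1)] by simp
  finally show "(LINT x|M. (r x)\<^sup>2 * (q x * (norm (W x))\<^sup>2 + F x * w x))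
      = 2 * ((LINT x|M. (F x - Ft x) * (r x * w x)) - (LINT x|M. (qt x *\<^sub>R (W x - Wt x)) \<bullet> ?V x))"
    unfolding V(2) Vt left_diff_distrib
    using sqint_integrable_mult[OF P(2) rw] sqint_integrable_mult[OF Pt(2) rw] by simp
qed

lemma Linf_iff: "u \<in> Linf \<Omega> \<longleftrightarrow> u \<in> borel_measurable M \<and> (\<exists>B. AE x in M. \<bar>u x\<bar> \<le> B)"
  by (simp add: Linf_def)

text \<open>The constant combines the bound for \<open>w\<close>, the energy estimate for \<open>\<nabla>w\<close>, and \<open>C\<close>, which bounds the
  gradients of \<open>q\<close> and \<open>qt\<close> in \<open>\<nabla>r = -\<nabla>qt / q + qt \<nabla>q / q\<^sup>2\<close>; none of these depends on \<open>qt\<close>, \<open>Ft\<close> or the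
  solutions.\<close>

lemma weighted_estimate:
  assumes cl: "0 < cl" and "cl \<le> cu"
    and F: "F \<in> Linf \<Omega>" and q: "q \<in> admissible \<Omega> cl cu"
    and q1: "q \<in> sobolev Linf 1 \<Omega>" and qC: "W12_norm \<Omega> q \<le> C"
  shows "\<exists>c>0. \<forall>qt Ft w wt. Ft \<in> Linf \<Omega> \<and> qt \<in> admissible \<Omega> cl cu \<and> W12_norm \<Omega> qt \<le> C \<and>
      weak_solution \<Omega> q F w \<and> weak_solution \<Omega> qt Ft wt \<longrightarrow>
      integrable M (\<lambda>x. (q x - qt x)\<^sup>2 / (q x)\<^sup>2 * (q x * (norm (weak_grad \<Omega> w x))\<^sup>2 + F x * w x)) \<and>
      (LINT x|M. (q x - qt x)\<^sup>2 / (q x)\<^sup>2 * (q x * (norm (weak_grad \<Omega> w x))\<^sup>2 + F x * w x))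
        \<le> c * (W12_norm \<Omega> (\<lambda>x. w x - wt x) + L2_norm \<Omega> (\<lambda>x. F x - Ft x))"
proof -
  have adm: "u \<in> sobolev L2 1 \<Omega>" "u \<in> borel_measurable M" "AE x in M. cl \<le> u x \<and> u x \<le> cu"
      "AE x in M. \<bar>u x\<bar> \<le> cu"
    if u: "u \<in> admissible \<Omega> cl cu" for u
  proof -
    show s: "u \<in> sobolev L2 1 \<Omega>" and b: "AE x in M. cl \<le> u x \<and> u x \<le> cu"
      using u by (auto simp: admissible_def simp del: One_nat_def)
    show "u \<in> borel_measurable M" by (rule sqint_measurable[OF sobolev_1(1)[OF s]])
    show "AE x in M. \<bar>u x\<bar> \<le> cu" using b by (rule eventually_mono) (use cl in auto)
  qed
  note qa = adm[OF q]
  obtain N where Fm: "F \<in> borel_measurable M" and N: "AE x in M. \<bar>F x\<bar> \<le> N"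
    using F by (auto simp: Linf_iff)
  have Fs: "sqint M F" by (rule sqint_bounded[OF Fm N])
  obtain b :: 'a where b: "b \<in> Basis" using nonempty_Basis by blast
  have "\<exists>g\<in>Linf \<Omega>. has_weak_pderiv \<Omega> b q g" using q1 b by simp
  then obtain g where gl: "g \<in> Linf \<Omega>" and g1: "has_weak_pderiv \<Omega> b q g" by blast
  then obtain G where g: "has_weak_pderiv \<Omega> b q g" "g \<in> borel_measurable M" "AE x in M. \<bar>g x\<bar> \<le> G"
    by (auto simp: Linf_iff)
  obtain B where B: "B \<ge> 0"
    and wB: "\<And>w W \<phi>. test_approx w W \<phi> \<Longrightarrow> div_eq (\<lambda>x. q x *\<^sub>R W x) F \<Longrightarrow> AE x in M. \<bar>w x\<bar> \<le> B"
    using weak_solution_bounded[OF qa(2,3) cl b g N] by blast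
  define p where "p = max (abs cl) (abs cu) * max (abs (inverse cu)) (abs (inverse cl))"
  define Br where "Br = max (abs (1 - p)) (abs (1 - - p))"
  define i2 where "i2 = (inverse cl)\<^sup>2"
  let ?Q = "weak_grad \<Omega> q"
  define KR where "KR = cu * (i2 * C) + inverse cl * C"
  define KW where "KW = sqrt (n2 M F * n2 M (\<lambda>x. B) / cl)"
  define KV where "KV = Br * KW + B * KR"
  define c where "c = 2 * (Br * n2 M (\<lambda>x. B) + cu * KV) + 1"
  have C: "C \<ge> 0" by (rule order_trans[OF n2_nonneg order_trans[OF n2_le_W12_norm(1) qC]])
  have cu: "cu > 0" using cl \<open>cl \<le> cu\<close> by simp
  have Br: "Br \<ge> 0" by (simp add: Br_def)
  have KR: "KR \<ge> 0" using C cl cu by (simp add: KR_def i2_def)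
  have KW: "KW \<ge> 0" using cl by (simp add: KW_def)
  have KV: "KV \<ge> 0" using Br KW B KR by (simp add: KV_def)
  have cpos: "c > 0" using Br KV cu by (simp add: c_def add_nonneg_pos)
  show ?thesis
  proof (intro exI[of _ c] conjI[OF cpos] allI impI; (elim conjE)?)
    fix qt Ft w wt
    assume Ft: "Ft \<in> Linf \<Omega>" and qt: "qt \<in> admissible \<Omega> cl cu" and qtC: "W12_norm \<Omega> qt \<le> C"
      and w: "weak_solution \<Omega> q F w" and wt: "weak_solution \<Omega> qt Ft wt"
    let ?W = "weak_grad \<Omega> w" and ?Wt = "weak_grad \<Omega> wt" and ?Qt = "weak_grad \<Omega> qt"
    note qta = adm[OF qt]
    note Q = sobolev_1[OF qa(1)] and Qt = sobolev_1[OF qta(1)]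
    note W = sobolev_1[OF weak_solution_sobolev[OF w]] and Wt = sobolev_1[OF weak_solution_sobolev[OF wt]]
    have Fts: "sqint M Ft" using Ft sqint_bounded by (auto simp: Linf_iff)
    have D: "div_eq (\<lambda>x. q x *\<^sub>R ?W x) F" by (rule weak_solution_div_eq[OF w Fs qa(2,4)])
    have Dt: "div_eq (\<lambda>x. qt x *\<^sub>R ?Wt x) Ft" by (rule weak_solution_div_eq[OF wt Fts qta(2,4)])
    have "w \<in> W12_0 \<Omega>" using w by (simp add: weak_solution_def)
    then obtain \<phi> where ap: "test_approx w ?W \<phi>" by (rule W12_0_test_approx)
    have wb: "AE x in M. \<bar>w x\<bar> \<le> B" by (rule wB[OF ap D])
    define r where "r x = 1 - qt x * inverse (q x)" for x
    define R where "R x = - (qt x *\<^sub>R (- (inverse (q x))\<^sup>2 *\<^sub>R ?Q x) + inverse (q x) *\<^sub>R ?Qt x)" for x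
    have sr: "smooth_approx (1 - p) (1 - - p) r R"
      unfolding r_def R_def p_def
      by (rule smooth_approx_one_minus[OF smooth_approx_mult[OF smooth_approx_sobolev[OF qta(1,3) \<open>cl \<le> cu\<close>]
            smooth_approx_inverse[OF smooth_approx_sobolev[OF qa(1,3) \<open>cl \<le> cu\<close>] cl]]])
    have rm: "r \<in> borel_measurable M" using sr by (simp add: smooth_approx_def)
    have rB: "AE x in M. \<bar>r x\<bar> \<le> Br"
      using smooth_approx_bounds[OF sr] unfolding Br_def
      by (rule eventually_mono) (elim conjE, rule interval_abs_bound)
    have rq: "AE x in M. r x * q x = q x - qt x"
      using qa(3) by (rule eventually_mono) (use cl in \<open>simp add: r_def field_simps\<close>)
    have inv: "AE x in M. \<bar>inverse (q x)\<bar> \<le> inverse cl"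
      using qa(3)
    proof (rule eventually_mono)
      fix x assume "cl \<le> q x \<and> q x \<le> cu"
      then show "\<bar>inverse (q x)\<bar> \<le> inverse cl"
        using cl le_imp_inverse_le[of cl "q x"] by simp
    qed
    have inv2: "AE x in M. \<bar>- (inverse (q x))\<^sup>2\<bar> \<le> i2"
      using inv
    proof (rule eventually_mono)
      fix x assume "\<bar>inverse (q x)\<bar> \<le> inverse cl"
      then have "\<bar>inverse (q x)\<bar>\<^sup>2 \<le> i2" unfolding i2_def by (intro power_mono) auto
      then show "\<bar>- (inverse (q x))\<^sup>2\<bar> \<le> i2"
        by (simp only: abs_minus_cancel abs_power2 power2_abs)
    qed
    have im: "(\<lambda>x. inverse (q x)) \<in> borel_measurable M" "(\<lambda>x. - (inverse (q x))\<^sup>2) \<in> borel_measurable M"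
      using qa(2) by simp_all
    note m1 = sqint_bounded_mult[OF im(2) inv2 Q(3)]
    note m2 = sqint_bounded_mult[OF qta(2,4) m1(1)]
    note m3 = sqint_bounded_mult[OF im(1) inv Qt(3)]
    have nR: "n2 M R \<le> KR"
    proof -
      have i2: "i2 \<ge> 0" by (simp add: i2_def)
      have QC: "n2 M ?Q \<le> C" "n2 M ?Qt \<le> C"
        using order_trans[OF n2_le_W12_norm(2) qC] order_trans[OF n2_le_W12_norm(2) qtC] by auto
      have "n2 M R = n2 M (\<lambda>x. qt x *\<^sub>R (- (inverse (q x))\<^sup>2 *\<^sub>R ?Q x) + inverse (q x) *\<^sub>R ?Qt x)"
        unfolding R_def n2_def norm_minus_cancel ..
      also have "\<dots> \<le> n2 M (\<lambda>x. qt x *\<^sub>R (- (inverse (q x))\<^sup>2 *\<^sub>R ?Q x)) + n2 M (\<lambda>x. inverse (q x) *\<^sub>R ?Qt x)"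
        by (rule n2_triangle[OF m2(1) m3(1)])
      also have "\<dots> \<le> \<bar>cu\<bar> * (\<bar>i2\<bar> * n2 M ?Q) + \<bar>inverse cl\<bar> * n2 M ?Qt"
        by (intro add_mono m3(2) order_trans[OF m2(2)] mult_left_mono m1(2)) simp
      also have "\<dots> \<le> KR"
        unfolding KR_def using cl cu i2 QC by (intro add_mono) (auto intro!: mult_left_mono)
      finally show ?thesis .
    qed
    have nw: "n2 M w \<le> n2 M (\<lambda>x. B)"
      by (rule sqint_bound(2)[OF sqint_const sqint_measurable[OF W(1)]])
         (use wb in \<open>auto elim!: eventually_mono\<close>)
    have nW: "n2 M ?W \<le> KW"
    proof -
      have "cl * (n2 M ?W)\<^sup>2 \<le> n2 M F * n2 M (\<lambda>x. B)"
        using weak_solution_energy[OF w Fs qa(2,3) cl] mult_left_mono[OF nw n2_nonneg[of M F]] by linarith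
      then have "(n2 M ?W)\<^sup>2 \<le> n2 M F * n2 M (\<lambda>x. B) / cl" using cl by (simp add: field_simps)
      then show ?thesis unfolding KW_def by (rule real_le_rsqrt)
    qed
    have Rs: "sqint M R" using sr by (simp add: smooth_approx_def)
    note v1 = sqint_bounded_mult[OF rm rB W(3)] and v2 = sqint_bounded_mult[OF sqint_measurable[OF W(1)] wb Rs]
    let ?V = "\<lambda>x. r x *\<^sub>R ?W x + w x *\<^sub>R R x"
    have nV: "n2 M ?V \<le> KV"
    proof -
      have "n2 M ?V \<le> n2 M (\<lambda>x. r x *\<^sub>R ?W x) + n2 M (\<lambda>x. w x *\<^sub>R R x)" by (rule n2_triangle[OF v1(1) v2(1)])
      also have "\<dots> \<le> \<bar>Br\<bar> * n2 M ?W + \<bar>B\<bar> * n2 M R" by (rule add_mono[OF v1(2) v2(2)])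
      also have "\<dots> \<le> KV"
        unfolding KV_def using Br B nW nR by (intro add_mono) (auto intro!: mult_left_mono)
      finally show ?thesis .
    qed
    have nrw: "sqint M (\<lambda>x. r x * w x)" "n2 M (\<lambda>x. r x * w x) \<le> Br * n2 M (\<lambda>x. B)"
      using sqint_bounded_mult[OF rm rB W(1)] Br mult_left_mono[OF nw Br] by simp_all
    have dW: "sqint M (\<lambda>x. ?W x - ?Wt x)" by (rule sqint_diff[OF W(3) Wt(3)])
    note d = sqint_bounded_mult[OF qta(2,4) dW]
    define \<delta> where "\<delta> = W12_norm \<Omega> (\<lambda>x. w x - wt x) + L2_norm \<Omega> (\<lambda>x. F x - Ft x)"
    have ndW: "n2 M (\<lambda>x. ?W x - ?Wt x) \<le> W12_norm \<Omega> (\<lambda>x. w x - wt x)"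
      using n2_le_W12_norm(2)[of "\<lambda>x. w x - wt x"]
      unfolding n2_weak_grad_eq[OF has_weak_grad_diff[OF W(2) Wt(2)] dW] .
    have W0: "W12_norm \<Omega> (\<lambda>x. w x - wt x) \<ge> 0"
      by (rule order_trans[OF n2_nonneg n2_le_W12_norm(1)])
    have \<delta>1: "n2 M (\<lambda>x. F x - Ft x) \<le> \<delta>" and \<delta>2: "n2 M (\<lambda>x. ?W x - ?Wt x) \<le> \<delta>"
      and \<delta>0: "\<delta> \<ge> 0"
      unfolding \<delta>_def L2_norm_eq using ndW W0 by (simp_all add: add_increasing2)
    note id = weighted_identity[OF D Dt ap wb Wt(3) sr rq qta(2,4) qa(2)]
    have "(LINT x|M. (r x)\<^sup>2 * (q x * (norm (?W x))\<^sup>2 + F x * w x))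
      = 2 * ((LINT x|M. (F x - Ft x) * (r x * w x)) - (LINT x|M. (qt x *\<^sub>R (?W x - ?Wt x)) \<bullet> ?V x))"
      by (rule id(2))
    also have "\<dots> \<le> 2 * (n2 M (\<lambda>x. F x - Ft x) * n2 M (\<lambda>x. r x * w x)
        + n2 M (\<lambda>x. qt x *\<^sub>R (?W x - ?Wt x)) * n2 M ?V)"
      using cauchy_schwarz_real[OF sqint_diff[OF Fs Fts] nrw(1)]
        cauchy_schwarz[OF d(1) sqint_add[OF v1(1) v2(1)]] by (simp add: abs_le_iff)
    also have "\<dots> \<le> 2 * (\<delta> * (Br * n2 M (\<lambda>x. B)) + (cu * \<delta>) * KV)"
    proof -
      have "n2 M (\<lambda>x. qt x *\<^sub>R (?W x - ?Wt x)) \<le> cu * \<delta>"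
        using order_trans[OF d(2) mult_left_mono[OF \<delta>2 abs_ge_zero]] cu by simp
      then show ?thesis
        using \<delta>1 nrw(2) nV \<delta>0 cu by (intro mult_left_mono add_mono mult_mono) auto
    qed
    also have "\<dots> = (c - 1) * \<delta>" by (simp add: c_def algebra_simps)
    also have "\<dots> \<le> c * \<delta>" using \<delta>0 by (intro mult_right_mono) auto
    finally have est: "(LINT x|M. (r x)\<^sup>2 * (q x * (norm (?W x))\<^sup>2 + F x * w x)) \<le> c * \<delta>" .
    have ae: "AE x in M. (r x)\<^sup>2 * (q x * (norm (?W x))\<^sup>2 + F x * w x)
        = (q x - qt x)\<^sup>2 / (q x)\<^sup>2 * (q x * (norm (?W x))\<^sup>2 + F x * w x)"
      using qa(3)
    proof (rule eventually_mono)
      fix x assume "cl \<le> q x \<and> q x \<le> cu"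
      then have "q x \<noteq> 0" using cl by auto
      then have "r x = (q x - qt x) / q x" by (simp add: r_def field_simps)
      then show "(r x)\<^sup>2 * (q x * (norm (?W x))\<^sup>2 + F x * w x)
        = (q x - qt x)\<^sup>2 / (q x)\<^sup>2 * (q x * (norm (?W x))\<^sup>2 + F x * w x)"
        by (simp add: power_divide)
    qed
    note [measurable] = qa(2) qta(2) Fm sqint_measurable[OF W(1)] sqint_measurable[OF W(3)] rm
    have m: "(\<lambda>x. (q x - qt x)\<^sup>2 / (q x)\<^sup>2 * (q x * (norm (?W x))\<^sup>2 + F x * w x)) \<in> borel_measurable M"
      by measurable
    have "integrable M (\<lambda>x. (q x - qt x)\<^sup>2 / (q x)\<^sup>2 * (q x * (norm (?W x))\<^sup>2 + F x * w x))"
      by (rule integrable_cong_AE_imp[OF id(1) m]) (use ae in \<open>auto elim!: eventually_mono\<close>)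
    moreover have "(LINT x|M. (q x - qt x)\<^sup>2 / (q x)\<^sup>2 * (q x * (norm (?W x))\<^sup>2 + F x * w x))
      = (LINT x|M. (r x)\<^sup>2 * (q x * (norm (?W x))\<^sup>2 + F x * w x))"
      by (rule integral_cong_AE[OF m borel_measurable_integrable[OF id(1)]]) (use ae in \<open>auto elim!: eventually_mono\<close>)
    ultimately show "integrable M (\<lambda>x. (q x - qt x)\<^sup>2 / (q x)\<^sup>2 * (q x * (norm (?W x))\<^sup>2 + F x * w x)) \<and>
      (LINT x|M. (q x - qt x)\<^sup>2 / (q x)\<^sup>2 * (q x * (norm (?W x))\<^sup>2 + F x * w x))
        \<le> c * (W12_norm \<Omega> (\<lambda>x. w x - wt x) + L2_norm \<Omega> (\<lambda>x. F x - Ft x))"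
      using est by (simp add: \<delta>_def)
  qed
qed

end

section \<open>Boundary strips of convex domains\<close>

lemma emeasure_lborel_homothety:
  fixes A :: "'a::euclidean_space set"
  assumes "k > 0" and A: "A \<in> sets borel" and m: "(\<lambda>x. t + k *\<^sub>R x) ` A \<in> sets borel"
  shows "emeasure lborel ((\<lambda>x. t + k *\<^sub>R x) ` A) = ennreal (k ^ DIM('a)) * emeasure lborel A"
proof -
  let ?T = "\<lambda>x. t + k *\<^sub>R x"
  have T: "?T \<in> borel \<rightarrow>\<^sub>M borel" by simp
  have vi: "?T -` (?T ` A) = A" using assms(1) by (intro inj_vimage_image_eq) (simp add: inj_on_def)
  have "emeasure lborel (?T ` A) = emeasure (density (distr lborel borel ?T) (\<lambda>_. ennreal (\<bar>k\<bar> ^ DIM('a)))) (?T ` A)"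
    using lborel_affine[of k t] assms(1) by simp
  also have "\<dots> = ennreal (\<bar>k\<bar> ^ DIM('a)) * emeasure (distr lborel borel ?T) (?T ` A)"
    using m by (intro emeasure_density_const) simp
  also have "emeasure (distr lborel borel ?T) (?T ` A) = emeasure lborel A"
    using m T vi by (subst emeasure_distr) simp_all
  finally show ?thesis using assms(1) by simp
qed

text \<open>Shrinking a convex domain by the factor \<open>1 - \<rho> / R\<close> towards the centre of a ball of radius \<open>R\<close>
  contained in it moves its points to distance at least \<open>\<rho>\<close> from the boundary. By Bernoulli's
  inequality only a fraction \<open>d \<rho> / R\<close> of the volume is left uncovered.\<close>

lemma convex_boundary_strip:
  fixes \<Omega> :: "'a::euclidean_space set"
  assumes "open \<Omega>" and "convex \<Omega>" and "bounded \<Omega>" and "\<Omega> \<noteq> {}"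
  shows "\<exists>c\<ge>0. \<forall>\<rho>>0. measure lebesgue {x \<in> \<Omega>. infdist x (frontier \<Omega>) < \<rho>} \<le> c * \<rho>"
proof -
  obtain a where "a \<in> \<Omega>" using assms(4) by blast
  then obtain R where R: "R > 0" "ball a R \<subseteq> \<Omega>" using assms(1) by (auto simp: open_contains_ball)
  let ?m = "measure lebesgue \<Omega>"
  have lm: "\<Omega> \<in> lmeasurable" by (rule lmeasurable_open[OF assms(3,1)])
  have "\<Omega> \<noteq> UNIV" using assms(3) by auto
  then have fr: "frontier \<Omega> \<noteq> {}" "closed (frontier \<Omega>)"
    using assms(4) by (auto simp: frontier_eq_empty)
  have strip_sets: "{x \<in> \<Omega>. infdist x (frontier \<Omega>) < \<rho>} \<in> sets lebesgue" for \<rho>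
  proof -
    have "open {x. infdist x (frontier \<Omega>) < \<rho>}"
      by (intro open_Collect_less continuous_on_infdist continuous_on_id continuous_on_const)
    then have "open (\<Omega> \<inter> {x. infdist x (frontier \<Omega>) < \<rho>})" by (rule open_Int[OF assms(1)])
    moreover have "{x \<in> \<Omega>. infdist x (frontier \<Omega>) < \<rho>} = \<Omega> \<inter> {x. infdist x (frontier \<Omega>) < \<rho>}" by blast
    ultimately show ?thesis by simp
  qed
  have strip: "measure lebesgue {x \<in> \<Omega>. infdist x (frontier \<Omega>) < \<rho>} \<le> ?m * real DIM('a) * (\<rho> / R)"
    if \<rho>: "0 < \<rho>" "\<rho> < R" for \<rho>
  proof -
    define t where "t = \<rho> / R"
    have t: "0 < t" "t < 1" "t * R = \<rho>" using \<rho> R(1) by (auto simp: t_def)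
    let ?T = "\<lambda>z. t *\<^sub>R a + (1 - t) *\<^sub>R z"
    let ?S = "?T ` \<Omega>"
    have far: "\<rho> \<le> infdist x (frontier \<Omega>)" if x: "x \<in> ?S" for x
    proof -
      obtain z where z: "z \<in> \<Omega>" "x = ?T z" using x by blast
      obtain y where y: "y \<in> frontier \<Omega>" "infdist x (frontier \<Omega>) = dist x y"
        using infdist_attains_inf[OF fr(2,1)] .
      have "y \<notin> \<Omega>" using y(1) assms(1) by (simp add: frontier_def interior_open)
      have "\<rho> \<le> dist x y"
      proof (rule ccontr)
        assume "\<not> \<rho> \<le> dist x y"
        then have n: "norm (y - x) < t * R" using t(3) by (simp add: dist_norm norm_minus_commute)
        define u where "u = a + (1 / t) *\<^sub>R (y - x)"
        have "norm (u - a) = norm (y - x) / t"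
          using t(1) unfolding u_def add_diff_cancel_left' norm_scaleR by simp
        then have "norm (u - a) < R" using n t(1) by (simp add: pos_divide_less_eq mult.commute)
        then have "u \<in> \<Omega>" using R(2) by (auto simp: dist_norm norm_minus_commute)
        then have "t *\<^sub>R u + (1 - t) *\<^sub>R z \<in> \<Omega>"
          using convexD[OF assms(2) _ z(1), of u t "1 - t"] t by simp
        moreover have "t *\<^sub>R u + (1 - t) *\<^sub>R z = y"
          using t(1) by (simp add: u_def z(2) scaleR_add_right)
        ultimately show False using \<open>y \<notin> \<Omega>\<close> by simp
      qed
      then show ?thesis using y(2) by simp
    qed
    have sub: "?S \<subseteq> \<Omega>"
    proof
      fix x assume "x \<in> ?S"
      then obtain z where "z \<in> \<Omega>" "x = ?T z" by blast
      then show "x \<in> \<Omega>" using convexD[OF assms(2) \<open>a \<in> \<Omega>\<close>, of z t "1 - t"] t by simp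
    qed
    have oS: "open ?S"
    proof -
      have "open ((\<lambda>x. t *\<^sub>R a + x) ` (\<lambda>x. (1 - t) *\<^sub>R x) ` \<Omega>)"
        using t(2) assms(1) by (intro open_translation open_scaling) auto
      then show ?thesis by (simp add: image_image)
    qed
    have Sl: "?S \<in> lmeasurable" by (rule lmeasurable_open[OF bounded_subset[OF assms(3) sub] oS])
    have "emeasure lborel ?S = ennreal ((1 - t) ^ DIM('a)) * emeasure lborel \<Omega>"
      using t assms(1) oS by (intro emeasure_lborel_homothety) auto
    then have mS: "measure lebesgue ?S = (1 - t) ^ DIM('a) * ?m"
      using t assms(1) oS by (simp add: measure_def enn2real_mult)
    have "measure lebesgue {x \<in> \<Omega>. infdist x (frontier \<Omega>) < \<rho>} \<le> measure lebesgue (\<Omega> - ?S)"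
    proof (rule measure_mono_fmeasurable)
      show "{x \<in> \<Omega>. infdist x (frontier \<Omega>) < \<rho>} \<subseteq> \<Omega> - ?S"
        using far by (auto simp: not_le[symmetric])
      show "{x \<in> \<Omega>. infdist x (frontier \<Omega>) < \<rho>} \<in> sets lebesgue" by (rule strip_sets)
      show "\<Omega> - ?S \<in> lmeasurable" by (rule fmeasurable_Diff[OF lm fmeasurableD[OF Sl]])
    qed
    also have "\<dots> = ?m - (1 - t) ^ DIM('a) * ?m"
      using measurable_measure_Diff[OF lm fmeasurableD[OF Sl] sub] mS by simp
    also have "\<dots> = (1 - (1 - t) ^ DIM('a)) * ?m" by (simp add: algebra_simps)
    also have "\<dots> \<le> (real DIM('a) * t) * ?m"
      using Bernoulli_inequality[of "- t" "DIM('a)"] t by (intro mult_right_mono) auto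
    finally show ?thesis by (simp add: t_def mult_ac)
  qed
  define c where "c = ?m * (real DIM('a) + 1) / R"
  have "measure lebesgue {x \<in> \<Omega>. infdist x (frontier \<Omega>) < \<rho>} \<le> c * \<rho>" if "\<rho> > 0" for \<rho>
  proof (cases "\<rho> < R")
    case True
    have "?m * real DIM('a) * (\<rho> / R) \<le> ?m * (real DIM('a) + 1) * (\<rho> / R)"
      using that R(1) by (intro mult_right_mono mult_left_mono) auto
    then show ?thesis using strip[OF that True] by (simp add: c_def)
  next
    case False
    have "measure lebesgue {x \<in> \<Omega>. infdist x (frontier \<Omega>) < \<rho>} \<le> ?m"
      by (rule measure_mono_fmeasurable[OF _ strip_sets lm]) blast
    also have "?m = ?m * 1 * 1" by simp
    also have "\<dots> \<le> ?m * (real DIM('a) + 1) * (\<rho> / R)"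
      using False R(1) by (intro mult_mono) auto
    finally show ?thesis by (simp add: c_def)
  qed
  moreover have "c \<ge> 0" using R(1) by (simp add: c_def)
  ultimately show ?thesis by (intro exI[of _ c]) simp
qed

section \<open>From the weighted estimate to the \<open>L\<^sup>2\<close> estimate\<close>

text \<open>Points at distance at least \<open>\<rho>\<close> from the boundary are controlled by the weighted estimate,
  the others by the volume of the strip.\<close>

lemma (in bounded_open) unweighted_estimate:
  assumes e: "AE x in M. 0 \<le> e x \<and> e x \<le> cu\<^sup>2" "e \<in> borel_measurable M"
    and q: "AE x in M. 0 < q x \<and> q x \<le> cu"
    and G: "AE x in M. G x \<ge> c0 * infdist x (frontier \<Omega>) powr \<beta>" and c0: "0 < c0" and \<beta>: "0 \<le> \<beta>"
    and i: "integrable M (\<lambda>x. e x / (q x)\<^sup>2 * G x)"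
    and est: "(LINT x|M. e x / (q x)\<^sup>2 * G x) \<le> d"
    and strip: "measure lebesgue {x \<in> \<Omega>. infdist x (frontier \<Omega>) < \<rho>} \<le> cs * \<rho>"
    and \<rho>: "\<rho> > 0"
  shows "(LINT x|M. e x) \<le> cu\<^sup>2 / c0 * \<rho> powr - \<beta> * d + cu\<^sup>2 * (cs * \<rho>)"
proof -
  let ?D = "\<lambda>x. infdist x (frontier \<Omega>)"
  let ?S = "{x \<in> \<Omega>. ?D x < \<rho>}"
  let ?k = "cu\<^sup>2 / c0 * \<rho> powr - \<beta>"
  have S: "?S \<in> sets lebesgue"
  proof -
    have "open {x. ?D x < \<rho>}"
      by (intro open_Collect_less continuous_on_infdist continuous_on_id continuous_on_const)
    then have "open (\<Omega> \<inter> {x. ?D x < \<rho>})" by (rule open_Int[OF open_\<Omega>])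
    moreover have "?S = \<Omega> \<inter> {x. ?D x < \<rho>}" by blast
    ultimately show ?thesis by simp
  qed
  have Sm: "(indicator ?S :: 'a \<Rightarrow> real) \<in> borel_measurable M"
    using S by (intro measurable_restrict_space1 borel_measurable_indicator)
  have iS: "integrable M (indicator ?S :: 'a \<Rightarrow> real)"
    by (rule sqint_integrable[OF sqint_bounded[OF Sm, of 1]]) (simp add: indicator_def)
  have ie: "integrable M e"
    by (rule sqint_integrable[OF sqint_bounded[OF e(2), of "cu\<^sup>2"]])
       (rule eventually_mono[OF e(1)], simp)
  have mS: "(LINT x|M. indicator ?S x) = measure lebesgue ?S"
  proof -
    have "?S \<inter> \<Omega> = ?S" by blast
    moreover have "measure M ?S = measure lebesgue ?S" by (rule measure_restrict_space) auto
    ultimately show ?thesis by simp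
  qed
  have "AE x in M. x \<in> \<Omega>" by (rule AE_I2) simp
  then have "AE x in M. e x \<le> ?k * (e x / (q x)\<^sup>2 * G x) + cu\<^sup>2 * indicator ?S x"
    using e(1) q G
  proof eventually_elim
    case (elim x)
    have k: "?k \<ge> 0" using c0 by simp
    have G0: "G x \<ge> 0" using elim(4) c0 by (meson dual_order.trans less_imp_le mult_nonneg_nonneg powr_ge_zero)
    have nn: "0 \<le> e x / (q x)\<^sup>2 * G x" using elim(2) G0 by (intro mult_nonneg_nonneg divide_nonneg_nonneg) auto
    show ?case
    proof (cases "?D x < \<rho>")
      case True
      have "0 \<le> ?k * (e x / (q x)\<^sup>2 * G x)" by (rule mult_nonneg_nonneg[OF k nn])
      then show ?thesis using elim(1,2) True by (simp add: indicator_def)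
    next
      case False
      have "c0 * \<rho> powr \<beta> \<le> c0 * ?D x powr \<beta>"
        using False \<rho> \<beta> c0 by (intro mult_left_mono powr_mono2) auto
      then have Gl: "c0 * \<rho> powr \<beta> \<le> G x" using elim(4) by linarith
      have q2: "0 < (q x)\<^sup>2" "(q x)\<^sup>2 \<le> cu\<^sup>2" using elim(3) by (auto intro!: power_mono)
      then have "e x / cu\<^sup>2 \<le> e x / (q x)\<^sup>2"
        using elim(2) by (intro divide_left_mono mult_pos_pos) auto
      then have le: "e x / cu\<^sup>2 * (c0 * \<rho> powr \<beta>) \<le> e x / (q x)\<^sup>2 * G x"
        using elim(2) Gl c0 by (intro mult_mono) auto
      have "e x = ?k * (e x / cu\<^sup>2 * (c0 * \<rho> powr \<beta>))"
        using c0 \<rho> elim(3) by (simp add: powr_minus field_simps)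
      also have "\<dots> \<le> ?k * (e x / (q x)\<^sup>2 * G x)"
        by (rule mult_left_mono[OF le k])
      finally show ?thesis by (simp add: indicator_def False)
    qed
  qed
  then have "(LINT x|M. e x) \<le> (LINT x|M. ?k * (e x / (q x)\<^sup>2 * G x) + cu\<^sup>2 * indicator ?S x)"
    by (intro integral_mono_AE ie Bochner_Integration.integrable_add integrable_mult_right i iS)
  also have "\<dots> = ?k * (LINT x|M. e x / (q x)\<^sup>2 * G x) + cu\<^sup>2 * measure lebesgue ?S"
    unfolding Bochner_Integration.integral_add[OF integrable_mult_right[OF i] integrable_mult_right[OF iS]]
      integral_mult_right_zero mS ..
  also have "\<dots> \<le> ?k * d + cu\<^sup>2 * (cs * \<rho>)"
    using est strip c0 by (intro add_mono mult_left_mono) auto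
  finally show ?thesis .
qed

text \<open>The choice \<open>\<rho> = \<delta>\<^bsup>1/(1+\<beta>)\<^esup>\<close> balances the two terms; for \<open>\<delta> = 0\<close> the bound tends to \<open>0\<close> with
  \<open>\<rho>\<close>.\<close>

lemma balance_strip_width:
  fixes n \<delta> K \<beta> :: real
  assumes le: "\<And>\<rho>. \<rho> > 0 \<Longrightarrow> n\<^sup>2 \<le> K * (\<rho> powr - \<beta> * \<delta> + \<rho>)"
    and "K > 0" and \<beta>: "\<beta> \<ge> 0" and "\<delta> \<ge> 0" and "n \<ge> 0"
  shows "n \<le> sqrt (2 * K) * \<delta> powr (1 / (2 * (1 + \<beta>)))"
proof (cases "\<delta> = 0")
  case True
  have "n\<^sup>2 \<le> 0 + e" if "e > 0" for e
    using le[of "e / K"] that \<open>K > 0\<close> True by simp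
  then have "n\<^sup>2 \<le> 0" by (rule field_le_epsilon)
  then show ?thesis using \<open>K > 0\<close> by simp
next
  case False
  then have \<delta>: "\<delta> > 0" using \<open>\<delta> \<ge> 0\<close> by simp
  let ?a = "1 / (2 * (1 + \<beta>))"
  define \<rho> where "\<rho> = \<delta> powr (1 / (1 + \<beta>))"
  have \<rho>: "\<rho> > 0" using \<delta> by (simp add: \<rho>_def)
  have "\<rho> powr - \<beta> * \<delta> = \<delta> powr (- \<beta> / (1 + \<beta>)) * \<delta> powr 1"
    using \<delta> by (simp add: \<rho>_def powr_powr)
  also have "\<dots> = \<delta> powr (- \<beta> / (1 + \<beta>) + 1)" by (simp only: powr_add)
  also have "- \<beta> / (1 + \<beta>) + 1 = 1 / (1 + \<beta>)" using \<beta> by (simp add: field_simps)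
  finally have "\<rho> powr - \<beta> * \<delta> = \<rho>" by (simp add: \<rho>_def)
  then have "n\<^sup>2 \<le> 2 * K * \<rho>" using le[OF \<rho>] by simp
  also have "\<rho> = (\<delta> powr ?a)\<^sup>2"
  proof -
    have "1 / (1 + \<beta>) = ?a + ?a" using \<beta> by (simp add: field_simps)
    then show ?thesis unfolding \<rho>_def power2_eq_square by (simp only: powr_add)
  qed
  also have "2 * K * (\<delta> powr ?a)\<^sup>2 = (sqrt (2 * K) * \<delta> powr ?a)\<^sup>2"
    using \<open>K > 0\<close> by (simp add: power_mult_distrib)
  finally show ?thesis using \<open>K > 0\<close> by (intro power2_le_imp_le[of n]) auto
qed

theorem theorem2p1:
  fixes \<Omega> :: "'a::euclidean_space set"
    and cl cu C :: real
    and q F :: "'a \<Rightarrow> real"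
  assumes "DIM('a) \<in> {1, 2, 3}"
    and "convex_polyhedral_domain \<Omega>"
    and "0 < cl" and "cl \<le> cu"
    and "F \<in> Linf \<Omega>"
    and "q \<in> admissible \<Omega> cl cu"
    and "q \<in> sobolev L2 2 \<Omega> \<inter> sobolev Linf 1 \<Omega>"
    and "W12_norm \<Omega> q \<le> C"
  shows "(\<exists>c>0. \<forall>qt Ft w wt.
            Ft \<in> Linf \<Omega> \<and> qt \<in> admissible \<Omega> cl cu \<and> W12_norm \<Omega> qt \<le> C \<and>
            weak_solution \<Omega> q F w \<and> weak_solution \<Omega> qt Ft wt \<longrightarrow>
            (LINT x|lebesgue_on \<Omega>. (q x - qt x)\<^sup>2 / (q x)\<^sup>2 *
                (q x * (norm (weak_grad \<Omega> w x))\<^sup>2 + F x * w x))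
              \<le> c * (W12_norm \<Omega> (\<lambda>x. w x - wt x) + L2_norm \<Omega> (\<lambda>x. F x - Ft x)))
       \<and> (\<forall>\<beta> c0. 0 \<le> \<beta> \<and> 0 < c0 \<longrightarrow>
          (\<exists>c>0. \<forall>qt Ft w wt.
            Ft \<in> Linf \<Omega> \<and> qt \<in> admissible \<Omega> cl cu \<and> W12_norm \<Omega> qt \<le> C \<and>
            weak_solution \<Omega> q F w \<and> weak_solution \<Omega> qt Ft wt \<and>
            (AE x in lebesgue_on \<Omega>. q x * (norm (weak_grad \<Omega> w x))\<^sup>2 + F x * w x
                \<ge> c0 * infdist x (frontier \<Omega>) powr \<beta>) \<longrightarrow>
            L2_norm \<Omega> (\<lambda>x. q x - qt x)
              \<le> c * (W12_norm \<Omega> (\<lambda>x. w x - wt x) + L2_norm \<Omega> (\<lambda>x. F x - Ft x))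
                      powr (1 / (2 * (1 + \<beta>)))))"
proof -
  have dom: "\<Omega> \<noteq> {}" "open \<Omega>" "convex \<Omega>" "bounded \<Omega>"
  proof -
    have "bounded (closure \<Omega>)"
      using assms(2) by (simp add: convex_polyhedral_domain_def polytope_imp_bounded)
    then show "bounded \<Omega>" using closure_subset by (rule bounded_subset)
  qed (use assms(2) in \<open>auto simp: convex_polyhedral_domain_def\<close>)
  interpret bounded_open \<Omega> by standard (use dom in auto)
  have q1: "q \<in> sobolev Linf 1 \<Omega>" using assms(7) by blast
  obtain c where c: "c > 0"
    and est: "\<forall>qt Ft w wt. Ft \<in> Linf \<Omega> \<and> qt \<in> admissible \<Omega> cl cu \<and> W12_norm \<Omega> qt \<le> C \<and>
      weak_solution \<Omega> q F w \<and> weak_solution \<Omega> qt Ft wt \<longrightarrow>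
      integrable M (\<lambda>x. (q x - qt x)\<^sup>2 / (q x)\<^sup>2 * (q x * (norm (weak_grad \<Omega> w x))\<^sup>2 + F x * w x)) \<and>
      (LINT x|M. (q x - qt x)\<^sup>2 / (q x)\<^sup>2 * (q x * (norm (weak_grad \<Omega> w x))\<^sup>2 + F x * w x))
        \<le> c * (W12_norm \<Omega> (\<lambda>x. w x - wt x) + L2_norm \<Omega> (\<lambda>x. F x - Ft x))"
    using weighted_estimate[OF assms(3,4,5,6) q1 assms(8)] by (elim exE conjE)
  obtain cs where cs: "cs \<ge> 0"
    and strip: "\<forall>\<rho>>0. measure lebesgue {x \<in> \<Omega>. infdist x (frontier \<Omega>) < \<rho>} \<le> cs * \<rho>"
    using convex_boundary_strip[OF dom(2,3,4,1)] by (elim exE conjE)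
  have second: "\<exists>c'>0. \<forall>qt Ft w wt.
            Ft \<in> Linf \<Omega> \<and> qt \<in> admissible \<Omega> cl cu \<and> W12_norm \<Omega> qt \<le> C \<and>
            weak_solution \<Omega> q F w \<and> weak_solution \<Omega> qt Ft wt \<and>
            (AE x in M. q x * (norm (weak_grad \<Omega> w x))\<^sup>2 + F x * w x
                \<ge> c0 * infdist x (frontier \<Omega>) powr \<beta>) \<longrightarrow>
            L2_norm \<Omega> (\<lambda>x. q x - qt x)
              \<le> c' * (W12_norm \<Omega> (\<lambda>x. w x - wt x) + L2_norm \<Omega> (\<lambda>x. F x - Ft x))
                      powr (1 / (2 * (1 + \<beta>)))"
    if \<beta>: "0 \<le> \<beta>" and c0: "0 < c0" for \<beta> c0
  proof -
    define K where "K = cu\<^sup>2 / c0 * c + cu\<^sup>2 * cs + 1"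
    have K: "K > 0" "cu\<^sup>2 / c0 * c \<le> K" "cu\<^sup>2 * cs \<le> K"
      using c c0 cs by (auto simp: K_def add_nonneg_pos)
    show ?thesis
    proof (intro exI[of _ "sqrt (2 * K)"] conjI allI impI)
      show "sqrt (2 * K) > 0" using K by simp
      fix qt Ft w wt
      assume A: "Ft \<in> Linf \<Omega> \<and> qt \<in> admissible \<Omega> cl cu \<and> W12_norm \<Omega> qt \<le> C \<and>
            weak_solution \<Omega> q F w \<and> weak_solution \<Omega> qt Ft wt \<and>
            (AE x in M. q x * (norm (weak_grad \<Omega> w x))\<^sup>2 + F x * w x
                \<ge> c0 * infdist x (frontier \<Omega>) powr \<beta>)"
      define \<delta> where "\<delta> = W12_norm \<Omega> (\<lambda>x. w x - wt x) + L2_norm \<Omega> (\<lambda>x. F x - Ft x)"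
      have \<delta>: "\<delta> \<ge> 0"
        unfolding \<delta>_def L2_norm_eq
        by (intro add_nonneg_nonneg n2_nonneg order_trans[OF n2_nonneg n2_le_W12_norm(1)])
      have q: "AE x in M. cl \<le> q x \<and> q x \<le> cu" and qt: "AE x in M. cl \<le> qt x \<and> qt x \<le> cu"
        using assms(6) A by (auto simp: admissible_def)
      have qm: "q \<in> borel_measurable M" "qt \<in> borel_measurable M"
        using assms(6) A by (auto simp: admissible_def L2_def)
      have e: "AE x in M. 0 \<le> (q x - qt x)\<^sup>2 \<and> (q x - qt x)\<^sup>2 \<le> cu\<^sup>2"
        using q qt
      proof eventually_elim
        case (elim x)
        then have "\<bar>q x - qt x\<bar> \<le> \<bar>cu\<bar>" using assms(3) by auto
        then show ?case by (simp only: abs_le_square_iff) simp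
      qed
      have q0: "AE x in M. 0 < q x \<and> q x \<le> cu"
        using q by (rule eventually_mono) (use assms(3) in auto)
      have em: "(\<lambda>x. (q x - qt x)\<^sup>2) \<in> borel_measurable M" using qm by simp
      have "(n2 M (\<lambda>x. q x - qt x))\<^sup>2 \<le> K * (\<rho> powr - \<beta> * \<delta> + \<rho>)" if \<rho>: "\<rho> > 0" for \<rho>
      proof -
        have "(n2 M (\<lambda>x. q x - qt x))\<^sup>2 = (LINT x|M. (q x - qt x)\<^sup>2)" by (simp add: n2_power2)
        also have "\<dots> \<le> cu\<^sup>2 / c0 * \<rho> powr - \<beta> * (c * \<delta>) + cu\<^sup>2 * (cs * \<rho>)"
          unfolding \<delta>_def
          by (rule unweighted_estimate[OF e em q0 _ c0 \<beta> _ _ strip[rule_format, OF \<rho>] \<rho>,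
                where G="\<lambda>x. q x * (norm (weak_grad \<Omega> w x))\<^sup>2 + F x * w x"])
             (use A est in blast)+
        also have "\<dots> = (cu\<^sup>2 / c0 * c) * (\<rho> powr - \<beta> * \<delta>) + (cu\<^sup>2 * cs) * \<rho>"
          by (simp add: mult_ac)
        also have "\<dots> \<le> K * (\<rho> powr - \<beta> * \<delta>) + K * \<rho>"
          using K \<delta> \<rho> by (intro add_mono mult_right_mono) auto
        finally show ?thesis by (simp add: distrib_left)
      qed
      from balance_strip_width[OF this K(1) \<beta> \<delta> n2_nonneg]
      show "L2_norm \<Omega> (\<lambda>x. q x - qt x)
              \<le> sqrt (2 * K) * (W12_norm \<Omega> (\<lambda>x. w x - wt x) + L2_norm \<Omega> (\<lambda>x. F x - Ft x))
                      powr (1 / (2 * (1 + \<beta>)))"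
        unfolding L2_norm_eq[of "\<lambda>x. q x - qt x"] \<delta>_def .
    qed
  qed
  show ?thesis
  proof (intro conjI allI impI; (elim conjE)?)
    show "\<exists>c>0. \<forall>qt Ft w wt.
            Ft \<in> Linf \<Omega> \<and> qt \<in> admissible \<Omega> cl cu \<and> W12_norm \<Omega> qt \<le> C \<and>
            weak_solution \<Omega> q F w \<and> weak_solution \<Omega> qt Ft wt \<longrightarrow>
            (LINT x|M. (q x - qt x)\<^sup>2 / (q x)\<^sup>2 *
                (q x * (norm (weak_grad \<Omega> w x))\<^sup>2 + F x * w x))
              \<le> c * (W12_norm \<Omega> (\<lambda>x. w x - wt x) + L2_norm \<Omega> (\<lambda>x. F x - Ft x))"
      using c est by blast
  qed (rule second)
qed

end
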